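(* Let $\mathcal{H}=(\mathbb{C}^2)^{\otimes n}$ and let $\mathcal{H}'$ be a finite-dimensional Hilbert space with a fixed unit vector $|0\rangle\in\mathcal{H}'$. Let $\sigma$ be the $n$-qubit state $$\sigma=(\mathcal{N}\circ\mathcal{U}_{L_\sigma}\circ\mathcal{N}\circ\cdots\circ\mathcal{N}\circ\mathcal{U}_1\circ\mathcal{N})(\rho_{in}),$$ where $\rho_{in}$ is an arbitrary $n$-qubit density operator, $\mathcal{U}_1,\dots,\mathcal{U}_{L_\sigma}$ are arbitrary unitary channels, and $\mathcal{N}=\bigotimes_{i=1}^n\mathcal{D}_i$ with $\mathcal{D}_i(\tau)=(1-p_i)\tau+p_i\mathrm{Tr}[\tau]\mathbb{I}/2$ a single-qubit depolarizing channel on qubit $i$, $p_i\in(0,1]$; let $q=\max_i(1-p_i)\in[0,1)$. For integers $M\ge1$, $k\ge0$ and any bounded operator $X$ on $\mathcal{H}^{\otimes M}\otimes\mathcal{H}'^{\otimes k}$ define $$E_{\sigma,X,M,k}=\mathrm{Tr}\big[X(\sigma^{\otimes M}\otimes|0\rangle\langle0|^{\otimes k})\big].$$ Then $$\Big|E_{\sigma,X,M,k}-\mathrm{Tr}\Big[X\Big(\frac{\mathbb{I}^{\otimes M}}{2^{Mn}}\otimes|0\rangle\langle0|^{\otimes k}\Big)\Big]\Big|\le \sqrt{\ln 4}\,\|X\|_\infty\,M\,n^{1/2}\,q^{L_\sigma+1},$$ where $\mathbb{I}$ is the $n$-qubit identity and $\|X\|_\infty$ is the operator norm.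
   Context: Quantities of the form $E_{\sigma,X,M,k}$ model expectation values estimated by error mitigation protocols: $M$ copies of a (noisily prepared) state, $k$ clean ancillas, and a general measurement operator $X$. *)

theory Defs
  imports "HOL-Analysis.Analysis" "Jordan_Normal_Form.Matrix"
begin

text \<open>Finite-dimensional operators are represented as complex matrices (Jordan_Normal_Form).
  An n-qubit operator is a 2^n x 2^n matrix; qubit i of a basis index a is the bit (a div 2^i) mod 2.\<close>

definition mtrace :: "complex mat \<Rightarrow> complex" where
  "mtrace A = (\<Sum>i<dim_row A. A $$ (i,i))"

definition madj :: "complex mat \<Rightarrow> complex mat" where
  "madj A = mat (dim_col A) (dim_row A) (\<lambda>(i,j). cnj (A $$ (j,i)))"

definition unitary_mat :: "nat \<Rightarrow> complex mat \<Rightarrow> bool" where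
  "unitary_mat d U \<longleftrightarrow> U \<in> carrier_mat d d \<and> madj U * U = 1\<^sub>m d \<and> U * madj U = 1\<^sub>m d"

definition vnorm :: "complex vec \<Rightarrow> real" where
  "vnorm v = sqrt (\<Sum>i<dim_vec v. (cmod (v $ i))^2)"

definition op_norm :: "complex mat \<Rightarrow> real" where
  "op_norm X = Sup {vnorm (X *\<^sub>v v) | v. v \<in> carrier_vec (dim_col X) \<and> vnorm v \<le> 1}"

definition density_op :: "nat \<Rightarrow> complex mat \<Rightarrow> bool" where
  "density_op n \<rho> \<longleftrightarrow> \<rho> \<in> carrier_mat (2^n) (2^n) \<and>
     (\<forall>v \<in> carrier_vec (2^n). Im ((\<rho> *\<^sub>v v) \<bullet>c v) = 0 \<and> Re ((\<rho> *\<^sub>v v) \<bullet>c v) \<ge> 0) \<and>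
     mtrace \<rho> = 1"

definition kron :: "complex mat \<Rightarrow> complex mat \<Rightarrow> complex mat" where
  "kron A B = mat (dim_row A * dim_row B) (dim_col A * dim_col B)
     (\<lambda>(i,j). A $$ (i div dim_row B, j div dim_col B) * B $$ (i mod dim_row B, j mod dim_col B))"

fun kron_pow :: "complex mat \<Rightarrow> nat \<Rightarrow> complex mat" where
  "kron_pow A 0 = 1\<^sub>m 1"
| "kron_pow A (Suc m) = kron A (kron_pow A m)"

definition ketbra :: "complex vec \<Rightarrow> complex mat" where
  "ketbra z = mat (dim_vec z) (dim_vec z) (\<lambda>(i,j). z $ i * cnj (z $ j))"

definition qbit :: "nat \<Rightarrow> nat \<Rightarrow> nat" where
  "qbit i a = (a div 2^i) mod 2"

definition set_qbit :: "nat \<Rightarrow> nat \<Rightarrow> nat \<Rightarrow> nat" where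
  "set_qbit i c a = a - qbit i a * 2^i + c * 2^i"

text \<open>(Tr_i tau) tensor I/2 on qubit i, i.e. partial trace over qubit i followed by
  inserting the maximally mixed single-qubit state on qubit i.\<close>
definition replace_mixed :: "nat \<Rightarrow> nat \<Rightarrow> complex mat \<Rightarrow> complex mat" where
  "replace_mixed n i \<tau> = mat (2^n) (2^n) (\<lambda>(a,b).
     if qbit i a = qbit i b
     then (1/2) * (\<Sum>c<2. \<tau> $$ (set_qbit i c a, set_qbit i c b))
     else 0)"

definition depol_on :: "nat \<Rightarrow> nat \<Rightarrow> real \<Rightarrow> complex mat \<Rightarrow> complex mat" where
  "depol_on n i p \<tau> = complex_of_real (1 - p) \<cdot>\<^sub>m \<tau> + complex_of_real p \<cdot>\<^sub>m replace_mixed n i \<tau>"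

text \<open>Noise layer N = D_1 tensor ... tensor D_n, realised as the composition of the
  (mutually commuting) local channels acting on the individual qubits.\<close>
definition noise :: "nat \<Rightarrow> (nat \<Rightarrow> real) \<Rightarrow> complex mat \<Rightarrow> complex mat" where
  "noise n p \<tau> = foldr (\<lambda>i t. depol_on n i (p i) t) [0..<n] \<tau>"

definition unitary_channel :: "complex mat \<Rightarrow> complex mat \<Rightarrow> complex mat" where
  "unitary_channel U \<tau> = U * \<tau> * madj U"

definition noisy_state :: "nat \<Rightarrow> (nat \<Rightarrow> real) \<Rightarrow> complex mat list \<Rightarrow> complex mat \<Rightarrow> complex mat" where
  "noisy_state n p Us \<rho> = foldl (\<lambda>\<tau> U. noise n p (unitary_channel U \<tau>)) (noise n p \<rho>) Us"

end

(*
  Write D(A) for the entropy deficit of a state A relative to the maximally mixed state.  The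
  theorem follows from the strong data processing inequality D(N(A)) <= q^2 D(A) for one layer of
  noise, Pinsker's inequality, D <= n ln 2, and telescoping over the M copies.

  Everything about relative entropy comes from one formula: D(A || B) is an integral over v in
  [0,1] of v times the supremum over K, with adjoint K', of
     2 Re tr(K' (B - A)) - v tr(K' B K) - (1 - v) tr(K A K'),
  which is affine in (A,B) for fixed K.  Let E be the dephasing by a Hermitian unitary P.  Convexity
  of the supremum gives the submodularity of the negative entropy h for two commuting dephasings,
  and replacing K by -PKP gives h(E_l A) <= l^2 h(A) + (1 - l^2) h(E A) for the partial dephasing
  E_l with parameter l.

  A depolarizing channel with parameter q = l^2 is the product of the partial X, Y and Z dephasings,
  so h(N(A)) is at most an average of h over patterns of complete dephasings.  This average is
  bounded by induction on the number of qubits.  For the qubit that is added one uses submodularity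
  and the inequality h(E_X) + h(E_Y) + h(E_Z) <= h + 2 h(E_X E_Z) for states that are diagonal on
  the other qubits; the latter holds because h is convex in the squared Bloch length.
*)
theory Submission
  imports Defs "Jordan_Normal_Form.Schur_Decomposition" "Jordan_Normal_Form.Spectral_Radius"
begin

text \<open>Why the rate comes out as q^2. The three partial dephasings have l = sqrt q, so the
  entropy inequality charges each of them the factor l^2 = q. For one qubit, with h measured from
  its fully mixed value, expanding gives at most q^3 h + q^2 (1 - q) (h_X + h_Y + h_Z), and h_X +
  h_Y + h_Z <= h turns this into q^2 h. The obstacle on n qubits is that this sum inequality is
  available only where the other qubits are diagonal, while the pattern average still contains
  undephased, entangled terms. The induction therefore carries states whose upper qubits are already
  Z-dephased, trades the missing dephasing of the current qubit for an entropy drop by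
  submodularity, and uses the sum inequality only after the lower qubits have been fully mixed.

  Logarithms call for full rank: the entropy lemmas speak of positive definite states, and a general
  input is replaced by e \<rho> + (1 - e) I/2^n. The circuit is linear and unital, so the deviation
  of the output from the mixed state is scaled by exactly e; dividing by e and letting e tend to 1
  loses nothing.\<close>

section \<open>Adjoints, traces and positive operators\<close>

no_notation vec_nth (infixl "$" 90)
no_notation inner (infix "\<bullet>" 70)

declare assoc_mult_mat [simp del] index_mult_mat(1) [simp del] index_mult_mat_vec [simp del]

abbreviation sq :: "nat \<Rightarrow> complex mat set" where
  "sq N \<equiv> carrier_mat N N"

lemma madj_carrier [simp]: "A \<in> carrier_mat m n \<Longrightarrow> madj A \<in> carrier_mat n m"
  by (auto simp: madj_def)

lemma madj_dim [simp]: "dim_row (madj A) = dim_col A" "dim_col (madj A) = dim_row A"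
  by (auto simp: madj_def)

lemma madj_index [simp]:
  "i < dim_col A \<Longrightarrow> j < dim_row A \<Longrightarrow> madj A $$ (i,j) = cnj (A $$ (j,i))"
  by (simp add: madj_def)

lemma madj_madj [simp]: "madj (madj A) = A"
  by (rule eq_matI) auto

lemma mult_index:
  assumes "A \<in> carrier_mat m n" "B \<in> carrier_mat n k" "i < m" "j < k"
  shows "(A * B) $$ (i,j) = (\<Sum>l<n. A $$ (i,l) * B $$ (l,j))"
  using assms by (auto simp: index_mult_mat(1) scalar_prod_def atLeast0LessThan intro!: sum.cong)

lemma madj_mult:
  assumes "A \<in> carrier_mat m n" "B \<in> carrier_mat n k"
  shows "madj (A * B) = madj B * madj A"
proof (rule eq_matI)
  show "dim_row (madj (A * B)) = dim_row (madj B * madj A)"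
    "dim_col (madj (A * B)) = dim_col (madj B * madj A)" using assms by auto
  fix i j assume "i < dim_row (madj B * madj A)" "j < dim_col (madj B * madj A)"
  then have ij: "i < k" "j < m" using assms by auto
  then show "madj (A * B) $$ (i,j) = (madj B * madj A) $$ (i,j)"
    using assms by (simp add: mult_index[OF assms] mult_index[OF madj_carrier[OF assms(2)] madj_carrier[OF assms(1)]] mult.commute)
qed

lemma madj_add:
  "A \<in> carrier_mat m n \<Longrightarrow> B \<in> carrier_mat m n \<Longrightarrow> madj (A + B) = madj A + madj B"
  by (rule eq_matI) auto

lemma madj_smult: "madj (c \<cdot>\<^sub>m A) = cnj c \<cdot>\<^sub>m madj A"
  by (rule eq_matI) auto

lemma madj_one [simp]: "madj (1\<^sub>m n) = 1\<^sub>m n"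
  by (rule eq_matI) auto

lemma mtrace_carrier: "A \<in> sq n \<Longrightarrow> mtrace A = (\<Sum>i<n. A $$ (i,i))"
  by (auto simp: mtrace_def)

lemma mtrace_mult:
  assumes "A \<in> carrier_mat m n" "B \<in> carrier_mat n m"
  shows "mtrace (A * B) = (\<Sum>i<m. \<Sum>j<n. A $$ (i,j) * B $$ (j,i))"
  using assms mult_index[OF assms] by (simp add: mtrace_def)

lemma mtrace_mult_comm:
  assumes "A \<in> carrier_mat m n" "B \<in> carrier_mat n m"
  shows "mtrace (A * B) = mtrace (B * A)"
  unfolding mtrace_mult[OF assms] mtrace_mult[OF assms(2,1)]
  by (subst sum.swap) (simp add: mult.commute)

lemma mtrace_add:
  "A \<in> sq n \<Longrightarrow> B \<in> sq n \<Longrightarrow> mtrace (A + B) = mtrace A + mtrace B"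
  by (auto simp: mtrace_def sum.distrib)

lemma mtrace_minus:
  "A \<in> sq n \<Longrightarrow> B \<in> sq n \<Longrightarrow> mtrace (A - B) = mtrace A - mtrace B"
  by (auto simp: mtrace_def sum_subtractf)

lemma mtrace_smult: "A \<in> sq n \<Longrightarrow> mtrace (c \<cdot>\<^sub>m A) = c * mtrace A"
  by (auto simp: mtrace_def sum_distrib_left)

lemma mult_vec_index:
  assumes "A \<in> carrier_mat m n" "v \<in> carrier_vec n" "i < m"
  shows "(A *\<^sub>v v) $ i = (\<Sum>l<n. A $$ (i,l) * v $ l)"
  using assms by (auto simp: index_mult_mat_vec scalar_prod_def atLeast0LessThan intro!: sum.cong)

lemma cprod_sum:
  assumes "w \<in> carrier_vec n"
  shows "v \<bullet>c w = (\<Sum>i<n. v $ i * cnj (w $ i))"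
  using assms by (auto simp: scalar_prod_def atLeast0LessThan intro!: sum.cong)

lemma cprod_mult_adj:
  assumes "A \<in> carrier_mat m n" "v \<in> carrier_vec n" "w \<in> carrier_vec m"
  shows "(A *\<^sub>v v) \<bullet>c w = v \<bullet>c (madj A *\<^sub>v w)"
proof -
  have "(A *\<^sub>v v) \<bullet>c w = (\<Sum>i<m. \<Sum>l<n. A $$ (i,l) * v $ l * cnj (w $ i))"
    unfolding cprod_sum[OF assms(3)] by (intro sum.cong refl) (simp add: mult_vec_index[OF assms(1,2)] sum_distrib_right)
  also have "\<dots> = (\<Sum>l<n. \<Sum>i<m. A $$ (i,l) * v $ l * cnj (w $ i))" by (rule sum.swap)
  also have "\<dots> = v \<bullet>c (madj A *\<^sub>v w)"
    using assms mult_mat_vec_carrier[OF madj_carrier[OF assms(1)] assms(3)] by (subst cprod_sum[of _ n])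
      (auto simp: mult_vec_index[OF madj_carrier[OF assms(1)] assms(3)] sum_distrib_left mult_ac intro!: sum.cong)
  finally show ?thesis .
qed

lemma sq_closed [simp]: "A \<in> sq N \<Longrightarrow> B \<in> sq N \<Longrightarrow> A * B \<in> sq N"
  by auto

lemma sq_assoc:
  "A \<in> sq N \<Longrightarrow> B \<in> sq N \<Longrightarrow> C \<in> sq N \<Longrightarrow> A * B * C = A * (B * C)"
  by (rule assoc_mult_mat)

lemma vec_closed [simp]: "A \<in> sq N \<Longrightarrow> v \<in> carrier_vec N \<Longrightarrow> A *\<^sub>v v \<in> carrier_vec N"
  by auto

lemma vnorm_sq: "v \<in> carrier_vec n \<Longrightarrow> v \<bullet>c v = complex_of_real ((vnorm v)\<^sup>2)"
  by (auto simp: cprod_sum[of v n] vnorm_def sum_nonneg complex_norm_square simp del: of_real_power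
      intro!: sum.cong)

lemma vnorm_nonneg [simp]: "vnorm v \<ge> 0"
  by (simp add: vnorm_def sum_nonneg)

lemma vnorm_eq_0: "v \<in> carrier_vec n \<Longrightarrow> vnorm v = 0 \<longleftrightarrow> v = 0\<^sub>v n"
  by (auto simp: vnorm_def sum_nonneg_eq_0_iff)

section \<open>Positive semidefinite and positive definite operators\<close>

definition psd :: "nat \<Rightarrow> complex mat \<Rightarrow> bool" where
  "psd N A \<longleftrightarrow> A \<in> sq N \<and>
     (\<forall>v \<in> carrier_vec N. Im ((A *\<^sub>v v) \<bullet>c v) = 0 \<and> Re ((A *\<^sub>v v) \<bullet>c v) \<ge> 0)"

definition pd :: "nat \<Rightarrow> complex mat \<Rightarrow> bool" where
  "pd N A \<longleftrightarrow> psd N A \<and> (\<forall>v \<in> carrier_vec N. v \<noteq> 0\<^sub>v N \<longrightarrow> Re ((A *\<^sub>v v) \<bullet>c v) > 0)"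

lemma psd_carrier: "psd N A \<Longrightarrow> A \<in> sq N"
  by (simp add: psd_def)

lemma pd_psd: "pd N A \<Longrightarrow> psd N A"
  by (simp add: pd_def)

lemma pd_carrier: "pd N A \<Longrightarrow> A \<in> sq N"
  by (simp add: psd_carrier pd_psd)

lemma quad_form_add:
  assumes "A \<in> sq N" "B \<in> sq N" "v \<in> carrier_vec N"
  shows "((A + B) *\<^sub>v v) \<bullet>c v = (A *\<^sub>v v) \<bullet>c v + (B *\<^sub>v v) \<bullet>c v"
  using assms by (simp add: add_mult_distrib_mat_vec add_scalar_prod_distrib[of _ N])

lemma quad_form_smult:
  assumes "A \<in> sq N" "v \<in> carrier_vec N"
  shows "((c \<cdot>\<^sub>m A) *\<^sub>v v) \<bullet>c v = c * ((A *\<^sub>v v) \<bullet>c v)"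
  using assms by (auto simp: index_mult_mat_vec scalar_prod_def sum_distrib_left sum_distrib_right mult.assoc intro!: sum.cong)

lemma quad_form_conj:
  assumes "A \<in> sq N" "U \<in> sq N" "v \<in> carrier_vec N"
  shows "((U * A * madj U) *\<^sub>v v) \<bullet>c v = (A *\<^sub>v (madj U *\<^sub>v v)) \<bullet>c (madj U *\<^sub>v v)"
proof -
  have "(U * A * madj U) *\<^sub>v v = U *\<^sub>v (A *\<^sub>v (madj U *\<^sub>v v))"
    using assms by (simp add: assoc_mult_mat_vec[of _ N N _ N])
  then show ?thesis using assms by (simp add: cprod_mult_adj[of _ N N] mult_mat_vec_carrier[of _ N N])
qed

lemma psd_add: "psd N A \<Longrightarrow> psd N B \<Longrightarrow> psd N (A + B)"
  by (auto simp: psd_def quad_form_add)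

lemma psd_smult: "psd N A \<Longrightarrow> c \<ge> 0 \<Longrightarrow> psd N (complex_of_real c \<cdot>\<^sub>m A)"
  by (auto simp: psd_def quad_form_smult)

lemma psd_conj:
  assumes "psd N A" "U \<in> sq N"
  shows "psd N (U * A * madj U)"
proof -
  have "A \<in> sq N" using assms by (simp add: psd_def)
  note c = this
  have m: "madj U \<in> sq N" using assms(2) by (rule madj_carrier)
  show ?thesis unfolding psd_def
  proof (intro conjI ballI)
    show "U * A * madj U \<in> sq N" by (intro sq_closed c m assms(2))
    fix v :: "complex vec" assume v: "v \<in> carrier_vec N"
    from vec_closed[OF m v] assms(1)
    show "Im (((U * A * madj U) *\<^sub>v v) \<bullet>c v) = 0" "0 \<le> Re (((U * A * madj U) *\<^sub>v v) \<bullet>c v)"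
      unfolding quad_form_conj[OF c assms(2) v] psd_def by blast+
  qed
qed

lemma pd_add_psd: "pd N A \<Longrightarrow> psd N B \<Longrightarrow> pd N (A + B)"
  unfolding pd_def using psd_add[of N A B] psd_carrier[of N A] psd_carrier[of N B]
  by (metis add_pos_nonneg psd_def quad_form_add plus_complex.sel(1))

lemma pd_smult: "pd N A \<Longrightarrow> c > 0 \<Longrightarrow> pd N (complex_of_real c \<cdot>\<^sub>m A)"
  unfolding pd_def by (auto simp: psd_smult quad_form_smult[of _ N] dest: psd_carrier)

section \<open>Unitary matrices and unitary conjugation\<close>

lemma unitary_matD:
  assumes "unitary_mat N U"
  shows "U \<in> sq N" "madj U \<in> sq N" "madj U * U = 1\<^sub>m N" "U * madj U = 1\<^sub>m N"
  using assms by (auto simp: unitary_mat_def)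

lemma unitary_madj: "unitary_mat N U \<Longrightarrow> unitary_mat N (madj U)"
  by (auto simp: unitary_mat_def)

lemma unitary_one: "unitary_mat N (1\<^sub>m N)"
  by (auto simp: unitary_mat_def)

lemma unitary_cancel:
  assumes "unitary_mat N U" "A \<in> sq N"
  shows "madj U * (U * A) = A" "U * (madj U * A) = A"
proof -
  note u = unitary_matD[OF assms(1)]
  show "madj U * (U * A) = A" 
    using assoc_mult_mat[OF u(2,1) assms(2)] u(3) left_mult_one_mat[OF assms(2)] by simp
  show "U * (madj U * A) = A"
    using assoc_mult_mat[OF u(1,2) assms(2)] u(4) left_mult_one_mat[OF assms(2)] by simp
qed

lemma unitary_mult:
  assumes "unitary_mat N U" "unitary_mat N V"
  shows "unitary_mat N (U * V)"
proof -
  note u = unitary_matD[OF assms(1)] and v = unitary_matD[OF assms(2)]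
  have "madj (U * V) * (U * V) = madj V * (madj U * (U * V))"
    using u(1,2) v(1,2) by (simp add: madj_mult[of _ N N _ N] assoc_mult_mat[of _ N N _ N _ N])
  moreover have "(U * V) * madj (U * V) = U * (V * (madj V * madj U))"
    using u(1,2) v(1,2) by (simp add: madj_mult[of _ N N _ N] assoc_mult_mat[of _ N N _ N _ N])
  ultimately show ?thesis using u v unfolding unitary_mat_def
    by (simp add: unitary_cancel[OF assms(1)] unitary_cancel[OF assms(2)])
qed

lemma pd_conj:
  assumes "pd N A" "unitary_mat N U"
  shows "pd N (U * A * madj U)"
proof -
  note u = unitary_matD[OF assms(2)]
  note c = pd_carrier[OF assms(1)]
  have "madj U *\<^sub>v v \<noteq> 0\<^sub>v N" if "v \<in> carrier_vec N" "v \<noteq> 0\<^sub>v N" for v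
  proof
    assume "madj U *\<^sub>v v = 0\<^sub>v N"
    then have "U *\<^sub>v (madj U *\<^sub>v v) = 0\<^sub>v N" using u(1) by (intro eq_vecI) (auto simp: index_mult_mat_vec)
    then have "(U * madj U) *\<^sub>v v = 0\<^sub>v N" using u(1,2) that by (simp add: assoc_mult_mat_vec[of _ N N _ N])
    then show False using u that by simp
  qed
  note nz = this
  show ?thesis unfolding pd_def
  proof (intro conjI ballI impI)
    show "psd N (U * A * madj U)" using psd_conj[OF pd_psd[OF assms(1)] u(1)] .
    fix v :: "complex vec" assume v: "v \<in> carrier_vec N" "v \<noteq> 0\<^sub>v N"
    from vec_closed[OF u(2) v(1)] assms(1) nz[OF v]
    show "0 < Re (((U * A * madj U) *\<^sub>v v) \<bullet>c v)"
      unfolding quad_form_conj[OF c u(1) v(1)] pd_def by blast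
  qed
qed

text \<open>Polarization over the complex numbers: besides diagonal terms, the form at e_i + c e_j
  sees A_ij c + A_ji cnj c, so c = 1 and c = \<i> together pin A_ji to the conjugate of A_ij. This
  supplies self-adjointness for \<open>psd\<close>, whose definition speaks only of the quadratic
  form.\<close>

lemma real_quad_form_hermitian:
  assumes A: "A \<in> sq N" and im: "\<And>v. v \<in> carrier_vec N \<Longrightarrow> Im ((A *\<^sub>v v) \<bullet>c v) = 0"
  shows "madj A = A"
proof -
  have im': "Im (\<Sum>k<N. \<Sum>l<N. A $$ (k,l) * f l * cnj (f k)) = 0" for f
  proof -
    have "(A *\<^sub>v vec N f) \<bullet>c vec N f = (\<Sum>k<N. \<Sum>l<N. A $$ (k,l) * f l * cnj (f k))"
      by (subst cprod_sum[of _ N])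
        (auto simp: mult_vec_index[OF A] sum_distrib_right intro!: sum.cong)
    then show ?thesis using im[of "vec N f"] by simp
  qed
  have ev: "(\<Sum>k<N. \<Sum>l<N. A $$ (k,l) * f l * cnj (f k)) =
      A $$ (i,i) + A $$ (i,j) * c + A $$ (j,i) * cnj c + A $$ (j,j) * c * cnj c"
    if "i < N" "j < N" "i \<noteq> j" "f = (\<lambda>k. if k = i then 1 else if k = j then c else 0)" for i j c f
  proof -
    have "(\<Sum>l<N. A $$ (k,l) * f l * cnj (f k)) = (\<Sum>l\<in>{i,j}. A $$ (k,l) * f l * cnj (f k))" for k
      using that by (intro sum.mono_neutral_right) auto
    then have "(\<Sum>k<N. \<Sum>l<N. A $$ (k,l) * f l * cnj (f k)) =
        (\<Sum>k<N. \<Sum>l\<in>{i,j}. A $$ (k,l) * f l * cnj (f k))" by simp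
    also have "\<dots> = (\<Sum>k\<in>{i,j}. \<Sum>l\<in>{i,j}. A $$ (k,l) * f l * cnj (f k))"
      using that by (intro sum.mono_neutral_right) auto
    also have "\<dots> = A $$ (i,i) + A $$ (i,j) * c + A $$ (j,i) * cnj c + A $$ (j,j) * c * cnj c"
      using that by simp
    finally show ?thesis .
  qed
  have d: "Im (A $$ (k,k)) = 0" if "k < N" for k
  proof -
    let ?f = "\<lambda>l. if l = k then 1 else 0 :: complex"
    have "(\<Sum>l<N. A $$ (k',l) * ?f l * cnj (?f k')) = A $$ (k',k) * cnj (?f k')" for k'
      using that by (subst sum.remove[of _ k]) (auto intro!: sum.neutral)
    then have "(\<Sum>k'<N. \<Sum>l<N. A $$ (k',l) * ?f l * cnj (?f k')) = (\<Sum>k'<N. A $$ (k',k) * cnj (?f k'))"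
      by simp
    also have "\<dots> = A $$ (k,k)"
      using that by (subst sum.remove[of _ k]) (auto intro!: sum.neutral)
    finally show ?thesis using im'[of ?f] by simp
  qed
  have e: "cnj (A $$ (j,i)) = A $$ (i,j)" if "i < N" "j < N" for i j
  proof (cases "i = j")
    case True
    then show ?thesis using d that by (simp add: complex_eq_iff)
  next
    case False
    have "Im (A $$ (i,j)) + Im (A $$ (j,i)) = 0"
      using im'[of "\<lambda>k. if k = i then 1 else if k = j then 1 else 0"] that False d[of i] d[of j]
      by (subst (asm) ev[of i j _ 1]) auto
    moreover have "Re (A $$ (i,j)) - Re (A $$ (j,i)) = 0"
      using im'[of "\<lambda>k. if k = i then 1 else if k = j then \<i> else 0"] that False d[of i] d[of j]
      by (subst (asm) ev[of i j _ "\<i>"]) auto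
    ultimately show ?thesis by (simp add: complex_eq_iff)
  qed
  show ?thesis
  proof (rule eq_matI)
    fix i j assume "i < dim_row A" "j < dim_col A"
    then show "madj A $$ (i,j) = A $$ (i,j)" using A e[of i j] by (metis carrier_matD madj_index)
  qed (use A in auto)
qed

lemma psd_hermitian: "psd N A \<Longrightarrow> madj A = A"
  using real_quad_form_hermitian[of A N] unfolding psd_def by blast

section \<open>The spectral theorem\<close>

text \<open>Completing v to a basis and orthogonalizing keeps v in front; dividing the columns by
  their norms then makes the matrix unitary, so column 0 is a multiple of v.\<close>

lemma unitary_completion:
  assumes v: "(v :: complex vec) \<in> carrier_vec n" "v \<noteq> 0\<^sub>v n" and n: "n \<noteq> 0"
  shows "\<exists>W c. unitary_mat n W \<and> col W 0 = c \<cdot>\<^sub>v v"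
proof -
  interpret cof_vec_space n "TYPE(complex)" .
  define b where "b = basis_completion v"
  define ws where "ws = gram_schmidt n b"
  from basis_completion[OF v, folded b_def]
  have dist_b: "distinct b" and indep: "\<not> lin_dep (set b)" and b: "set b \<subseteq> carrier_vec n"
    and hdb: "hd b = v" and len_b: "length b = n" by auto
  from hdb len_b n obtain vs where bv: "b = v # vs" by (cases b) auto
  from gram_schmidt_result[OF b dist_b indep refl, folded ws_def]
  have ws: "set ws \<subseteq> carrier_vec n" "corthogonal ws" "length ws = n" by (auto simp: len_b)
  from gram_schmidt_hd[OF v(1), of vs, folded bv] have hdws: "hd ws = v" unfolding ws_def .
  have wc: "ws ! i \<in> carrier_vec n" if "i < n" for i using ws that by auto
  have ws0: "ws ! 0 = v" using hdws ws n by (metis hd_conv_nth list.size(3))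
  have nz: "vnorm (ws ! i) \<noteq> 0" if "i < n" for i
  proof
    assume "vnorm (ws ! i) = 0"
    then have "ws ! i \<bullet>c ws ! i = 0" using vnorm_sq[OF wc[OF that]] by simp
    then show False using corthogonalD[OF ws(2), of i i] that ws by simp
  qed
  define W where "W = mat n n (\<lambda>(i,j). ws ! j $ i / complex_of_real (vnorm (ws ! j)))"
  have W: "W \<in> sq n" by (simp add: W_def)
  have 1: "madj W * W = 1\<^sub>m n"
  proof (rule eq_matI)
    fix i j assume "i < dim_row (1\<^sub>m n :: complex mat)" "j < dim_col (1\<^sub>m n :: complex mat)"
    then have ij: "i < n" "j < n" by auto
    have "(madj W * W) $$ (i,j) = (\<Sum>l<n. madj W $$ (i,l) * W $$ (l,j))"
      by (rule mult_index[OF madj_carrier[OF W] W ij])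
    also have "\<dots> = (\<Sum>l<n. ws ! j $ l * cnj (ws ! i $ l)) / (vnorm (ws ! i) * vnorm (ws ! j))"
      unfolding sum_divide_distrib using ij W by (intro sum.cong) (auto simp: W_def)
    also have "\<dots> = (ws ! j \<bullet>c ws ! i) / (vnorm (ws ! i) * vnorm (ws ! j))"
      by (simp add: cprod_sum[OF wc[OF ij(1)]])
    also have "\<dots> = 1\<^sub>m n $$ (i,j)"
    proof (cases "i = j")
      case True
      have "ws ! i \<bullet>c ws ! i = complex_of_real (vnorm (ws ! i)) * complex_of_real (vnorm (ws ! i))"
        unfolding vnorm_sq[OF wc[OF ij(1)]] by (simp add: power2_eq_square)
      then show ?thesis using True nz[OF ij(1)] ij by simp
    next
      case False
      then show ?thesis using corthogonalD[OF ws(2), of j i] ij ws by simp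
    qed
    finally show "(madj W * W) $$ (i,j) = 1\<^sub>m n $$ (i,j)" .
  qed (use W in auto)
  have "unitary_mat n W" unfolding unitary_mat_def
    using mat_mult_left_right_inverse[OF madj_carrier[OF W] W 1] 1 W by simp
  moreover have "col W 0 = (1 / complex_of_real (vnorm v)) \<cdot>\<^sub>v v"
    using n v(1) ws0 by (intro eq_vecI) (auto simp: W_def)
  ultimately show ?thesis by blast
qed

abbreviation rdiag :: "nat \<Rightarrow> (nat \<Rightarrow> real) \<Rightarrow> complex mat" where
  "rdiag N r \<equiv> mat_diag N (\<lambda>i. complex_of_real (r i))"

text \<open>A relation, because eigenbases are not unique: the same matrix will be paired with two
  different ones in \<open>rel_ent_twirl_chain\<close>. The eigenvalues come in no particular
  order.\<close>

definition spec :: "nat \<Rightarrow> complex mat \<Rightarrow> complex mat \<Rightarrow> (nat \<Rightarrow> real) \<Rightarrow> bool" where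
  "spec N A U r \<longleftrightarrow> unitary_mat N U \<and> A = U * rdiag N r * madj U"

lemma conj_assoc:
  assumes "A \<in> sq N" "U \<in> sq N" "V \<in> sq N"
  shows "U * (V * A * madj V) * madj U = (U * V) * A * madj (U * V)"
  using assms by (simp add: madj_mult[of _ N N] assoc_mult_mat[of _ N N _ N _ N])

lemma spec_conj:
  assumes "spec N A V r" "unitary_mat N U"
  shows "spec N (U * A * madj U) (U * V) r"
  using assms unitary_mult[OF assms(2)] unitary_matD(1)[of N U] unitary_matD(1)[of N V]
  unfolding spec_def by (auto simp: conj_assoc[of _ N])

lemma madj_four_block:
  assumes "A \<in> sq a" "P \<in> sq b"
  shows "madj (four_block_mat A (0\<^sub>m a b) (0\<^sub>m b a) P) = four_block_mat (madj A) (0\<^sub>m a b) (0\<^sub>m b a) (madj P)"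
  using assms by (intro eq_matI) auto

lemma mult_four_block_diag:
  assumes "A \<in> sq a" "P \<in> sq b" "B \<in> sq a" "Q \<in> sq b"
  shows "four_block_mat A (0\<^sub>m a b) (0\<^sub>m b a) P * four_block_mat B (0\<^sub>m a b) (0\<^sub>m b a) Q
    = four_block_mat (A * B) (0\<^sub>m a b) (0\<^sub>m b a) (P * (Q :: complex mat))"
  using assms by (subst mult_four_block_mat[of _ a a _ b _ b _ _ a _ b]) auto

text \<open>Deflation: a unitary whose first column is an eigenvector turns A into a matrix whose
  first column is e times a unit vector. Self-adjointness clears the first row as well and makes e
  real, so the induction continues on the lower right block.\<close>

theorem hermitian_spec:
  assumes "A \<in> sq N" "madj A = A"
  shows "\<exists>U r. spec N A U r"
  using assms
proof (induction N arbitrary: A)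
  case 0
  then have "spec 0 A (1\<^sub>m 0) (\<lambda>_. 0)" by (auto simp: spec_def unitary_one)
  then show ?case by blast
next
  case (Suc m)
  note A = Suc.prems(1)
  have "spectrum A \<noteq> {}" using spectrum_non_empty[OF A] by simp
  then obtain e v where ev: "eigenvector A v e" by (auto simp: spectrum_def eigenvalue_def)
  then have v: "v \<in> carrier_vec (Suc m)" "v \<noteq> 0\<^sub>v (Suc m)" and Av: "A *\<^sub>v v = e \<cdot>\<^sub>v v"
    using A by (auto simp: eigenvector_def)
  obtain W c where W: "unitary_mat (Suc m) W" and col: "col W 0 = c \<cdot>\<^sub>v v"
    using unitary_completion[OF v] by auto
  note w = unitary_matD[OF W]
  define B where "B = madj W * A * W"
  have B: "B \<in> sq (Suc m)" unfolding B_def by (intro sq_closed w A)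
  have Bh: "madj B = B" unfolding B_def using w A Suc.prems(2)
    by (simp add: madj_mult[of _ "Suc m" "Suc m" _ "Suc m"] assoc_mult_mat[of _ "Suc m" "Suc m" _ "Suc m" _ "Suc m"])
  have colB: "col B 0 = e \<cdot>\<^sub>v unit_vec (Suc m) 0"
  proof -
    have "col B 0 = (madj W * A) *\<^sub>v col W 0" unfolding B_def using w A by (intro col_mult2) auto
    also have "\<dots> = madj W *\<^sub>v (A *\<^sub>v (c \<cdot>\<^sub>v v))" unfolding col 
      using w A v by (intro assoc_mult_mat_vec) auto
    also have "A *\<^sub>v (c \<cdot>\<^sub>v v) = e \<cdot>\<^sub>v (c \<cdot>\<^sub>v v)"
      using A v Av by (simp add: mult_mat_vec smult_smult_assoc mult.commute)
    also have "madj W *\<^sub>v (e \<cdot>\<^sub>v (c \<cdot>\<^sub>v v)) = e \<cdot>\<^sub>v (madj W *\<^sub>v col W 0)"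
      unfolding col using w(2) v(1) by (intro mult_mat_vec) auto
    also have "madj W *\<^sub>v col W 0 = col (madj W * W) 0" using w by (intro col_mult2[symmetric]) auto
    finally show ?thesis unfolding w(3) by simp
  qed
  have B0: "B $$ (i,0) = (if i = 0 then e else 0)" if "i < Suc m" for i
    using arg_cong[OF colB, of "\<lambda>x. x $ i"] that B by auto
  have B0': "B $$ (0,i) = (if i = 0 then cnj e else 0)" if "i < Suc m" for i
    using B0[OF that] B that arg_cong[OF Bh, of "\<lambda>X. X $$ (0,i)"] by (auto split: if_splits)
  have er: "complex_of_real (Re e) = e" using B0[of 0] B0'[of 0] by (simp add: complex_eq_iff)
  define A3 where "A3 = mat m m (\<lambda>(i,j). B $$ (Suc i, Suc j))"
  have A3: "A3 \<in> sq m" by (simp add: A3_def)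
  have "madj A3 = A3"
  proof (rule eq_matI)
    fix i j assume "i < dim_row A3" "j < dim_col A3"
    then have "i < m" "j < m" by (auto simp: A3_def)
    then show "madj A3 $$ (i,j) = A3 $$ (i,j)"
      using arg_cong[OF Bh, of "\<lambda>X. X $$ (Suc i, Suc j)"] B A3 by (simp add: A3_def)
  qed (auto simp: A3_def)
  from Suc.IH[OF A3 this] obtain P r where P: "unitary_mat m P" and A3P: "A3 = P * rdiag m r * madj P"
    by (auto simp: spec_def)
  note p = unitary_matD[OF P]
  let ?F = "\<lambda>X Y. four_block_mat X (0\<^sub>m 1 m) (0\<^sub>m m 1) Y :: complex mat"
  define Q where "Q = ?F (1\<^sub>m 1) P"
  define s where "s = case_nat (Re e) r"
  have Q: "Q \<in> sq (Suc m)" unfolding Q_def using p by auto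
  have Qm: "madj Q = ?F (1\<^sub>m 1) (madj P)" unfolding Q_def by (subst madj_four_block) (use p in auto)
  have "?F (1\<^sub>m 1) (1\<^sub>m m) = 1\<^sub>m (Suc m)" using four_block_one_mat[of 1 m] by simp
  then have QU: "unitary_mat (Suc m) Q" unfolding unitary_mat_def Qm using Q p
    by (auto simp: Q_def mult_four_block_diag)
  have sd: "rdiag (Suc m) s = ?F (rdiag 1 (\<lambda>_. Re e)) (rdiag m r)"
    by (rule eq_matI) (auto simp: mat_diag_def s_def split: nat.split)
  have "B = ?F (rdiag 1 (\<lambda>_. Re e)) A3"
  proof (rule eq_matI)
    let ?R = "?F (rdiag 1 (\<lambda>_. Re e)) A3"
    fix i j assume "i < dim_row ?R" "j < dim_col ?R"
    then have "i < Suc m" "j < Suc m" using A3 by (auto simp: mat_diag_def)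
    then show "B $$ (i,j) = ?R $$ (i,j)"
      using B0[of i] B0'[of j] er A3 by (cases i; cases j) (auto simp: mat_diag_def A3_def)
  qed (use B A3 in \<open>auto simp: mat_diag_def\<close>)
  also have "\<dots> = Q * rdiag (Suc m) s * madj Q"
    unfolding Qm sd unfolding Q_def using p A3P
    by (simp add: mult_four_block_diag[where a=1 and b=m] left_mult_one_mat[of _ 1 1] right_mult_one_mat[of _ 1 1] del: One_nat_def)
  finally have "spec (Suc m) B Q s" using QU by (simp add: spec_def)
  from spec_conj[OF this W] have "spec (Suc m) (W * B * madj W) (W * Q) s" .
  moreover have "W * B * madj W = A" unfolding B_def using w A
    by (simp add: assoc_mult_mat[of _ "Suc m" "Suc m" _ "Suc m" _ "Suc m"] unitary_cancel[OF W])
  ultimately show ?case by auto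
qed

lemma specD:
  assumes "spec N A U r"
  shows "unitary_mat N U" "A = U * rdiag N r * madj U" "A \<in> sq N"
proof -
  show "unitary_mat N U" "A = U * rdiag N r * madj U" using assms by (auto simp: spec_def)
  then show "A \<in> sq N" using unitary_matD(1,2)[of N U] by (auto intro!: sq_closed)
qed

lemma spec_diag:
  assumes "spec N A U r"
  shows "madj U * A * U = rdiag N r"
  using specD[OF assms] unitary_matD[of N U] by (simp add: unitary_cancel[of N] sq_assoc[of _ N] right_mult_one_mat[of _ N N])

lemma spec_eigenvector_form:
  assumes "spec N A U r" "i < N"
  shows "(A *\<^sub>v col U i) \<bullet>c col U i = complex_of_real (r i)" "col U i \<noteq> 0\<^sub>v N" "vnorm (col U i) = 1"
proof -
  note s = specD[OF assms(1)] and u = unitary_matD[OF specD(1)[OF assms(1)]]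
  have c: "col U i \<in> carrier_vec N" using u(1) by auto
  have "A * U = U * rdiag N r" using s(2) u by (simp add: unitary_cancel[of N] sq_assoc[of _ N] right_mult_one_mat[of _ N N])
  then have "A *\<^sub>v col U i = col (U * rdiag N r) i" using s(3) u(1) assms(2) by (metis col_mult2)
  then have A: "A *\<^sub>v col U i = complex_of_real (r i) \<cdot>\<^sub>v col U i"
    using u(1) assms(2) by (auto simp: mat_diag_mult_right[of _ N])
  have 1: "col U i \<bullet>c col U i = 1"
  proof -
    have "(\<Sum>l<N. madj U $$ (i,l) * U $$ (l,i)) = 1"
      using arg_cong[OF u(3), of "\<lambda>X. X $$ (i,i)"] assms(2) 
      unfolding mult_index[OF u(2,1) assms(2) assms(2)] by simp
    moreover have "col U i \<bullet>c col U i = (\<Sum>l<N. madj U $$ (i,l) * U $$ (l,i))"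
      unfolding cprod_sum[OF c] using u(1) assms(2) by (intro sum.cong) auto
    ultimately show ?thesis by simp
  qed
  then show "(A *\<^sub>v col U i) \<bullet>c col U i = complex_of_real (r i)" 
    unfolding A using c by simp
  show "col U i \<noteq> 0\<^sub>v N" using 1 by auto
  have "(vnorm (col U i))\<^sup>2 = 1" using 1 unfolding vnorm_sq[OF c] by (metis of_real_eq_1_iff)
  then show "vnorm (col U i) = 1" using power2_eq_iff_nonneg[of "vnorm (col U i)" 1] by simp
qed

lemma psd_spec:
  assumes "psd N A"
  obtains U r where "spec N A U r" "\<And>i. i < N \<Longrightarrow> r i \<ge> 0"
proof -
  obtain U r where s: "spec N A U r" using hermitian_spec[OF psd_carrier[OF assms] psd_hermitian[OF assms]] by auto
  have "r i \<ge> 0" if "i < N" for i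
    using spec_eigenvector_form[OF s that] assms unitary_matD(1)[OF specD(1)[OF s]]
    unfolding psd_def by (metis Re_complex_of_real carrier_matD(1) col_dim)
  with s that show ?thesis by blast
qed

lemma spec_pd_pos:
  assumes "pd N A" "spec N A U r" "i < N"
  shows "r i > 0"
  using spec_eigenvector_form[OF assms(2,3)] assms(1) unitary_matD(1)[OF specD(1)[OF assms(2)]]
  unfolding pd_def by (metis Re_complex_of_real carrier_matD(1) col_dim)

lemma pd_spec:
  assumes "pd N A"
  obtains U r where "spec N A U r" "\<And>i. i < N \<Longrightarrow> r i > 0"
  using psd_spec[OF pd_psd[OF assms]] spec_pd_pos[OF assms] by metis

section \<open>A variational integral formula for relative entropy\<close>

lemma cnj_mult_self: "cnj z * z = (complex_of_real (cmod z))\<^sup>2"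
  by (metis complex_norm_square mult.commute of_real_power)

lemma mult_cnj_self: "z * cnj z = (complex_of_real (cmod z))\<^sup>2"
  by (metis complex_norm_square of_real_power)

text \<open>For positive operators and v in [0,1] this is concave in K, and its maximum is the
  quadratic form at \<Delta> of the inverse of v L + (1 - v) R, where L is left multiplication by
  \<sigma> and R right multiplication by \<rho>. \<Delta> stands for \<sigma> - \<rho>, but is an
  argument of its own so that it can be rescaled while \<sigma> and \<rho> stay.\<close>

definition qform :: "real \<Rightarrow> complex mat \<Rightarrow> complex mat \<Rightarrow> complex mat \<Rightarrow> complex mat \<Rightarrow> real" where
  "qform v \<Delta> \<sigma> \<rho> K = 2 * Re (mtrace (madj K * \<Delta>)) - v * Re (mtrace (madj K * (\<sigma> * K)))
     - (1 - v) * Re (mtrace (K * (\<rho> * madj K)))"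

lemma mtrace_unitary_conj:
  assumes "unitary_mat N U" "A \<in> sq N"
  shows "mtrace (U * A * madj U) = mtrace A" "mtrace (madj U * A * U) = mtrace A"
proof -
  note u = unitary_matD[OF assms(1)]
  have "mtrace ((U * A) * madj U) = mtrace (madj U * (U * A))"
    by (rule mtrace_mult_comm) (use u assms in auto)
  then show "mtrace (U * A * madj U) = mtrace A" by (simp only: unitary_cancel[OF assms])
  have "mtrace ((madj U * A) * U) = mtrace (U * (madj U * A))"
    by (rule mtrace_mult_comm) (use u assms in auto)
  then show "mtrace (madj U * A * U) = mtrace A" by (simp only: unitary_cancel[OF assms])
qed

text \<open>Different unitaries act on the two sides of K, so \<sigma> and \<rho> can be
  diagonalized at once, each in its own eigenbasis.\<close>

lemma qform_unitary:
  assumes U: "unitary_mat N U" and V: "unitary_mat N V"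
    and c: "\<Delta> \<in> sq N" "\<sigma> \<in> sq N" "\<rho> \<in> sq N" "K \<in> sq N"
  shows "qform v (madj V * \<Delta> * U) (madj V * \<sigma> * V) (madj U * \<rho> * U) (madj V * K * U) = qform v \<Delta> \<sigma> \<rho> K"
proof -
  note u = unitary_matD[OF U] and w = unitary_matD[OF V]
  have "madj (madj V * K * U) * (madj V * \<Delta> * U) = madj U * (madj K * \<Delta>) * U"
    using u(1,2) w(1,2) c by (simp add: madj_mult[of _ N N _ N] sq_assoc[of _ N] unitary_cancel[OF U] unitary_cancel[OF V])
  moreover have "madj (madj V * K * U) * (madj V * \<sigma> * V * (madj V * K * U)) = madj U * (madj K * (\<sigma> * K)) * U"
    using u(1,2) w(1,2) c by (simp add: madj_mult[of _ N N _ N] sq_assoc[of _ N] unitary_cancel[OF U] unitary_cancel[OF V])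
  moreover have "(madj V * K * U) * (madj U * \<rho> * U * madj (madj V * K * U)) = madj V * (K * (\<rho> * madj K)) * V"
    using u(1,2) w(1,2) c by (simp add: madj_mult[of _ N N _ N] sq_assoc[of _ N] unitary_cancel[OF U] unitary_cancel[OF V])
  ultimately show ?thesis
    using u(1,2) w(1,2) c unfolding qform_def
    by (simp add: mtrace_unitary_conj[OF U] mtrace_unitary_conj[OF V])
qed

lemma mtrace_madj_mult:
  assumes "K \<in> sq N" "A \<in> sq N"
  shows "mtrace (madj K * A) = (\<Sum>j<N. \<Sum>i<N. cnj (K $$ (j,i)) * A $$ (j,i))"
proof -
  have "mtrace (madj K * A) = (\<Sum>i<N. \<Sum>j<N. madj K $$ (i,j) * A $$ (j,i))"
    by (rule mtrace_mult) (use assms in auto)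
  also have "\<dots> = (\<Sum>i<N. \<Sum>j<N. cnj (K $$ (j,i)) * A $$ (j,i))"
    using assms by (intro sum.cong refl) auto
  also have "\<dots> = (\<Sum>j<N. \<Sum>i<N. cnj (K $$ (j,i)) * A $$ (j,i))" by (rule sum.swap)
  finally show ?thesis .
qed

text \<open>With both operators diagonal the entries of K decouple, each contributing a quadratic of
  its own.\<close>

lemma qform_diag:
  assumes "\<Delta> \<in> sq N" "K \<in> sq N"
  shows "qform v \<Delta> (rdiag N s) (rdiag N r) K =
    (\<Sum>j<N. \<Sum>i<N. 2 * Re (cnj (K $$ (j,i)) * \<Delta> $$ (j,i)) - (v * s j + (1 - v) * r i) * (cmod (K $$ (j,i)))\<^sup>2)"
proof -
  have 1: "mtrace (madj K * (rdiag N s * K)) = (\<Sum>j<N. \<Sum>i<N. of_real (s j * (cmod (K $$ (j,i)))\<^sup>2))"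
    using assms by (simp add: mtrace_madj_mult[of _ N] mat_diag_mult_left[of _ N N])
      (auto intro!: sum.cong simp: cnj_mult_self)
  have "mtrace (K * (rdiag N r * madj K)) = mtrace (rdiag N r * madj K * K)"
    using assms by (intro mtrace_mult_comm) auto
  also have "rdiag N r * madj K * K = rdiag N r * (madj K * K)"
    using assms by (simp add: sq_assoc[of _ N])
  also have "mtrace \<dots> = mtrace (madj K * K * rdiag N r)"
    using assms by (intro mtrace_mult_comm[of _ N N]) auto
  also have "madj K * K * rdiag N r = madj K * (K * rdiag N r)"
    using assms by (simp add: sq_assoc[of _ N])
  also have "mtrace \<dots> = (\<Sum>j<N. \<Sum>i<N. of_real (r i * (cmod (K $$ (j,i)))\<^sup>2))"
    using assms by (simp add: mtrace_madj_mult[of _ N] mat_diag_mult_right[of _ N N])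
      (auto intro!: sum.cong simp: cnj_mult_self)
  finally show ?thesis unfolding qform_def 1 using assms
    by (simp add: mtrace_madj_mult[of _ N] sum_subtractf sum_distrib_left algebra_simps sum.distrib)
qed

definition rel_quad :: "nat \<Rightarrow> real \<Rightarrow> complex mat \<Rightarrow> complex mat \<Rightarrow> real" where
  "rel_quad N v \<rho> \<sigma> = Sup (qform v (\<sigma> - \<rho>) \<sigma> \<rho> ` sq N)"

text \<open>For positive definite arguments this is tr(\<rho> ln \<rho> - \<rho> ln \<sigma>) - tr
  \<rho> + tr \<sigma>, see \<open>rel_ent_has_integral\<close>, reached without a matrix logarithm.
  The trace terms keep it nonnegative for operators of different trace.\<close>

definition rel_ent :: "nat \<Rightarrow> complex mat \<Rightarrow> complex mat \<Rightarrow> real" where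
  "rel_ent N \<rho> \<sigma> = integral {0..1} (\<lambda>v. v * rel_quad N v \<rho> \<sigma>)"

lemma complete_square:
  fixes k w :: complex and t m :: real
  assumes "m > 0"
  shows "2 * Re (cnj k * (w * of_real t)) - m * (cmod k)\<^sup>2 \<le> (cmod w)\<^sup>2 * t\<^sup>2 / m"
    "k = w * of_real (t / m) \<Longrightarrow> 2 * Re (cnj k * (w * of_real t)) - m * (cmod k)\<^sup>2 = (cmod w)\<^sup>2 * t\<^sup>2 / m"
proof -
  have "0 \<le> (cmod (w * of_real t - of_real m * k))\<^sup>2" by simp
  also have "\<dots> = (cmod w)\<^sup>2 * t\<^sup>2 - 2 * m * Re (cnj k * (w * of_real t)) + m\<^sup>2 * (cmod k)\<^sup>2"
    unfolding cmod_power2 by (simp add: power2_eq_square algebra_simps)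
  finally have "m * (2 * Re (cnj k * (w * of_real t)) - m * (cmod k)\<^sup>2) \<le> (cmod w)\<^sup>2 * t\<^sup>2"
    by (simp add: algebra_simps power2_eq_square)
  then show "2 * Re (cnj k * (w * of_real t)) - m * (cmod k)\<^sup>2 \<le> (cmod w)\<^sup>2 * t\<^sup>2 / m"
    using assms by (simp add: pos_le_divide_eq mult.commute)
  assume k: "k = w * of_real (t / m)"
  have "(cmod k)\<^sup>2 = (cmod w)\<^sup>2 * (t / m)\<^sup>2" unfolding k by (simp add: norm_mult power_mult_distrib norm_divide power_divide)
  moreover have "Re (cnj k * (w * of_real t)) = (cmod w)\<^sup>2 * (t / m) * t"
    unfolding k cmod_power2 by (simp add: power2_eq_square algebra_simps add_divide_distrib)
  ultimately show "2 * Re (cnj k * (w * of_real t)) - m * (cmod k)\<^sup>2 = (cmod w)\<^sup>2 * t\<^sup>2 / m"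
    using assms by (simp add: power2_eq_square field_simps)
qed

lemma qform_spec:
  assumes "spec N \<rho> U r" "spec N \<sigma> V s" "K \<in> sq N"
  defines "W \<equiv> madj V * U" and "K' \<equiv> madj V * K * U"
  shows "qform v (\<sigma> - \<rho>) \<sigma> \<rho> K =
    (\<Sum>j<N. \<Sum>i<N. 2 * Re (cnj (K' $$ (j,i)) * (W $$ (j,i) * of_real (s j - r i)))
       - (v * s j + (1 - v) * r i) * (cmod (K' $$ (j,i)))\<^sup>2)"
proof -
  note r = specD[OF assms(1)] and s = specD[OF assms(2)]
  note u = unitary_matD[OF r(1)] and w = unitary_matD[OF s(1)]
  have W: "W \<in> sq N" "K' \<in> sq N" unfolding W_def K'_def by (intro sq_closed u w assms(3))+
  have "madj V * \<sigma> * U = rdiag N s * W" unfolding W_def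
    using u w s(2) by (simp add: sq_assoc[of _ N] unitary_cancel[OF s(1)])
  moreover have "madj V * \<rho> * U = W * rdiag N r" unfolding W_def
    using u w r(2) by (simp add: sq_assoc[of _ N] unitary_cancel[OF r(1)] right_mult_one_mat[of _ N N])
  moreover have "madj V * (\<sigma> - \<rho>) * U = madj V * \<sigma> * U - madj V * \<rho> * U"
    using u w r s by (simp add: mult_minus_distrib_mat[of _ N N _ N] minus_mult_distrib_mat[of _ N N _ _ N])
  ultimately have D: "madj V * (\<sigma> - \<rho>) * U = rdiag N s * W - W * rdiag N r" by simp
  have "qform v (\<sigma> - \<rho>) \<sigma> \<rho> K = qform v (rdiag N s * W - W * rdiag N r) (rdiag N s) (rdiag N r) K'"
    using qform_unitary[OF r(1) s(1) _ s(3) r(3) assms(3), of "\<sigma> - \<rho>" v] minus_carrier_mat[OF r(3)]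
    unfolding D spec_diag[OF assms(1)] spec_diag[OF assms(2)] K'_def by simp
  also have "\<dots> = (\<Sum>j<N. \<Sum>i<N. 2 * Re (cnj (K' $$ (j,i)) * (W $$ (j,i) * of_real (s j - r i)))
       - (v * s j + (1 - v) * r i) * (cmod (K' $$ (j,i)))\<^sup>2)"
    using W by (subst qform_diag) (auto simp: mat_diag_mult_left[of _ N N] mat_diag_mult_right[of _ N N] algebra_simps intro!: sum.cong)
  finally show ?thesis .
qed

text \<open>Completing the square in each entry of K separately yields the supremum and shows that
  it is attained. W holds the overlaps of the two eigenbases.\<close>

lemma rel_quad_spec:
  assumes "spec N \<rho> U r" "spec N \<sigma> V s" "\<And>i. i < N \<Longrightarrow> r i > 0" "\<And>i. i < N \<Longrightarrow> s i > 0" "0 \<le> v" "v \<le> 1"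
  defines "W \<equiv> madj V * U"
  defines "B \<equiv> (\<Sum>j<N. \<Sum>i<N. (cmod (W $$ (j,i)))\<^sup>2 * (s j - r i)\<^sup>2 / (v * s j + (1 - v) * r i))"
  shows "rel_quad N v \<rho> \<sigma> = B"
    and "K \<in> sq N \<Longrightarrow> qform v (\<sigma> - \<rho>) \<sigma> \<rho> K \<le> rel_quad N v \<rho> \<sigma>"
proof -
  note r = specD[OF assms(1)] and s = specD[OF assms(2)]
  note u = unitary_matD[OF r(1)] and w = unitary_matD[OF s(1)]
  have m: "v * s j + (1 - v) * r i > 0" if "i < N" "j < N" for i j
  proof (cases "v = 0")
    case False
    then have "v * s j > 0" "(1 - v) * r i \<ge> 0" using assms(3-6) that by (auto simp: less_imp_le)
    then show ?thesis by linarith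
  qed (use assms(3) that in auto)
  have le: "qform v (\<sigma> - \<rho>) \<sigma> \<rho> K \<le> B" if "K \<in> sq N" for K
    unfolding qform_spec[OF assms(1,2) that] B_def W_def
    by (intro sum_mono complete_square(1) m) auto
  \<comment> \<open>The entrywise maximizer from \<open>complete_square\<close>, written in the two
    eigenbases and then transported back.\<close>
  define K' where "K' = mat N N (\<lambda>(j,i). W $$ (j,i) * of_real ((s j - r i) / (v * s j + (1 - v) * r i)))"
  have K': "K' \<in> sq N" by (simp add: K'_def)
  define K where "K = V * K' * madj U"
  have K: "K \<in> sq N" unfolding K_def by (intro sq_closed u w K')
  have "madj V * K * U = K'" unfolding K_def using u w K'
    by (simp add: sq_assoc[of _ N] unitary_cancel[OF s(1)] right_mult_one_mat[of _ N N])
  then have eq: "qform v (\<sigma> - \<rho>) \<sigma> \<rho> K = B"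
    unfolding qform_spec[OF assms(1,2) K] B_def W_def[symmetric]
    by (intro sum.cong refl complete_square(2) m) (auto simp: K'_def)
  show R: "rel_quad N v \<rho> \<sigma> = B" unfolding rel_quad_def
    by (rule cSup_eq_maximum) (use eq K le in auto)
  show "K \<in> sq N \<Longrightarrow> qform v (\<sigma> - \<rho>) \<sigma> \<rho> K \<le> rel_quad N v \<rho> \<sigma>" for K
    unfolding R by (rule le)
qed

lemma rel_ent_kernel_integral:
  fixes r s :: real
  assumes "r > 0" "s > 0"
  shows "((\<lambda>v. v * ((s - r)\<^sup>2 / (v * s + (1 - v) * r))) has_integral (r * ln r - r * ln s - r + s)) {0..1}"
proof -
  \<comment> \<open>With m = v s + (1 - v) r one has v (s - r) = m - r, so the integrand equals (s -
    r) - r (s - r) / m.\<close>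
  define F where "F = (\<lambda>v. (s - r) * v - r * ln (v * s + (1 - v) * r))"
  have m: "v * s + (1 - v) * r > 0" if "v \<in> {0..1}" for v
  proof (cases "v = 0")
    case False
    then have "v * s > 0" "(1 - v) * r \<ge> 0" using assms that by auto
    then show ?thesis by linarith
  qed (use assms in auto)
  have "((\<lambda>v. v * ((s - r)\<^sup>2 / (v * s + (1 - v) * r))) has_integral (F 1 - F 0)) {0..1}"
  proof (rule fundamental_theorem_of_calculus)
    fix v :: real assume v: "v \<in> {0..1}"
    have "(F has_real_derivative ((s - r) - r * ((s - r) / (v * s + (1 - v) * r)))) (at v within {0..1})"
      unfolding F_def using m[OF v] by (auto intro!: derivative_eq_intros)
    also have "(s - r) - r * ((s - r) / (v * s + (1 - v) * r)) = v * ((s - r)\<^sup>2 / (v * s + (1 - v) * r))"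
      using m[OF v] by (simp add: field_simps power2_eq_square)
    finally show "(F has_vector_derivative v * ((s - r)\<^sup>2 / (v * s + (1 - v) * r))) (at v within {0..1})"
      by (simp add: has_real_derivative_iff_has_vector_derivative)
  qed simp
  moreover have "F 1 - F 0 = r * ln r - r * ln s - r + s" by (simp add: F_def algebra_simps)
  ultimately show ?thesis by simp
qed

lemma rel_ent_has_integral:
  assumes "spec N \<rho> U r" "spec N \<sigma> V s" "\<And>i. i < N \<Longrightarrow> r i > 0" "\<And>i. i < N \<Longrightarrow> s i > 0"
  defines "W \<equiv> madj V * U"
  defines "D \<equiv> (\<Sum>j<N. \<Sum>i<N. (cmod (W $$ (j,i)))\<^sup>2 * (r i * ln (r i) - r i * ln (s j) - r i + s j))"
  shows "((\<lambda>v. v * rel_quad N v \<rho> \<sigma>) has_integral D) {0..1}" "rel_ent N \<rho> \<sigma> = D"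
proof -
  have "((\<lambda>v. \<Sum>j<N. \<Sum>i<N. (cmod (W $$ (j,i)))\<^sup>2 * (v * ((s j - r i)\<^sup>2 / (v * s j + (1 - v) * r i))))
     has_integral D) {0..1}"
    unfolding D_def by (intro has_integral_sum has_integral_mult_right rel_ent_kernel_integral assms) auto
  then show 1: "((\<lambda>v. v * rel_quad N v \<rho> \<sigma>) has_integral D) {0..1}"
    by (rule has_integral_eq[rotated])
      (auto simp: rel_quad_spec(1)[OF assms(1-4)] W_def sum_distrib_left algebra_simps intro!: sum.cong)
  then show "rel_ent N \<rho> \<sigma> = D" unfolding rel_ent_def by (rule integral_unique)
qed

text \<open>Lifts an inequality between the variational functionals at each v to the relative
  entropies. Quantifying over upper bounds B stands in for the supremum: a caller bounds the value
  at one K by finitely many values of the other functional.\<close>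

lemma rel_ent_compare:
  assumes "pd N \<rho>" "pd N \<sigma>" "pd N \<rho>'" "pd N \<sigma>'"
    and le: "\<And>v B K. 0 \<le> v \<Longrightarrow> v \<le> 1 \<Longrightarrow> (\<And>K. K \<in> sq N \<Longrightarrow> qform v (\<sigma> - \<rho>) \<sigma> \<rho> K \<le> B) \<Longrightarrow>
      K \<in> sq N \<Longrightarrow> qform v (\<sigma>' - \<rho>') \<sigma>' \<rho>' K \<le> c * B"
  shows "rel_ent N \<rho>' \<sigma>' \<le> c * rel_ent N \<rho> \<sigma>"
proof -
  obtain U r where r: "spec N \<rho> U r" "\<And>i. i < N \<Longrightarrow> r i > 0" using pd_spec[OF assms(1)] by metis
  obtain V s where s: "spec N \<sigma> V s" "\<And>i. i < N \<Longrightarrow> s i > 0" using pd_spec[OF assms(2)] by metis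
  obtain U' r' where r': "spec N \<rho>' U' r'" "\<And>i. i < N \<Longrightarrow> r' i > 0" using pd_spec[OF assms(3)] by metis
  obtain V' s' where s': "spec N \<sigma>' V' s'" "\<And>i. i < N \<Longrightarrow> s' i > 0" using pd_spec[OF assms(4)] by metis
  have "rel_quad N v \<rho>' \<sigma>' \<le> c * rel_quad N v \<rho> \<sigma>" if "0 \<le> v" "v \<le> 1" for v
  proof -
    have "qform v (\<sigma>' - \<rho>') \<sigma>' \<rho>' K \<le> c * rel_quad N v \<rho> \<sigma>" if "K \<in> sq N" for K
      using le[OF \<open>0 \<le> v\<close> \<open>v \<le> 1\<close> _ that] rel_quad_spec(2)[OF r(1) s(1) r(2) s(2) \<open>0 \<le> v\<close> \<open>v \<le> 1\<close>] by blast
    then show ?thesis unfolding rel_quad_def[of N v \<rho>' \<sigma>'] by (intro cSup_least) auto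
  qed
  then have *: "v * rel_quad N v \<rho>' \<sigma>' \<le> c * (v * rel_quad N v \<rho> \<sigma>)" if "v \<in> {0..1}" for v
    using mult_left_mono[of "rel_quad N v \<rho>' \<sigma>'" "c * rel_quad N v \<rho> \<sigma>" v] that by (simp add: mult_ac)
  have "((\<lambda>v. v * rel_quad N v \<rho> \<sigma>) has_integral rel_ent N \<rho> \<sigma>) {0..1}"
    using rel_ent_has_integral[OF r(1) s(1) r(2) s(2)] by simp
  moreover have "((\<lambda>v. v * rel_quad N v \<rho>' \<sigma>') has_integral rel_ent N \<rho>' \<sigma>') {0..1}"
    using rel_ent_has_integral[OF r'(1) s'(1) r'(2) s'(2)] by simp
  ultimately show ?thesis
    using has_integral_le[OF _ has_integral_mult_right[of _ _ _ c]] * by blast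
qed

section \<open>Entropy and dephasing\<close>

text \<open>This is tr(\<rho> ln \<rho>) for positive definite \<rho>: relative to the identity,
  \<open>rel_ent\<close> carries the extra terms - tr \<rho> + N, which are taken off again.\<close>

definition neg_entropy :: "nat \<Rightarrow> complex mat \<Rightarrow> real" where
  "neg_entropy N \<rho> = rel_ent N \<rho> (1\<^sub>m N) + Re (mtrace \<rho>) - real N"

text \<open>The diagonals of W* W and W W*. These sums remove the eigenbasis overlaps from every
  term that depends on one spectrum only.\<close>

lemma unitary_sums:
  assumes "unitary_mat N W"
  shows "i < N \<Longrightarrow> (\<Sum>j<N. (cmod (W $$ (j,i)))\<^sup>2) = 1" "j < N \<Longrightarrow> (\<Sum>i<N. (cmod (W $$ (j,i)))\<^sup>2) = 1"
proof -
  note w = unitary_matD[OF assms]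
  assume i: "i < N"
  have "(\<Sum>j<N. madj W $$ (i,j) * W $$ (j,i)) = 1"
    using arg_cong[OF w(3), of "\<lambda>X. X $$ (i,i)"] i unfolding mult_index[OF w(2,1) i i] by simp
  also have "(\<Sum>j<N. madj W $$ (i,j) * W $$ (j,i)) = of_real (\<Sum>j<N. (cmod (W $$ (j,i)))\<^sup>2)"
    unfolding of_real_sum using w(1) i by (intro sum.cong) (auto simp: cnj_mult_self)
  finally show "(\<Sum>j<N. (cmod (W $$ (j,i)))\<^sup>2) = 1" by (metis of_real_eq_1_iff)
next
  note w = unitary_matD[OF assms]
  assume j: "j < N"
  have "(\<Sum>i<N. W $$ (j,i) * madj W $$ (i,j)) = 1"
    using arg_cong[OF w(4), of "\<lambda>X. X $$ (j,j)"] j unfolding mult_index[OF w(1,2) j j] by simp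
  also have "(\<Sum>i<N. W $$ (j,i) * madj W $$ (i,j)) = of_real (\<Sum>i<N. (cmod (W $$ (j,i)))\<^sup>2)"
    unfolding of_real_sum using w(1) j by (intro sum.cong) (auto simp: cnj_mult_self mult.commute[of "W $$ _"])
  finally show "(\<Sum>i<N. (cmod (W $$ (j,i)))\<^sup>2) = 1" by (metis of_real_eq_1_iff)
qed

lemma spec_mtrace:
  assumes "spec N A U r"
  shows "mtrace A = of_real (\<Sum>i<N. r i)"
proof -
  have "mtrace A = mtrace (rdiag N r)"
    unfolding specD(2)[OF assms] by (intro mtrace_unitary_conj(1)[of N] specD(1)[OF assms] mat_diag_dim)
  also have "\<dots> = of_real (\<Sum>i<N. r i)" by (simp add: mtrace_def mat_diag_def)
  finally show ?thesis .
qed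

lemma spec_one: "spec N (1\<^sub>m N) (1\<^sub>m N) (\<lambda>_. 1)"
  by (simp add: spec_def unitary_one)

lemma neg_entropy_spec:
  assumes "spec N \<rho> U r" "\<And>i. i < N \<Longrightarrow> r i > 0"
  shows "neg_entropy N \<rho> = (\<Sum>i<N. r i * ln (r i))"
proof -
  define W where "W = madj (1\<^sub>m N) * U"
  have W: "unitary_mat N W" unfolding W_def using unitary_mult[OF unitary_madj[OF unitary_one] specD(1)[OF assms(1)]] .
  have "rel_ent N \<rho> (1\<^sub>m N) = (\<Sum>j<N. \<Sum>i<N. (cmod (W $$ (j,i)))\<^sup>2 * (r i * ln (r i) - r i * ln 1 - r i + 1))"
    unfolding W_def by (rule rel_ent_has_integral(2)[OF assms(1) spec_one assms(2)]) auto
  also have "\<dots> = (\<Sum>i<N. \<Sum>j<N. (cmod (W $$ (j,i)))\<^sup>2 * (r i * ln (r i) - r i * ln 1 - r i + 1))"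
    by (rule sum.swap)
  also have "\<dots> = (\<Sum>i<N. r i * ln (r i) - r i + 1)"
    by (intro sum.cong refl) (simp add: unitary_sums(1)[OF W] flip: sum_distrib_right)
  finally show ?thesis unfolding neg_entropy_def
    by (simp add: spec_mtrace[OF assms(1)] sum.distrib sum_subtractf)
qed

lemma neg_entropy_unitary:
  assumes "pd N \<rho>" "unitary_mat N U"
  shows "neg_entropy N (U * \<rho> * madj U) = neg_entropy N \<rho>"
proof -
  obtain V r where r: "spec N \<rho> V r" "\<And>i. i < N \<Longrightarrow> r i > 0" using pd_spec[OF assms(1)] by metis
  show ?thesis using neg_entropy_spec[OF r] neg_entropy_spec[OF spec_conj[OF r(1) assms(2)] r(2)] by simp
qed

text \<open>Only the cross term tr(\<rho> ln \<sigma>) involves both operators, and it sees \<rho>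
  through its diagonal in an eigenbasis V of \<sigma>, which may be chosen freely.\<close>

lemma rel_ent_neg_entropy:
  assumes "pd N \<rho>" "spec N \<sigma> V s" "\<And>i. i < N \<Longrightarrow> s i > 0"
  shows "rel_ent N \<rho> \<sigma> = neg_entropy N \<rho> - (\<Sum>j<N. ln (s j) * Re ((madj V * \<rho> * V) $$ (j,j)))
    - Re (mtrace \<rho>) + Re (mtrace \<sigma>)"
proof -
  obtain U r where r: "spec N \<rho> U r" "\<And>i. i < N \<Longrightarrow> r i > 0" using pd_spec[OF assms(1)] by metis
  note u = unitary_matD[OF specD(1)[OF r(1)]] and w = unitary_matD[OF specD(1)[OF assms(2)]]
  define W where "W = madj V * U"
  have W: "unitary_mat N W" unfolding W_def 
    using unitary_mult[OF unitary_madj[OF specD(1)[OF assms(2)]] specD(1)[OF r(1)]] .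
  note ww = unitary_matD[OF W]
  have eq: "madj V * \<rho> * V = W * (rdiag N r * madj W)"
    unfolding specD(2)[OF r(1)] W_def using u w by (simp add: sq_assoc[of _ N] madj_mult[of _ N N _ N])
  have d: "Re ((madj V * \<rho> * V) $$ (j,j)) = (\<Sum>i<N. (cmod (W $$ (j,i)))\<^sup>2 * r i)" if "j < N" for j
  proof -
    have "(madj V * \<rho> * V) $$ (j,j) = (\<Sum>i<N. W $$ (j,i) * (rdiag N r * madj W) $$ (i,j))"
      unfolding eq by (rule mult_index) (use ww that in auto)
    also have "\<dots> = of_real (\<Sum>i<N. (cmod (W $$ (j,i)))\<^sup>2 * r i)"
      unfolding of_real_sum using ww that
      by (intro sum.cong refl) (auto simp: mat_diag_mult_left[of _ N N] cnj_mult_self[symmetric])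
    finally show ?thesis by simp
  qed
  have "rel_ent N \<rho> \<sigma> = (\<Sum>j<N. \<Sum>i<N. (cmod (W $$ (j,i)))\<^sup>2 * (r i * ln (r i) - r i * ln (s j) - r i + s j))"
    unfolding W_def by (rule rel_ent_has_integral(2)[OF r(1) assms(2) r(2) assms(3)])
  also have "\<dots> = (\<Sum>j<N. \<Sum>i<N. (cmod (W $$ (j,i)))\<^sup>2 * (r i * ln (r i) - r i)) -
     (\<Sum>j<N. \<Sum>i<N. ln (s j) * ((cmod (W $$ (j,i)))\<^sup>2 * r i)) + (\<Sum>j<N. \<Sum>i<N. (cmod (W $$ (j,i)))\<^sup>2 * s j)"
    unfolding sum_subtractf[symmetric] sum.distrib[symmetric]
    by (intro sum.cong refl) (simp add: algebra_simps)
  also have "(\<Sum>j<N. \<Sum>i<N. (cmod (W $$ (j,i)))\<^sup>2 * s j) = (\<Sum>j<N. s j)"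
    by (intro sum.cong refl) (simp add: unitary_sums(2)[OF W] flip: sum_distrib_right)
  also have "(\<Sum>j<N. \<Sum>i<N. (cmod (W $$ (j,i)))\<^sup>2 * (r i * ln (r i) - r i)) =
     (\<Sum>i<N. \<Sum>j<N. (cmod (W $$ (j,i)))\<^sup>2 * (r i * ln (r i) - r i))" by (rule sum.swap)
  also have "\<dots> = (\<Sum>i<N. r i * ln (r i) - r i)"
    by (intro sum.cong refl) (simp add: unitary_sums(1)[OF W] flip: sum_distrib_right)
  also have "(\<Sum>j<N. \<Sum>i<N. ln (s j) * ((cmod (W $$ (j,i)))\<^sup>2 * r i)) = (\<Sum>j<N. ln (s j) * Re ((madj V * \<rho> * V) $$ (j,j)))"
    by (intro sum.cong refl) (simp add: d sum_distrib_left)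
  finally show ?thesis
    by (simp add: neg_entropy_spec[OF r] spec_mtrace[OF r(1)] spec_mtrace[OF assms(2)] sum_subtractf)
qed

text \<open>Klein's inequality, read off from the nonnegative integrand in
  \<open>rel_ent_kernel_integral\<close>.\<close>

lemma rel_ent_nonneg:
  assumes "pd N \<rho>" "pd N \<sigma>"
  shows "rel_ent N \<rho> \<sigma> \<ge> 0"
proof -
  obtain U r where r: "spec N \<rho> U r" "\<And>i. i < N \<Longrightarrow> r i > 0" using pd_spec[OF assms(1)] by metis
  obtain V s where s: "spec N \<sigma> V s" "\<And>i. i < N \<Longrightarrow> s i > 0" using pd_spec[OF assms(2)] by metis
  have "0 \<le> r i * ln (r i) - r i * ln (s j) - r i + s j" if "i < N" "j < N" for i j
    using r(2)[OF that(1)] s(2)[OF that(2)]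
    by (intro has_integral_nonneg[OF rel_ent_kernel_integral])
      (auto intro!: mult_nonneg_nonneg divide_nonneg_nonneg add_nonneg_nonneg)
  then show ?thesis by (subst rel_ent_has_integral(2)[OF r(1) s(1) r(2) s(2)]) (auto intro!: sum_nonneg)
qed

section \<open>Complete and partial dephasing by a Hermitian unitary\<close>

definition sym_unitary :: "nat \<Rightarrow> complex mat \<Rightarrow> bool" where
  "sym_unitary N P \<longleftrightarrow> P \<in> sq N \<and> madj P = P \<and> P * P = 1\<^sub>m N"

text \<open>The part of A that commutes with P is kept and the anticommuting part is multiplied by
  l, so parameters multiply under composition. Parameter 1 is the identity, 0 the complete
  dephasing, -1 conjugation by P.\<close>

definition twirl :: "complex mat \<Rightarrow> real \<Rightarrow> complex mat \<Rightarrow> complex mat" where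
  "twirl P l A = complex_of_real ((1 + l) / 2) \<cdot>\<^sub>m A + complex_of_real ((1 - l) / 2) \<cdot>\<^sub>m (P * A * P)"

lemma sym_unitaryD:
  assumes "sym_unitary N P"
  shows "P \<in> sq N" "madj P = P" "P * P = 1\<^sub>m N" "unitary_mat N P"
  using assms by (auto simp: sym_unitary_def unitary_mat_def)

lemma sym_unitary_cancel:
  assumes "sym_unitary N P" "A \<in> sq N"
  shows "P * (P * A) = A"
  using unitary_cancel(1)[OF sym_unitaryD(4)[OF assms(1)] assms(2)] sym_unitaryD(2)[OF assms(1)] by simp

lemma sym_conj_conj:
  assumes "sym_unitary N P" "A \<in> sq N"
  shows "P * (P * A * P) * P = A"
  using assms sym_unitaryD(1,3)[OF assms(1)]
  by (simp add: sq_assoc[of _ N] sym_unitary_cancel[of N] right_mult_one_mat[of _ N N])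

lemma sym_conj_linear:
  fixes A :: "complex mat"
  assumes "P \<in> sq N" "A \<in> sq N" "B \<in> sq N"
  shows "P * (A + B) * P = P * A * P + P * B * P" "P * (A - B) * P = P * A * P - P * B * P"
    "P * (c \<cdot>\<^sub>m A) * P = c \<cdot>\<^sub>m (P * A * P)"
proof -
  note c = assms
  show "P * (A + B) * P = P * A * P + P * B * P"
    unfolding mult_add_distrib_mat[OF c] by (rule add_mult_distrib_mat[OF sq_closed[OF c(1,2)] sq_closed[OF c(1,3)] c(1)])
  show "P * (A - B) * P = P * A * P - P * B * P"
    unfolding mult_minus_distrib_mat[OF c] by (rule minus_mult_distrib_mat[OF sq_closed[OF c(1,2)] sq_closed[OF c(1,3)] c(1)])
  show "P * (c \<cdot>\<^sub>m A) * P = c \<cdot>\<^sub>m (P * A * P)"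
    unfolding mult_smult_distrib[OF c(1,2)] by (rule mult_smult_assoc_mat[OF sq_closed[OF c(1,2)] c(1)])
qed

lemma twirl_carrier [simp]:
  "P \<in> sq N \<Longrightarrow> A \<in> sq N \<Longrightarrow> twirl P l A \<in> sq N"
  by (simp add: twirl_def)

lemma sym_conj_twirl:
  assumes "sym_unitary N P" "A \<in> sq N"
  shows "P * twirl P l A * P = twirl P (- l) A"
proof -
  note p = sym_unitaryD[OF assms(1)]
  show ?thesis unfolding twirl_def using p assms
    by (simp add: sym_conj_linear[of _ N] sym_conj_conj[of N] comm_add_mat[of _ N N])
qed

lemma sq_index:
  fixes A :: "complex mat"
  assumes "A \<in> sq N" "B \<in> sq N" "i < N" "j < N"
  shows "(c \<cdot>\<^sub>m A) $$ (i,j) = c * A $$ (i,j)" "(A + B) $$ (i,j) = A $$ (i,j) + B $$ (i,j)"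
    "(A - B) $$ (i,j) = A $$ (i,j) - B $$ (i,j)"
  using assms by auto

lemma sq_eqI:
  assumes "A \<in> sq N" "B \<in> sq N" "\<And>i j. i < N \<Longrightarrow> j < N \<Longrightarrow> A $$ (i,j) = B $$ (i,j)"
  shows "A = B"
  using assms by (intro eq_matI) auto

lemma twirl_index:
  assumes "P \<in> sq N" "A \<in> sq N" "i < N" "j < N"
  shows "twirl P l A $$ (i,j) = ((1 + l) / 2) * A $$ (i,j) + ((1 - l) / 2) * (P * A * P) $$ (i,j)"
  using assms by (simp add: twirl_def)

lemma twirl_twirl:
  assumes "sym_unitary N P" "A \<in> sq N"
  shows "twirl P l (twirl P k A) = twirl P (l * k) A"
proof -
  note p = sym_unitaryD[OF assms(1)]
  show ?thesis
  proof (rule eq_matI)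
    fix i j assume "i < dim_row (twirl P (l * k) A)" "j < dim_col (twirl P (l * k) A)"
    then have ij: "i < N" "j < N" using p assms by (auto simp: twirl_def)
    show "twirl P l (twirl P k A) $$ (i,j) = twirl P (l * k) A $$ (i,j)"
      using p assms ij by (simp add: twirl_index[of _ N] sym_conj_twirl[of N])
       (simp add: field_simps)
  qed (use p assms in \<open>auto simp: twirl_def\<close>)
qed

lemma mtrace_twirl:
  assumes "sym_unitary N P" "A \<in> sq N"
  shows "mtrace (twirl P l A) = mtrace A"
proof -
  note p = sym_unitaryD[OF assms(1)]
  have "mtrace (P * A * P) = mtrace A" using mtrace_unitary_conj(1)[OF p(4) assms(2)] p(2) by simp
  then show ?thesis unfolding twirl_def using p assms
    by (simp add: mtrace_add[of _ N] mtrace_smult[of _ N] field_simps)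
qed

lemma pd_sym_conj: "pd N A \<Longrightarrow> sym_unitary N P \<Longrightarrow> pd N (P * A * P)"
  using pd_conj[of N A P] sym_unitaryD(2,4)[of N P] by simp

lemma pd_twirl:
  assumes "pd N A" "sym_unitary N P" "\<bar>l\<bar> \<le> 1"
  shows "pd N (twirl P l A)"
proof (cases "l = -1")
  case True
  have "twirl P l A = P * A * P" unfolding twirl_def True
    using sym_unitaryD[OF assms(2)] pd_carrier[OF assms(1)] by (intro eq_matI) (auto)
  then show ?thesis using pd_sym_conj[OF assms(1,2)] by simp
next
  case False
  then have "l > -1" "l \<le> 1" using assms(3) by auto
  then show ?thesis unfolding twirl_def
    by (intro pd_add_psd pd_smult psd_smult pd_psd pd_sym_conj assms) auto
qed

text \<open>Pythagoras for a dephasing: the dephased state \<sigma> commutes with P, so \<rho> and P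
  \<rho> P have the same cross term with ln \<sigma>, and the average of the two is tr(\<sigma> ln
  \<sigma>).\<close>

lemma rel_ent_twirl_chain:
  assumes "pd N \<rho>" "sym_unitary N P"
  shows "rel_ent N \<rho> (twirl P 0 \<rho>) = neg_entropy N \<rho> - neg_entropy N (twirl P 0 \<rho>)"
proof -
  note p = sym_unitaryD[OF assms(2)]
  note c = pd_carrier[OF assms(1)]
  define \<sigma> where "\<sigma> = twirl P 0 \<rho>"
  have \<sigma>: "pd N \<sigma>" unfolding \<sigma>_def by (rule pd_twirl) (use assms in auto)
  obtain V s where s: "spec N \<sigma> V s" "\<And>i. i < N \<Longrightarrow> s i > 0" using pd_spec[OF \<sigma>] by metis
  note v = unitary_matD[OF specD(1)[OF s(1)]]
  have "P * \<sigma> * P = \<sigma>" unfolding \<sigma>_def using sym_conj_twirl[OF assms(2) c, of 0] by simp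
  \<comment> \<open>A second eigenbasis of \<sigma> for the same eigenvalues; reading the diagonal
    of \<rho> in it amounts to reading that of P \<rho> P in V.\<close>
  then have s': "spec N \<sigma> (P * V) s" using spec_conj[OF s(1) p(4)] p(2) by simp
  define a where "a j = Re ((madj V * \<rho> * V) $$ (j,j))" for j
  define b where "b j = Re ((madj (P * V) * \<rho> * (P * V)) $$ (j,j))" for j
  have ab: "a j + b j = 2 * s j" if j: "j < N" for j
  proof -
    have c': "P * \<rho> * P \<in> sq N" by (intro sq_closed p c)
    have e: "madj (P * V) * \<rho> * (P * V) = madj V * (P * \<rho> * P) * V"
      using p(1,2) v(1,2) c by (simp add: madj_mult[of _ N N _ N] sq_assoc[of _ N])
    have "madj V * (\<rho> + P * \<rho> * P) * V = madj V * \<rho> * V + madj V * (P * \<rho> * P) * V"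
      using v c c' by (simp add: mult_add_distrib_mat[of _ N N _ N] add_mult_distrib_mat[of _ N N _ _ N])
    moreover have "\<rho> + P * \<rho> * P = 2 \<cdot>\<^sub>m \<sigma>" unfolding \<sigma>_def twirl_def
      using c p by (intro eq_matI) (auto)
    moreover have "madj V * (2 \<cdot>\<^sub>m \<sigma>) * V = 2 \<cdot>\<^sub>m rdiag N s"
      using v pd_carrier[OF \<sigma>] spec_diag[OF s(1)]
      by (simp add: mult_smult_distrib[of _ N N _ N] mult_smult_assoc_mat[of _ N N _ N])
    ultimately have "(madj V * \<rho> * V + madj V * (P * \<rho> * P) * V) $$ (j,j) = (2 \<cdot>\<^sub>m rdiag N s) $$ (j,j)" by simp
    then show ?thesis unfolding a_def b_def e using v c c' j
      by (auto simp: mat_diag_def complex_eq_iff)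
  qed
  have "rel_ent N \<rho> \<sigma> = neg_entropy N \<rho> - (\<Sum>j<N. ln (s j) * a j) - Re (mtrace \<rho>) + Re (mtrace \<sigma>)"
    unfolding a_def by (rule rel_ent_neg_entropy[OF assms(1) s])
  moreover have "rel_ent N \<rho> \<sigma> = neg_entropy N \<rho> - (\<Sum>j<N. ln (s j) * b j) - Re (mtrace \<rho>) + Re (mtrace \<sigma>)"
    unfolding b_def by (rule rel_ent_neg_entropy[OF assms(1) s' s(2)])
  moreover have "mtrace \<sigma> = mtrace \<rho>" unfolding \<sigma>_def by (rule mtrace_twirl[OF assms(2) c])
  moreover have "(\<Sum>j<N. ln (s j) * a j) + (\<Sum>j<N. ln (s j) * b j) = 2 * (\<Sum>j<N. s j * ln (s j))"
    unfolding sum.distrib[symmetric] sum_distrib_left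
  proof (intro sum.cong refl)
    fix j assume "j \<in> {..<N}"
    then have "ln (s j) * (a j + b j) = ln (s j) * (2 * s j)" using ab by simp
    then show "ln (s j) * a j + ln (s j) * b j = 2 * (s j * ln (s j))" by (simp add: algebra_simps)
  qed
  ultimately have "2 * rel_ent N \<rho> \<sigma> = 2 * neg_entropy N \<rho> - 2 * neg_entropy N \<sigma>"
    using neg_entropy_spec[OF s] by simp
  then show ?thesis unfolding \<sigma>_def by simp
qed

lemma neg_entropy_twirl0_le:
  assumes "pd N \<rho>" "sym_unitary N P"
  shows "neg_entropy N (twirl P 0 \<rho>) \<le> neg_entropy N \<rho>"
  using rel_ent_nonneg[OF assms(1) pd_twirl[OF assms, of 0]] rel_ent_twirl_chain[OF assms] by simp

text \<open>Joint linearity at fixed K is the source of every convexity argument for the relative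
  entropy here.\<close>

lemma qform_linear:
  assumes c: "D1 \<in> sq N" "D2 \<in> sq N" "S1 \<in> sq N" "S2 \<in> sq N"
    "R1 \<in> sq N" "R2 \<in> sq N" "K \<in> sq N"
  shows "qform v (complex_of_real a \<cdot>\<^sub>m D1 + complex_of_real b \<cdot>\<^sub>m D2) (complex_of_real a \<cdot>\<^sub>m S1 + complex_of_real b \<cdot>\<^sub>m S2)
      (complex_of_real a \<cdot>\<^sub>m R1 + complex_of_real b \<cdot>\<^sub>m R2) K = a * qform v D1 S1 R1 K + b * qform v D2 S2 R2 K"
  using c unfolding qform_def
  by (simp add: mult_add_distrib_mat[of _ N N _ N] add_mult_distrib_mat[of _ N N _ _ N]
      mult_smult_distrib[of _ N N _ N] mult_smult_assoc_mat[of _ N N _ N] mtrace_add[of _ N] mtrace_smult[of _ N]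
      algebra_simps)

lemma qform_scale:
  assumes c: "D \<in> sq N" "S \<in> sq N" "R \<in> sq N" "K \<in> sq N"
  shows "qform v (complex_of_real l \<cdot>\<^sub>m D) S R (complex_of_real l \<cdot>\<^sub>m K) = l\<^sup>2 * qform v D S R K"
  using c unfolding qform_def
  by (simp add: madj_smult mult_smult_distrib[of _ N N _ N] mult_smult_assoc_mat[of _ N N _ N] mtrace_smult[of _ N]
      algebra_simps power2_eq_square)

lemma qform_sym_conj:
  assumes "sym_unitary N P" "\<Delta> \<in> sq N" "\<sigma> \<in> sq N" "\<rho> \<in> sq N" "K \<in> sq N"
  shows "qform v (P * \<Delta> * P) (P * \<sigma> * P) (P * \<rho> * P) (P * K * P) = qform v \<Delta> \<sigma> \<rho> K"
  using qform_unitary[OF sym_unitaryD(4)[OF assms(1)] sym_unitaryD(4)[OF assms(1)] assms(2-5)]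
    sym_unitaryD(2)[OF assms(1)] by simp

text \<open>The square arises because the partial dephasing multiplies the difference to the
  dephased state by l, and the functional scales by l^2 when K is scaled along. Hence the relative
  entropy to the common dephased state contracts by l^2, which \<open>rel_ent_twirl_chain\<close>
  turns into the claim.\<close>

lemma neg_entropy_twirl_le:
  assumes "pd N \<rho>" "sym_unitary N P" "\<bar>l\<bar> \<le> 1"
  shows "neg_entropy N (twirl P l \<rho>) \<le> l\<^sup>2 * neg_entropy N \<rho> + (1 - l\<^sup>2) * neg_entropy N (twirl P 0 \<rho>)"
proof (cases "l = 0")
  case False
  note p = sym_unitaryD[OF assms(2)]
  note c = pd_carrier[OF assms(1)]
  define a where "a = twirl P 0 \<rho>"
  define \<rho>' where "\<rho>' = twirl P l \<rho>"
  define \<Delta> where "\<Delta> = a - \<rho>"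
  have cc: "a \<in> sq N" "\<rho>' \<in> sq N" "\<Delta> \<in> sq N" "P * \<rho> * P \<in> sq N"
    unfolding a_def \<rho>'_def \<Delta>_def using p c by (auto intro!: minus_carrier_mat)
  have pda: "pd N a" and pd': "pd N \<rho>'" unfolding a_def \<rho>'_def by (rule pd_twirl, use assms in auto)+
  have Pa: "P * a * P = a" unfolding a_def using sym_conj_twirl[OF assms(2) c, of 0] by simp
  have \<Delta>': "a - \<rho>' = complex_of_real l \<cdot>\<^sub>m \<Delta>" unfolding \<Delta>_def a_def \<rho>'_def twirl_def using p c
    by (intro eq_matI) (auto simp: field_simps)
  have \<Delta>P: "P * \<Delta> * P = complex_of_real (-1) \<cdot>\<^sub>m \<Delta>"
    unfolding \<Delta>_def sym_conj_linear(2)[OF p(1) cc(1) c] Pa unfolding a_def twirl_def using p c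
    by (intro eq_matI) (auto simp: field_simps)
  have "rel_ent N \<rho>' a \<le> l\<^sup>2 * rel_ent N \<rho> a"
  proof (rule rel_ent_compare[OF assms(1) pda pd' pda])
    fix v B :: real and K :: "complex mat"
    assume B: "\<And>K. K \<in> sq N \<Longrightarrow> qform v (a - \<rho>) a \<rho> K \<le> B" and K: "K \<in> sq N"
    \<comment> \<open>Every K is l times some K0, so that l^2 can be pulled out. This divides by l;
      for l = 0 both sides of the claim coincide.\<close>
    define K0 where "K0 = complex_of_real (1 / l) \<cdot>\<^sub>m K"
    have K0: "K0 \<in> sq N" unfolding K0_def using K by simp
    have K: "K = complex_of_real l \<cdot>\<^sub>m K0" unfolding K0_def using K False by (intro eq_matI) auto
    have PK: "P * K0 * P \<in> sq N" by (intro sq_closed p K0)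
    have "qform v (a - \<rho>') a \<rho>' K = l\<^sup>2 * qform v \<Delta> a \<rho>' K0"
      unfolding \<Delta>' K by (rule qform_scale[OF cc(3,1,2) K0])
    also have "qform v \<Delta> a \<rho>' K0 = qform v (complex_of_real ((1 + l) / 2) \<cdot>\<^sub>m \<Delta> + complex_of_real ((1 - l) / 2) \<cdot>\<^sub>m \<Delta>)
       (complex_of_real ((1 + l) / 2) \<cdot>\<^sub>m a + complex_of_real ((1 - l) / 2) \<cdot>\<^sub>m a) \<rho>' K0"
      using cc(1,3) by (intro arg_cong2[where f="\<lambda>x y. qform v x y \<rho>' K0"] eq_matI) (auto simp: field_simps)
    also have "\<dots> = (1 + l) / 2 * qform v \<Delta> a \<rho> K0 + (1 - l) / 2 * qform v \<Delta> a (P * \<rho> * P) K0"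
      unfolding \<rho>'_def twirl_def by (rule qform_linear[OF cc(3,3,1,1) c cc(4) K0])
    \<comment> \<open>In the mirrored half, conjugation by P restores \<rho>, fixes a and reverses
      the sign of \<Delta>; the sign is absorbed into K.\<close>
    also have "qform v \<Delta> a (P * \<rho> * P) K0 = qform v (P * \<Delta> * P) (P * a * P) (P * (P * \<rho> * P) * P) (P * K0 * P)"
      by (rule qform_sym_conj[symmetric, OF assms(2) cc(3,1,4) K0])
    also have "\<dots> = qform v (complex_of_real (-1) \<cdot>\<^sub>m \<Delta>) a \<rho> (complex_of_real (-1) \<cdot>\<^sub>m (complex_of_real (-1) \<cdot>\<^sub>m (P * K0 * P)))"
      unfolding \<Delta>P Pa sym_conj_conj[OF assms(2) c] using PK
      by (intro arg_cong[where f="qform v _ a \<rho>"] eq_matI) (auto)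
    also have "\<dots> = (-1)\<^sup>2 * qform v \<Delta> a \<rho> (complex_of_real (-1) \<cdot>\<^sub>m (P * K0 * P))"
      by (rule qform_scale[OF cc(3,1) c]) (use PK in auto)
    also have "(1 + l) / 2 * qform v \<Delta> a \<rho> K0 + (1 - l) / 2 * \<dots> \<le> (1 + l) / 2 * B + (1 - l) / 2 * B"
      using assms(3) B[OF K0] B[of "complex_of_real (-1) \<cdot>\<^sub>m (P * K0 * P)"] PK unfolding \<Delta>_def
      by (intro add_mono mult_left_mono) auto
    also have "\<dots> = B" by (simp add: field_simps)
    finally show "qform v (a - \<rho>') a \<rho>' K \<le> l\<^sup>2 * B" by (simp add: mult_left_mono)
  qed
  moreover have "rel_ent N \<rho>' a = neg_entropy N \<rho>' - neg_entropy N a"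
    using rel_ent_twirl_chain[OF pd' assms(2)] unfolding a_def \<rho>'_def twirl_twirl[OF assms(2) c] by simp
  moreover have "rel_ent N \<rho> a = neg_entropy N \<rho> - neg_entropy N a"
    using rel_ent_twirl_chain[OF assms(1,2)] unfolding a_def .
  ultimately show ?thesis unfolding a_def \<rho>'_def by (simp add: algebra_simps)
qed simp

text \<open>Commutation of the conjugations rather than of the matrices: this also covers two Pauli
  matrices on the same qubit, which may anticommute.\<close>

definition conj_commute :: "nat \<Rightarrow> complex mat \<Rightarrow> complex mat \<Rightarrow> bool" where
  "conj_commute N P Q \<longleftrightarrow> (\<forall>A \<in> sq N. P * (Q * A * Q) * P = Q * (P * A * P) * Q)"

lemma twirl_commute:
  assumes "P \<in> sq N" "Q \<in> sq N" "conj_commute N P Q" "A \<in> sq N"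
  shows "twirl P l (twirl Q k A) = twirl Q k (twirl P l A)"
proof (rule eq_matI)
  fix i j assume "i < dim_row (twirl Q k (twirl P l A))" "j < dim_col (twirl Q k (twirl P l A))"
  then have ij: "i < N" "j < N" using assms by (auto simp: twirl_def)
  have e: "P * (Q * A * Q) * P = Q * (P * A * P) * Q" using assms by (simp add: conj_commute_def)
  have "P * twirl Q k A * P = complex_of_real ((1 + k) / 2) \<cdot>\<^sub>m (P * A * P) + complex_of_real ((1 - k) / 2) \<cdot>\<^sub>m (P * (Q * A * Q) * P)"
    unfolding twirl_def using assms by (simp add: sym_conj_linear[of _ N])
  moreover have "Q * twirl P l A * Q = complex_of_real ((1 + l) / 2) \<cdot>\<^sub>m (Q * A * Q) + complex_of_real ((1 - l) / 2) \<cdot>\<^sub>m (P * (Q * A * Q) * P)"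
    unfolding twirl_def e using assms by (simp add: sym_conj_linear[of _ N])
  moreover have "P * (Q * A * Q) * P \<in> sq N" "P * A * P \<in> sq N" "Q * A * Q \<in> sq N"
    by (intro sq_closed assms)+
  ultimately show "twirl P l (twirl Q k A) $$ (i,j) = twirl Q k (twirl P l A) $$ (i,j)"
    using assms ij by (simp add: twirl_index[of _ N]) (simp add: field_simps)
qed (use assms in \<open>auto simp: twirl_def\<close>)

text \<open>Data processing: the relative entropy of \<rho> to its P-dephasing does not grow under
  the dephasing by Q, and \<open>rel_ent_twirl_chain\<close> rewrites both sides as entropy
  differences.\<close>

lemma neg_entropy_submodular:
  assumes "pd N \<rho>" "sym_unitary N P" "sym_unitary N Q" "conj_commute N P Q"
  shows "neg_entropy N (twirl P 0 \<rho>) + neg_entropy N (twirl Q 0 \<rho>)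
    \<le> neg_entropy N \<rho> + neg_entropy N (twirl P 0 (twirl Q 0 \<rho>))"
proof -
  note p = sym_unitaryD[OF assms(2)] and q = sym_unitaryD[OF assms(3)]
  note c = pd_carrier[OF assms(1)]
  define \<sigma> where "\<sigma> = twirl P 0 \<rho>"
  have pds: "pd N \<sigma>" "pd N (twirl Q 0 \<rho>)" unfolding \<sigma>_def by (rule pd_twirl, use assms in auto)+
  then have pds2: "pd N (twirl Q 0 \<sigma>)" by (intro pd_twirl) (use assms in auto)
  note cs = pd_carrier[OF pds(1)]
  have "rel_ent N (twirl Q 0 \<rho>) (twirl Q 0 \<sigma>) \<le> 1 * rel_ent N \<rho> \<sigma>"
  proof (rule rel_ent_compare[OF assms(1) pds(1) pds(2) pds2])
    fix v B :: real and K :: "complex mat"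
    assume B: "\<And>K. K \<in> sq N \<Longrightarrow> qform v (\<sigma> - \<rho>) \<sigma> \<rho> K \<le> B" and K: "K \<in> sq N"
    let ?h = "complex_of_real (1/2)"
    have t: "twirl Q 0 A = ?h \<cdot>\<^sub>m A + ?h \<cdot>\<^sub>m (Q * A * Q)" for A by (simp add: twirl_def)
    have cc: "Q * \<sigma> * Q \<in> sq N" "Q * \<rho> * Q \<in> sq N" "\<sigma> - \<rho> \<in> sq N"
      "Q * (\<sigma> - \<rho>) * Q \<in> sq N" "Q * K * Q \<in> sq N"
      by (intro sq_closed q cs c K minus_carrier_mat)+
    have d: "twirl Q 0 \<sigma> - twirl Q 0 \<rho> = ?h \<cdot>\<^sub>m (\<sigma> - \<rho>) + ?h \<cdot>\<^sub>m (Q * (\<sigma> - \<rho>) * Q)"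
      unfolding sym_conj_linear(2)[OF q(1) cs c] t using cs c cc
      by (intro sq_eqI[of _ N]) (simp_all add: minus_carrier_mat sq_index[of _ N] field_simps)
    have "qform v (twirl Q 0 \<sigma> - twirl Q 0 \<rho>) (twirl Q 0 \<sigma>) (twirl Q 0 \<rho>) K =
      1/2 * qform v (\<sigma> - \<rho>) \<sigma> \<rho> K + 1/2 * qform v (Q * (\<sigma> - \<rho>) * Q) (Q * \<sigma> * Q) (Q * \<rho> * Q) K"
      unfolding d unfolding t by (rule qform_linear[OF cc(3,4) cs cc(1) c cc(2) K])
    \<comment> \<open>In the second half the conjugation by Q moves onto K, so both halves are
      values of the original functional.\<close>
    also have "qform v (Q * (\<sigma> - \<rho>) * Q) (Q * \<sigma> * Q) (Q * \<rho> * Q) K =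
        qform v (Q * (\<sigma> - \<rho>) * Q) (Q * \<sigma> * Q) (Q * \<rho> * Q) (Q * (Q * K * Q) * Q)"
      by (simp only: sym_conj_conj[OF assms(3) K])
    also have "\<dots> = qform v (\<sigma> - \<rho>) \<sigma> \<rho> (Q * K * Q)"
      by (rule qform_sym_conj[OF assms(3) cc(3) cs c cc(5)])
    also have "1/2 * qform v (\<sigma> - \<rho>) \<sigma> \<rho> K + 1/2 * \<dots> \<le> 1/2 * B + 1/2 * B"
      by (intro add_mono mult_left_mono B K cc(5)) auto
    finally show "qform v (twirl Q 0 \<sigma> - twirl Q 0 \<rho>) (twirl Q 0 \<sigma>) (twirl Q 0 \<rho>) K \<le> 1 * B" by simp
  qed
  moreover have "rel_ent N \<rho> \<sigma> = neg_entropy N \<rho> - neg_entropy N \<sigma>"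
    unfolding \<sigma>_def by (rule rel_ent_twirl_chain[OF assms(1,2)])
  moreover have "twirl Q 0 \<sigma> = twirl P 0 (twirl Q 0 \<rho>)"
    unfolding \<sigma>_def by (rule twirl_commute[symmetric]) (use p q c assms in auto)
  moreover have "rel_ent N (twirl Q 0 \<rho>) (twirl P 0 (twirl Q 0 \<rho>)) = neg_entropy N (twirl Q 0 \<rho>) - neg_entropy N (twirl P 0 (twirl Q 0 \<rho>))"
    by (rule rel_ent_twirl_chain[OF pds(2) assms(2)])
  ultimately show ?thesis unfolding \<sigma>_def by simp
qed

section \<open>Pauli dephasings on qubits\<close>

lemma qbit_bit: "qbit i a = of_bool (bit a i)"
  by (simp add: qbit_def bit_iff_odd mod_2_eq_odd)

lemma qbit_lt [simp]: "qbit i a < 2"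
  by (simp add: qbit_def)

text \<open>Trades the arithmetic form of \<open>set_qbit\<close>, with its truncated subtraction,
  for bit operations, where index identities can be checked bit by bit.\<close>

lemma set_qbit_bit:
  assumes "c < 2"
  shows "set_qbit i c a = (if c = 1 then set_bit i a else unset_bit i a)"
proof -
  have 1: "a - qbit i a * 2 ^ i = unset_bit i a"
  proof (cases "bit a i")
    case True
    have "a = set_bit i (unset_bit i a)"
      by (rule bit_eqI) (use True in \<open>auto simp: bit_simps\<close>)
    also have "\<dots> = unset_bit i a + 2 ^ i" by (simp add: set_bit_eq bit_simps)
    finally show ?thesis using True by (simp add: qbit_bit)
  next
    case False
    have "a = unset_bit i a"
      by (rule bit_eqI) (use False in \<open>auto simp: bit_simps\<close>)
    then show ?thesis using False by (simp add: qbit_bit)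
  qed
  have 2: "unset_bit i a + 2 ^ i = set_bit i a"
  proof -
    have "set_bit i a = set_bit i (unset_bit i a)" by (rule bit_eqI) (auto simp: bit_simps)
    also have "\<dots> = unset_bit i a + 2 ^ i" by (simp add: set_bit_eq bit_simps)
    finally show ?thesis by simp
  qed
  show ?thesis using assms 2 by (auto simp: set_qbit_def 1 less_2_cases_iff)
qed

lemma bit_set_qbit: "c < 2 \<Longrightarrow> bit (set_qbit i c a) k \<longleftrightarrow> (if k = i then c = 1 else bit a k)"
  by (auto simp: set_qbit_bit bit_simps)

lemma qbit_set_qbit [simp]: "c < 2 \<Longrightarrow> qbit k (set_qbit i c a) = (if k = i then c else qbit k a)"
  by (auto simp: qbit_bit bit_set_qbit less_2_cases_iff)

lemma set_qbit_set_qbit [simp]: "c < 2 \<Longrightarrow> d < 2 \<Longrightarrow> set_qbit i c (set_qbit i d a) = set_qbit i c a"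
  by (rule bit_eqI) (auto simp: bit_set_qbit)

lemma set_qbit_qbit [simp]: "set_qbit i (qbit i a) a = a"
  by (rule bit_eqI) (auto simp: bit_set_qbit qbit_bit)

lemma set_qbit_commute: "c < 2 \<Longrightarrow> d < 2 \<Longrightarrow> i \<noteq> j \<Longrightarrow> set_qbit i c (set_qbit j d a) = set_qbit j d (set_qbit i c a)"
  by (rule bit_eqI) (auto simp: bit_set_qbit)

lemma lt_pow_bit: "(a::nat) < 2 ^ n \<longleftrightarrow> (\<forall>k\<ge>n. \<not> bit a k)"
proof
  assume "a < 2 ^ n"
  then have "take_bit n a = a" by (simp add: take_bit_nat_eq_self_iff)
  then show "\<forall>k\<ge>n. \<not> bit a k" by (metis bit_take_bit_iff not_less)
next
  assume "\<forall>k\<ge>n. \<not> bit a k"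
  then have "take_bit n a = a" by (intro bit_eqI) (metis bit_take_bit_iff leI)
  then show "a < 2 ^ n" by (simp add: take_bit_nat_eq_self_iff)
qed

lemma set_qbit_lt [simp]: "a < 2 ^ n \<Longrightarrow> i < n \<Longrightarrow> c < 2 \<Longrightarrow> set_qbit i c a < 2 ^ n"
  by (auto simp: lt_pow_bit bit_set_qbit)

lemma qbit_eqI:
  assumes "a < 2 ^ n" "b < 2 ^ n" "\<And>k. k < n \<Longrightarrow> qbit k a = qbit k b"
  shows "a = b"
proof (rule bit_eqI)
  fix k show "bit a k = bit b k"
  proof (cases "k < n")
    case True
    then show ?thesis using assms(3)[OF True] by (cases "bit a k"; cases "bit b k") (auto simp: qbit_bit)
  qed (use assms in \<open>auto simp: lt_pow_bit\<close>)
qed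

definition flip :: "nat \<Rightarrow> nat \<Rightarrow> nat" where
  "flip i a = set_qbit i (1 - qbit i a) a"

lemma one_minus_lt [simp]: "1 - c < (2::nat)"
  by simp

lemma qbit_flip [simp]: "qbit k (flip i a) = (if k = i then 1 - qbit i a else qbit k a)"
  by (simp add: flip_def)

lemma qbit_cases: "qbit i a = 0 \<or> qbit i a = 1"
  using qbit_lt[of i a] by (auto simp: less_2_cases_iff)

lemma flip_flip [simp]: "flip i (flip i a) = a"
proof -
  have "1 - (1 - qbit i a) = qbit i a" using qbit_cases[of i a] by auto
  then have "flip i (flip i a) = set_qbit i (qbit i a) a"
    by (simp add: flip_def[of i "flip i a"] del: set_qbit_qbit) (simp add: flip_def del: set_qbit_qbit)
  then show ?thesis by simp
qed

lemma flip_commute: "flip i (flip j a) = flip j (flip i a)"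
  by (cases "i = j") (simp_all add: flip_def set_qbit_commute)

lemma flip_lt [simp]: "a < 2 ^ n \<Longrightarrow> i < n \<Longrightarrow> flip i a < 2 ^ n"
  by (simp add: flip_def)

text \<open>The booleans select the Pauli matrix: (True,False) is X, (False,True) is Z, (True,True) is Y.\<close>

definition pauli :: "nat \<Rightarrow> nat \<Rightarrow> bool \<Rightarrow> bool \<Rightarrow> complex mat" where
  "pauli n i x z = mat (2^n) (2^n) (\<lambda>(a,b). if b = (if x then flip i a else a)
     then (if z \<and> qbit i a = 1 then -1 else 1) * (if x \<and> z then -\<i> else 1) else 0)"

lemma pauli_carrier [simp]: "pauli n i x z \<in> sq (2^n)"
  by (simp add: pauli_def)

lemma pauli_mult_left:
  assumes "A \<in> sq (2^n)" "a < 2^n" "b < 2^n" "i < n"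
  shows "(pauli n i x z * A) $$ (a,b) = (if z \<and> qbit i a = 1 then -1 else 1) * (if x \<and> z then -\<i> else 1)
     * A $$ (if x then flip i a else a, b)"
proof -
  let ?p = "if x then flip i a else a"
  have "(pauli n i x z * A) $$ (a,b) = (\<Sum>l<2^n. pauli n i x z $$ (a,l) * A $$ (l,b))"
    by (rule mult_index[OF pauli_carrier assms(1-3)])
  also have "\<dots> = (\<Sum>l\<in>{?p}. pauli n i x z $$ (a,l) * A $$ (l,b))"
    using assms by (intro sum.mono_neutral_right) (auto simp: pauli_def)
  finally show ?thesis using assms by (simp add: pauli_def)
qed

lemma pauli_mult_right:
  assumes "A \<in> sq (2^n)" "a < 2^n" "b < 2^n" "i < n"
  shows "(A * pauli n i x z) $$ (a,b) = (if z \<and> qbit i b = 1 then -1 else 1) * (if x \<and> z then \<i> else 1)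
     * A $$ (a, if x then flip i b else b)"
proof -
  let ?p = "if x then flip i b else b"
  have "(A * pauli n i x z) $$ (a,b) = (\<Sum>l<2^n. A $$ (a,l) * pauli n i x z $$ (l,b))"
    by (rule mult_index[OF assms(1) pauli_carrier assms(2-3)])
  also have "\<dots> = (\<Sum>l\<in>{?p}. A $$ (a,l) * pauli n i x z $$ (l,b))"
    using assms by (intro sum.mono_neutral_right) (auto simp: pauli_def)
  finally show ?thesis using assms qbit_cases[of i b] by (auto simp: pauli_def)
qed

text \<open>The phases of the two outer factors cancel; X leaves a relabelling of the basis, Z a
  sign between states whose i-th bits differ.\<close>

lemma pauli_conj:
  assumes "A \<in> sq (2^n)" "a < 2^n" "b < 2^n" "i < n"
  shows "(pauli n i x z * A * pauli n i x z) $$ (a,b) = (if z \<and> qbit i a \<noteq> qbit i b then -1 else 1)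
     * A $$ (if x then flip i a else a, if x then flip i b else b)"
  using assms qbit_cases[of i a] qbit_cases[of i b]
  by (subst pauli_mult_right, simp, simp, simp, simp, subst pauli_mult_left) auto

lemma sym_unitary_pauli: "i < n \<Longrightarrow> sym_unitary (2^n) (pauli n i x z)"
  unfolding sym_unitary_def
proof (intro conjI pauli_carrier)
  assume i: "i < n"
  show "madj (pauli n i x z) = pauli n i x z"
  proof (rule sq_eqI)
    fix a b :: nat assume ab: "a < 2^n" "b < 2^n"
    have f: "b = flip i a \<longleftrightarrow> a = flip i b" by (metis flip_flip)
    show "madj (pauli n i x z) $$ (a,b) = pauli n i x z $$ (a,b)"
    proof -
      have "madj (pauli n i x z) $$ (a,b) = cnj (pauli n i x z $$ (b,a))"
        using ab by (intro madj_index) (auto simp: pauli_def)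
      then show ?thesis using ab f qbit_cases[of i a] qbit_cases[of i b] by (cases "x"; cases z) (auto simp: pauli_def)
    qed
  qed auto
  show "pauli n i x z * pauli n i x z = 1\<^sub>m (2^n)"
  proof (rule sq_eqI)
    fix a b :: nat assume ab: "a < 2^n" "b < 2^n"
    show "(pauli n i x z * pauli n i x z) $$ (a,b) = 1\<^sub>m (2^n) $$ (a,b)"
      using ab i qbit_cases[of i a] unfolding pauli_mult_left[OF pauli_carrier ab i] by (auto simp: pauli_def)
  qed auto
qed

lemma pauli_conj_conj:
  assumes "A \<in> sq (2^n)" "a < 2^n" "b < 2^n" "i < n" "j < n"
  shows "(pauli n i x z * (pauli n j x' z' * A * pauli n j x' z') * pauli n i x z) $$ (a,b) =
     (if z \<and> qbit i a \<noteq> qbit i b then -1 else 1) * (if z' \<and> qbit j a \<noteq> qbit j b then -1 else 1)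
     * A $$ (if x' then flip j (if x then flip i a else a) else if x then flip i a else a,
             if x' then flip j (if x then flip i b else b) else if x then flip i b else b)"
proof -
  have c: "pauli n j x' z' * A * pauli n j x' z' \<in> sq (2^n)"
    by (intro sq_closed pauli_carrier assms)
  have s: "qbit j (flip i a) \<noteq> qbit j (flip i b) \<longleftrightarrow> qbit j a \<noteq> qbit j b"
    using qbit_cases[of i a] qbit_cases[of i b] by auto
  show ?thesis unfolding pauli_conj[OF c assms(2-4)]
    by (subst pauli_conj[OF assms(1) _ _ assms(5)]) (use assms s in auto)
qed

text \<open>The sign in \<open>pauli_conj\<close> depends only on whether two bits agree, and no
  simultaneous flip changes that; so signs and relabellings commute, also for i = j.\<close>

lemma conj_commute_pauli: "i < n \<Longrightarrow> j < n \<Longrightarrow> conj_commute (2^n) (pauli n i x z) (pauli n j x' z')"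
  unfolding conj_commute_def
proof
  fix A :: "complex mat" assume ij: "i < n" "j < n" and A: "A \<in> sq (2^n)"
  show "pauli n i x z * (pauli n j x' z' * A * pauli n j x' z') * pauli n i x z =
      pauli n j x' z' * (pauli n i x z * A * pauli n i x z) * pauli n j x' z'"
    by (rule sq_eqI[of _ "2^n"]) (use ij A in \<open>auto simp: pauli_conj_conj flip_commute[of i j]\<close>)
qed

section \<open>Pauli dephasings and the depolarizing channel\<close>

abbreviation ptwirl :: "nat \<Rightarrow> nat \<Rightarrow> bool \<Rightarrow> bool \<Rightarrow> real \<Rightarrow> complex mat \<Rightarrow> complex mat" where
  "ptwirl n i x z \<equiv> twirl (pauli n i x z)"

lemma ptwirl_index:
  assumes "A \<in> sq (2^n)" "a < 2^n" "b < 2^n" "i < n"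
  shows "ptwirl n i x z l A $$ (a,b) = ((1 + l) / 2) * A $$ (a,b) + ((1 - l) / 2) *
     ((if z \<and> qbit i a \<noteq> qbit i b then -1 else 1) * A $$ (if x then flip i a else a, if x then flip i b else b))"
  using twirl_index[OF pauli_carrier assms(1-3)] pauli_conj[OF assms] by simp

lemma ptwirl_commute:
  "A \<in> sq (2^n) \<Longrightarrow> i < n \<Longrightarrow> j < n \<Longrightarrow>
    ptwirl n i x z l (ptwirl n j x' z' k A) = ptwirl n j x' z' k (ptwirl n i x z l A)"
  by (rule twirl_commute[of _ "2^n"]) (auto intro: conj_commute_pauli)

lemma replace_mixed_carrier [simp]: "replace_mixed n i A \<in> sq (2^n)"
  by (simp add: replace_mixed_def)

lemma replace_mixed_index:
  assumes "a < 2^n" "b < 2^n"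
  shows "replace_mixed n i A $$ (a,b) = (if qbit i a = qbit i b then (A $$ (a,b) + A $$ (flip i a, flip i b)) / 2 else 0)"
proof -
  have "(\<Sum>c<2. A $$ (set_qbit i c a, set_qbit i c b)) = A $$ (a,b) + A $$ (flip i a, flip i b)"
    if "qbit i a = qbit i b"
  proof -
    have "{..<2::nat} = {0,1}" by auto
    then have "(\<Sum>c<2. A $$ (set_qbit i c a, set_qbit i c b)) =
        A $$ (set_qbit i 0 a, set_qbit i 0 b) + A $$ (set_qbit i 1 a, set_qbit i 1 b)" by simp
    moreover have "qbit i a = 0 \<Longrightarrow> set_qbit i 0 a = a \<and> set_qbit i 0 b = b \<and> set_qbit i 1 a = flip i a \<and> set_qbit i 1 b = flip i b"
      using that set_qbit_qbit[of i a] set_qbit_qbit[of i b] by (simp add: flip_def del: set_qbit_qbit)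
    moreover have "qbit i a = 1 \<Longrightarrow> set_qbit i 1 a = a \<and> set_qbit i 1 b = b \<and> set_qbit i 0 a = flip i a \<and> set_qbit i 0 b = flip i b"
      using that set_qbit_qbit[of i a] set_qbit_qbit[of i b] by (simp add: flip_def del: set_qbit_qbit)
    ultimately show ?thesis using qbit_cases[of i a] by (auto simp: add.commute)
  qed
  then show ?thesis using assms by (simp add: replace_mixed_def)
qed

text \<open>Each complete dephasing keeps one axis of the Bloch ball, so two along different axes
  leave only its centre.\<close>

lemma ptwirl_pair:
  assumes "A \<in> sq (2^n)" "i < n" "x \<or> z" "x' \<or> z'" "x \<noteq> x' \<or> z \<noteq> z'"
  shows "ptwirl n i x z 0 (ptwirl n i x' z' 0 A) = replace_mixed n i A"
proof (rule sq_eqI)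
  fix a b :: nat assume ab: "a < 2^n" "b < 2^n"
  have s: "qbit i (flip i a) = qbit i (flip i b) \<longleftrightarrow> qbit i a = qbit i b"
    using qbit_cases[of i a] qbit_cases[of i b] by auto
  show "ptwirl n i x z 0 (ptwirl n i x' z' 0 A) $$ (a,b) = replace_mixed n i A $$ (a,b)"
    using assms ab s unfolding replace_mixed_index[OF ab]
    by (cases x; cases z; cases x'; cases z'; cases "qbit i a = qbit i b")
      (simp_all add: ptwirl_index[of _ n] del: qbit_flip, (simp_all add: field_simps)?)
qed (use assms in auto)

text \<open>Each Bloch component survives one of the three dephasings and is multiplied by l in the
  other two, which gives the depolarizing factor l^2 = 1 - p.\<close>

lemma depol_on_twirl:
  assumes "A \<in> sq (2^n)" "i < n" "p = 1 - l\<^sup>2"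
  shows "depol_on n i p A = ptwirl n i False True l (ptwirl n i True False l (ptwirl n i True True l A))"
proof (rule sq_eqI)
  fix a b :: nat assume ab: "a < 2^n" "b < 2^n"
  have s: "qbit i (flip i a) = qbit i (flip i b) \<longleftrightarrow> qbit i a = qbit i b"
    using qbit_cases[of i a] qbit_cases[of i b] by auto
  have "depol_on n i p A $$ (a,b) = l\<^sup>2 * A $$ (a,b) + (1 - l\<^sup>2) * replace_mixed n i A $$ (a,b)"
    unfolding depol_on_def assms(3) using assms(1) ab by (simp add: sq_index[of _ "2^n"])
  then show "depol_on n i p A $$ (a,b) = ptwirl n i False True l (ptwirl n i True False l (ptwirl n i True True l A)) $$ (a,b)"
    using assms ab s unfolding replace_mixed_index[OF ab]
    by (cases "qbit i a = qbit i b")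
      (simp_all add: ptwirl_index[of _ n] power2_eq_square del: qbit_flip, (simp add: field_simps)+)
qed (use assms in \<open>auto simp: depol_on_def\<close>)

section \<open>States that are diagonal away from one qubit\<close>

lemma pd_rdiag:
  assumes "\<And>i. i < N \<Longrightarrow> r i > 0"
  shows "pd N (rdiag N r)"
proof -
  have q: "(rdiag N r *\<^sub>v v) \<bullet>c v = complex_of_real (\<Sum>i<N. r i * (cmod (v $ i))\<^sup>2)" if v: "v \<in> carrier_vec N" for v
  proof -
    have "(rdiag N r *\<^sub>v v) $ i = r i * v $ i" if "i < N" for i
    proof -
      have "(\<Sum>l<N. rdiag N r $$ (i,l) * v $ l) = (\<Sum>l\<in>{i}. rdiag N r $$ (i,l) * v $ l)"
        using that by (intro sum.mono_neutral_right) (auto simp: mat_diag_def)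
      then show ?thesis using mult_vec_index[OF mat_diag_dim v that, of "\<lambda>i. complex_of_real (r i)"] that
        by (simp add: mat_diag_def)
    qed
    then show ?thesis unfolding cprod_sum[OF v] of_real_sum
      by (intro sum.cong) (auto simp: mult.assoc mult_cnj_self)
  qed
  have nn: "(\<Sum>i<N. r i * (cmod (v $ i))\<^sup>2) \<ge> 0" for v
    using assms by (intro sum_nonneg) (simp add: less_imp_le)
  have "(\<Sum>i<N. r i * (cmod (v $ i))\<^sup>2) > 0" if v: "v \<in> carrier_vec N" "v \<noteq> 0\<^sub>v N" for v
  proof -
    obtain i where i: "i < N" "v $ i \<noteq> 0" using v by (metis carrier_vecD eq_vecI index_zero_vec)
    have "0 < r i * (cmod (v $ i))\<^sup>2" using i assms by simp
    also have "\<dots> \<le> (\<Sum>i<N. r i * (cmod (v $ i))\<^sup>2)"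
      using i assms by (intro member_le_sum) (auto simp: less_imp_le)
    finally show ?thesis .
  qed
  then show ?thesis using q nn by (auto simp: pd_def psd_def)
qed

lemma neg_entropy_rdiag:
  assumes "\<And>i. i < N \<Longrightarrow> r i > 0"
  shows "neg_entropy N (rdiag N r) = (\<Sum>i<N. r i * ln (r i))"
proof (rule neg_entropy_spec[OF _ assms])
  show "spec N (rdiag N r) (1\<^sub>m N) r"
    by (simp add: spec_def unitary_one left_mult_one_mat[of _ N N] right_mult_one_mat[of _ N N])
qed

section \<open>Entropy of a positive 2 x 2 matrix in terms of trace and discriminant\<close>

definition pair_entropy :: "real \<Rightarrow> real \<Rightarrow> real" where
  "pair_entropy S d = (S + sqrt d) / 2 * ln ((S + sqrt d) / 2) + (S - sqrt d) / 2 * ln ((S - sqrt d) / 2)"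

lemma sum_lessThan_2: "(\<Sum>z<2. f z) = f 0 + f (Suc 0)" for f :: "nat \<Rightarrow> 'a::comm_monoid_add"
  by (simp add: numeral_2_eq_2)

text \<open>Here S is the trace of a 2 x 2 block and d the squared difference of its eigenvalues.  The
  lemma is the dephasing inequality for a diagonal qubit state under the bit flip channel.\<close>

lemma pair_entropy_scale:
  assumes "d \<ge> 0" "sqrt d < S" "0 \<le> l" "l \<le> 1"
  shows "pair_entropy S (l\<^sup>2 * d) \<le> l\<^sup>2 * pair_entropy S d + (1 - l\<^sup>2) * pair_entropy S 0"
proof -
  define R where "R k = rdiag 2 (\<lambda>i. if i = 0 then (S + k * sqrt d) / 2 else (S - k * sqrt d) / 2)" for k
  let ?P = "pauli 1 0 True False"
  have P: "sym_unitary 2 ?P" using sym_unitary_pauli[of 0 1] by simp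
  have b: "0 \<le> k * sqrt d" "k * sqrt d < S" if "0 \<le> k" "k \<le> 1" for k
  proof -
    show "0 \<le> k * sqrt d" using that assms(1) by simp
    have "k * sqrt d \<le> sqrt d" using that assms(1) by (simp add: mult_left_le_one_le)
    then show "k * sqrt d < S" using assms(2) by simp
  qed
  have ent: "neg_entropy 2 (R k) = pair_entropy S (k\<^sup>2 * d)" if "0 \<le> k" "k \<le> 1" for k
  proof -
    have "sqrt (k\<^sup>2 * d) = k * sqrt d" using that by (simp add: real_sqrt_mult)
    then show ?thesis unfolding R_def pair_entropy_def
      by (subst neg_entropy_rdiag) (use b[OF that] in \<open>auto simp: sum_lessThan_2\<close>)
  qed
  have RC: "R k \<in> sq (2^1)" for k unfolding R_def by (simp del: One_nat_def)
  have tw: "twirl ?P k (R 1) = R k" for k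
  proof (rule sq_eqI[of _ "2^1"])
    fix a b :: nat assume ab: "a < 2^1" "b < 2^1"
    then have "a = 0 \<or> a = 1" "b = 0 \<or> b = 1" by auto
    moreover have "flip 0 0 = 1" "flip 0 1 = 0" by (auto simp: flip_def set_qbit_def qbit_def)
    ultimately show "twirl ?P k (R 1) $$ (a,b) = R k $$ (a,b)"
      by (subst ptwirl_index[OF RC[of 1] ab, of 0 True False k], simp) (auto simp: R_def mat_diag_def field_simps)
  qed (use twirl_carrier[OF pauli_carrier[of 1 0 True False] RC[of 1]] RC[of k] in auto)
  have "0 < S + sqrt d" "0 < S - sqrt d" using assms(2) real_sqrt_ge_zero[OF assms(1)] by linarith+
  then have "pd 2 (R 1)" unfolding R_def by (intro pd_rdiag) auto
  from neg_entropy_twirl_le[OF this P, of l] assms(3,4) ent[of 0] ent[of 1] ent[of l]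
  show ?thesis unfolding tw by simp
qed

text \<open>Convexity is needed only along the chord from 0 to x + y + w: the weights of the three
  points add up to 1 at its far end and to 2 at the origin.\<close>

lemma pair_entropy_add:
  assumes "x \<ge> 0" "y \<ge> 0" "w \<ge> 0" "sqrt (x + y + w) < S"
  shows "pair_entropy S x + pair_entropy S y + pair_entropy S w \<le> pair_entropy S (x + y + w) + 2 * pair_entropy S 0"
proof (cases "x + y + w = 0")
  case True
  then have "x = 0" "y = 0" "w = 0" using assms by linarith+
  then show ?thesis by simp
next
  case False
  define d where "d = x + y + w"
  have d: "d > 0" using False assms unfolding d_def by linarith
  have "pair_entropy S t \<le> t / d * pair_entropy S d + (1 - t / d) * pair_entropy S 0" if "0 \<le> t" "t \<le> d" for t
  proof -
    have "0 \<le> t / d" "t / d \<le> 1" using that d by auto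
    then show ?thesis
      using pair_entropy_scale[of d S "sqrt (t / d)"] that d assms(4) unfolding d_def[symmetric] by simp
  qed
  from this[of x] this[of y] this[of w] assms
  have "pair_entropy S x + pair_entropy S y + pair_entropy S w \<le>
    (x / d + y / d + w / d) * pair_entropy S d + (3 - (x / d + y / d + w / d)) * pair_entropy S 0"
    unfolding d_def[symmetric] by (simp add: algebra_simps d_def)
  also have "x / d + y / d + w / d = 1" using d unfolding d_def by (simp flip: add_divide_distrib)
  finally show ?thesis unfolding d_def by simp
qed

text \<open>The trace and the trace of the square determine the eigenvalues up to order, through (r0
  - r1)^2 = 2 tr(T^2) - (tr T)^2.\<close>

lemma spec_two:
  assumes "spec 2 T U r" "madj T = T"
  shows "r 0 * ln (r 0) + r 1 * ln (r 1) =
      pair_entropy (Re (T $$ (0,0)) + Re (T $$ (1,1))) ((Re (T $$ (0,0)) - Re (T $$ (1,1)))\<^sup>2 + 4 * (cmod (T $$ (0,1)))\<^sup>2)"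
    and "r 0 > 0 \<Longrightarrow> r 1 > 0 \<Longrightarrow>
      sqrt ((Re (T $$ (0,0)) - Re (T $$ (1,1)))\<^sup>2 + 4 * (cmod (T $$ (0,1)))\<^sup>2) < Re (T $$ (0,0)) + Re (T $$ (1,1))"
proof -
  note s = specD[OF assms(1)]
  note u = unitary_matD[OF s(1)]
  have h: "T $$ (j,i) = cnj (T $$ (i,j))" if "i < 2" "j < 2" for i j
    using that s(3) arg_cong[OF assms(2), of "\<lambda>X. X $$ (j,i)"] by simp
  have im: "Im (T $$ (0,0)) = 0" "Im (T $$ (1,1)) = 0"
    using arg_cong[OF h[of 0 0], of Im] arg_cong[OF h[of 1 1], of Im] by auto
  have S: "r 0 + r 1 = Re (T $$ (0,0)) + Re (T $$ (1,1))"
    using arg_cong[OF spec_mtrace[OF assms(1)], of Re] s(3) by (simp add: mtrace_carrier[of _ 2] sum_lessThan_2)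
  have "T * T = U * (rdiag 2 r * (madj U * (U * (rdiag 2 r * madj U))))"
    using s(2) u(1,2) by (simp add: sq_assoc[of _ 2])
  also have "madj U * (U * (rdiag 2 r * madj U)) = rdiag 2 r * madj U"
    using unitary_cancel(1)[OF s(1)] u(2) by simp
  also have "rdiag 2 r * (rdiag 2 r * madj U) = rdiag 2 (\<lambda>i. (r i)\<^sup>2) * madj U"
    using assoc_mult_mat[OF mat_diag_dim mat_diag_dim u(2), of "\<lambda>i. complex_of_real (r i)" "\<lambda>i. complex_of_real (r i)"]
    by (simp add: power2_eq_square)
  finally have "T * T = U * rdiag 2 (\<lambda>i. (r i)\<^sup>2) * madj U"
    using u(1,2) by (simp add: sq_assoc[of _ 2])
  then have "spec 2 (T * T) U (\<lambda>i. (r i)\<^sup>2)" using s(1) by (simp add: spec_def)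
  from spec_mtrace[OF this] have "complex_of_real ((r 0)\<^sup>2 + (r 1)\<^sup>2) = mtrace (T * T)" by (simp add: sum_lessThan_2)
  also have "\<dots> = mtrace (madj T * T)" by (simp only: assms(2))
  also have "\<dots> = of_real ((cmod (T $$ (0,0)))\<^sup>2 + (cmod (T $$ (0,1)))\<^sup>2 + (cmod (T $$ (1,0)))\<^sup>2 + (cmod (T $$ (1,1)))\<^sup>2)"
    unfolding mtrace_madj_mult[OF s(3) s(3)] by (simp add: sum_lessThan_2 cnj_mult_self)
  finally have "(r 0)\<^sup>2 + (r 1)\<^sup>2 = (cmod (T $$ (0,0)))\<^sup>2 + (cmod (T $$ (0,1)))\<^sup>2 + (cmod (T $$ (1,0)))\<^sup>2 + (cmod (T $$ (1,1)))\<^sup>2"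
    by (metis of_real_eq_iff)
  also have "cmod (T $$ (1,0)) = cmod (T $$ (0,1))" using h[of 0 1] by simp
  also have "(cmod (T $$ (0,0)))\<^sup>2 = (Re (T $$ (0,0)))\<^sup>2" by (simp add: cmod_power2 im)
  also have "(cmod (T $$ (1,1)))\<^sup>2 = (Re (T $$ (1,1)))\<^sup>2" using im by (simp add: cmod_power2)
  finally have q: "(r 0)\<^sup>2 + (r 1)\<^sup>2 = (Re (T $$ (0,0)))\<^sup>2 + 2 * (cmod (T $$ (0,1)))\<^sup>2 + (Re (T $$ (1,1)))\<^sup>2" by simp
  define d where "d = (Re (T $$ (0,0)) - Re (T $$ (1,1)))\<^sup>2 + 4 * (cmod (T $$ (0,1)))\<^sup>2"
  have "(r 0 - r 1)\<^sup>2 = 2 * ((r 0)\<^sup>2 + (r 1)\<^sup>2) - (r 0 + r 1)\<^sup>2" by (simp add: power2_eq_square algebra_simps)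
  also have "\<dots> = d" unfolding q S d_def by (simp add: power2_eq_square algebra_simps)
  finally have sd: "sqrt d = \<bar>r 0 - r 1\<bar>" by (metis real_sqrt_abs)
  show "r 0 * ln (r 0) + r 1 * ln (r 1) =
      pair_entropy (Re (T $$ (0,0)) + Re (T $$ (1,1))) ((Re (T $$ (0,0)) - Re (T $$ (1,1)))\<^sup>2 + 4 * (cmod (T $$ (0,1)))\<^sup>2)"
    unfolding d_def[symmetric] pair_entropy_def sd S[symmetric] by (cases "r 0 \<ge> r 1") auto
  show "sqrt ((Re (T $$ (0,0)) - Re (T $$ (1,1)))\<^sup>2 + 4 * (cmod (T $$ (0,1)))\<^sup>2) < Re (T $$ (0,0)) + Re (T $$ (1,1))"
    if "r 0 > 0" "r 1 > 0"
    unfolding d_def[symmetric] sd S[symmetric] using that by (simp add: abs_if)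
qed

section \<open>Block-diagonal matrices with one 2 x 2 block per setting of the other qubits\<close>

abbreviation base :: "nat \<Rightarrow> nat \<Rightarrow> nat" where
  "base i a \<equiv> set_qbit i 0 a"

text \<open>A direct sum of the 2 x 2 matrices u c, where c is the index with bit i cleared and
  labels the block; products and adjoints are taken blockwise.\<close>

definition blk :: "nat \<Rightarrow> nat \<Rightarrow> (nat \<Rightarrow> nat \<Rightarrow> nat \<Rightarrow> complex) \<Rightarrow> complex mat" where
  "blk n i u = mat (2^n) (2^n) (\<lambda>(a,b). if base i a = base i b then u (base i a) (qbit i a) (qbit i b) else 0)"

lemma blk_carrier [simp]: "blk n i u \<in> sq (2^n)"
  by (simp add: blk_def)

lemma blk_index:
  "a < 2^n \<Longrightarrow> b < 2^n \<Longrightarrow> blk n i u $$ (a,b) = (if base i a = base i b then u (base i a) (qbit i a) (qbit i b) else 0)"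
  by (simp add: blk_def)

lemma set_qbit_base_qbit [simp]: "set_qbit i (qbit i a) (base i a) = a"
  by (subst set_qbit_set_qbit) auto

lemma base_eqD: "base i a = base i b \<Longrightarrow> set_qbit i (qbit i b) a = b"
  by (metis pos2 qbit_lt set_qbit_base_qbit set_qbit_set_qbit)

lemma base_qbit_eqD: "base i a = base i b \<Longrightarrow> qbit i a = qbit i b \<Longrightarrow> a = b"
  by (metis set_qbit_base_qbit)

lemma blk_cong:
  assumes "i < n" "\<And>c x y. c < 2^n \<Longrightarrow> x < 2 \<Longrightarrow> y < 2 \<Longrightarrow> u c x y = v c x y"
  shows "blk n i u = blk n i v"
  using assms by (intro sq_eqI[of _ "2^n"]) (auto simp: blk_index)

lemma blk_mult:
  assumes i: "i < n"
  shows "blk n i u * blk n i v = blk n i (\<lambda>c x y. \<Sum>z<2. u c x z * v c z y)"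
proof (rule sq_eqI[of _ "2^n"])
  fix a b :: nat assume ab: "a < 2^n" "b < 2^n"
  \<comment> \<open>The two indices that share the block of a; all other summands vanish.\<close>
  let ?L = "(\<lambda>z. set_qbit i z a) ` {..<2}"
  have "(blk n i u * blk n i v) $$ (a,b) = (\<Sum>l<2^n. blk n i u $$ (a,l) * blk n i v $$ (l,b))"
    by (rule mult_index[OF blk_carrier blk_carrier ab])
  also have "\<dots> = (\<Sum>l\<in>?L. blk n i u $$ (a,l) * blk n i v $$ (l,b))"
  proof (intro sum.mono_neutral_right ballI)
    fix l assume l: "l \<in> {..<2^n} - ?L"
    have "base i a \<noteq> base i l"
    proof
      assume "base i a = base i l"
      then have "l = set_qbit i (qbit i l) a" using base_eqD[of i a l] by simp
      then have "l \<in> ?L" using qbit_lt[of i l] by blast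
      then show False using l by blast
    qed
    then show "blk n i u $$ (a,l) * blk n i v $$ (l,b) = 0" using ab l by (simp add: blk_index)
  qed (use ab i in auto)
  also have "\<dots> = (\<Sum>z<2. blk n i u $$ (a, set_qbit i z a) * blk n i v $$ (set_qbit i z a, b))"
  proof (rule sum.reindex_cong[OF _ refl refl])
    show "inj_on (\<lambda>z. set_qbit i z a) {..<2}"
    proof (rule inj_onI)
      fix x y assume "x \<in> {..<2}" "y \<in> {..<2}" "set_qbit i x a = set_qbit i y a"
      then show "x = y" by (metis lessThan_iff qbit_set_qbit)
    qed
  qed
  also have "\<dots> = blk n i (\<lambda>c x y. \<Sum>z<2. u c x z * v c z y) $$ (a,b)"
    using ab i by (auto simp: blk_index intro!: sum.cong)
  finally show "(blk n i u * blk n i v) $$ (a,b) = blk n i (\<lambda>c x y. \<Sum>z<2. u c x z * v c z y) $$ (a,b)" .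
qed auto

lemma madj_blk: "madj (blk n i u) = blk n i (\<lambda>c x y. cnj (u c y x))"
  by (rule sq_eqI[of _ "2^n"]) (auto simp: blk_def)

lemma blk_one: "blk n i (\<lambda>c x y. if x = y then 1 else 0) = 1\<^sub>m (2^n)"
  by (rule sq_eqI[of _ "2^n"]) (auto simp: blk_index dest: base_qbit_eqD)

lemma blk_rdiag: "rdiag (2^n) (\<lambda>a. r (base i a) (qbit i a)) = blk n i (\<lambda>c x y. if x = y then complex_of_real (r c x) else 0)"
  by (rule sq_eqI[of _ "2^n"]) (auto simp: blk_index mat_diag_def dest: base_qbit_eqD)

definition blk_diag :: "nat \<Rightarrow> nat \<Rightarrow> complex mat \<Rightarrow> bool" where
  "blk_diag n i A \<longleftrightarrow> (\<forall>a<2^n. \<forall>b<2^n. base i a \<noteq> base i b \<longrightarrow> A $$ (a,b) = 0)"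

lemma blk_diag_eq:
  assumes "A \<in> sq (2^n)" "blk_diag n i A"
  shows "A = blk n i (\<lambda>c x y. A $$ (set_qbit i x c, set_qbit i y c))"
proof (rule sq_eqI[OF assms(1) blk_carrier])
  fix a b :: nat assume ab: "a < 2^n" "b < 2^n"
  show "A $$ (a,b) = blk n i (\<lambda>c x y. A $$ (set_qbit i x c, set_qbit i y c)) $$ (a,b)"
  proof (cases "base i a = base i b")
    case True
    have "set_qbit i (qbit i b) (base i a) = b" unfolding True by (rule set_qbit_base_qbit)
    then show ?thesis using ab True set_qbit_base_qbit[of i a]
      by (simp add: blk_index del: set_qbit_set_qbit set_qbit_base_qbit)
  next
    case False
    then show ?thesis using assms(2) ab by (simp add: blk_index blk_diag_def)
  qed
qed

definition blk_sum :: "nat \<Rightarrow> complex mat \<Rightarrow> nat \<Rightarrow> real" where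
  "blk_sum i A c = Re (A $$ (set_qbit i 0 c, set_qbit i 0 c)) + Re (A $$ (set_qbit i 1 c, set_qbit i 1 c))"

text \<open>For a self-adjoint block this is the squared length of its unnormalized Bloch vector,
  the off-diagonal entry carrying two of the three components.\<close>

definition blk_disc :: "nat \<Rightarrow> complex mat \<Rightarrow> nat \<Rightarrow> real" where
  "blk_disc i A c = (Re (A $$ (set_qbit i 0 c, set_qbit i 0 c)) - Re (A $$ (set_qbit i 1 c, set_qbit i 1 c)))\<^sup>2
     + 4 * (cmod (A $$ (set_qbit i 0 c, set_qbit i 1 c)))\<^sup>2"

text \<open>The blocks are diagonalized separately and their eigenvectors assembled into one
  block-diagonal unitary. Summing over all indices instead of blocks counts every block twice, hence
  the division by 2.\<close>

lemma neg_entropy_blk: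
  assumes A: "pd (2^n) A" and bd: "blk_diag n i A" and i: "i < n"
  shows "neg_entropy (2^n) A = (\<Sum>a<2^n. pair_entropy (blk_sum i A (base i a)) (blk_disc i A (base i a))) / 2"
    and "c < 2^n \<Longrightarrow> sqrt (blk_disc i A c) < blk_sum i A c"
proof -
  note c = pd_carrier[OF A]
  define T where "T c = mat 2 2 (\<lambda>(x,y). A $$ (set_qbit i x c, set_qbit i y c))" for c
  have T: "T c \<in> sq 2" for c by (simp add: T_def)
  have Ah: "cnj (A $$ (b,a)) = A $$ (a,b)" if "a < 2^n" "b < 2^n" for a b
    using that c arg_cong[OF psd_hermitian[OF pd_psd[OF A]], of "\<lambda>X. X $$ (a,b)"] by simp
  have Th: "madj (T c) = T c" if "c < 2^n" for c
  proof (rule sq_eqI[of _ 2])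
    fix x y :: nat assume "x < 2" "y < 2"
    moreover from this have "madj (T c) $$ (x,y) = cnj (T c $$ (y,x))" using T[of c] by (intro madj_index) auto
    ultimately show "madj (T c) $$ (x,y) = T c $$ (x,y)"
      using Ah[of "set_qbit i x c" "set_qbit i y c"] that i by (simp add: T_def)
  qed (use T in auto)
  have "\<forall>c. \<exists>p. c < 2^n \<longrightarrow> spec 2 (T c) (fst p) (snd p)"
    using hermitian_spec[OF T Th] by auto
  then obtain p where p: "\<And>c. c < 2^n \<Longrightarrow> spec 2 (T c) (fst (p c)) (snd (p c))" by metis
  define u where "u c x y = fst (p c) $$ (x,y)" for c x y
  define r where "r c = snd (p c)" for c
  define r' where "r' a = r (base i a) (qbit i a)" for a
  have u: "fst (p c) \<in> sq 2" "madj (fst (p c)) \<in> sq 2" if "c < 2^n" for c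
    using unitary_matD[OF specD(1)[OF p[OF that]]] by auto
  have u1: "(\<Sum>z<2. cnj (u c z x) * u c z y) = (if x = y then 1 else 0)" if "c < 2^n" "x < 2" "y < 2" for c x y
  proof -
    have "(\<Sum>z<2. madj (fst (p c)) $$ (x,z) * fst (p c) $$ (z,y)) = 1\<^sub>m 2 $$ (x,y)"
      using mult_index[OF u(2,1)[OF that(1)] that(2,3)] unitary_matD(3)[OF specD(1)[OF p[OF that(1)]]] by simp
    moreover have "(\<Sum>z<2. madj (fst (p c)) $$ (x,z) * fst (p c) $$ (z,y)) = (\<Sum>z<2. cnj (u c z x) * u c z y)"
      using u[OF that(1)] that by (intro sum.cong) (auto simp: u_def)
    ultimately show ?thesis using that by simp
  qed
  have u2: "(\<Sum>z<2. u c x z * cnj (u c y z)) = (if x = y then 1 else 0)" if "c < 2^n" "x < 2" "y < 2" for c x y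
  proof -
    have "(\<Sum>z<2. fst (p c) $$ (x,z) * madj (fst (p c)) $$ (z,y)) = 1\<^sub>m 2 $$ (x,y)"
      using mult_index[OF u(1,2)[OF that(1)] that(2,3)] unitary_matD(4)[OF specD(1)[OF p[OF that(1)]]] by simp
    moreover have "(\<Sum>z<2. fst (p c) $$ (x,z) * madj (fst (p c)) $$ (z,y)) = (\<Sum>z<2. u c x z * cnj (u c y z))"
      using u[OF that(1)] that by (intro sum.cong) (auto simp: u_def)
    ultimately show ?thesis using that by simp
  qed
  have Tu: "A $$ (set_qbit i x c, set_qbit i y c) = (\<Sum>z<2. (u c x z * r c z) * cnj (u c y z))"
    if "c < 2^n" "x < 2" "y < 2" for c x y
  proof -
    note uu = u[OF that(1)]
    have "T c = (fst (p c) * rdiag 2 (r c)) * madj (fst (p c))" using specD(2)[OF p[OF that(1)]] by (simp add: r_def)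
    then have "T c $$ (x,y) = (\<Sum>z<2. (fst (p c) * rdiag 2 (r c)) $$ (x,z) * madj (fst (p c)) $$ (z,y))"
      using mult_index[OF sq_closed[OF uu(1) mat_diag_dim] uu(2) that(2,3)] by simp
    also have "\<dots> = (\<Sum>z<2. (u c x z * r c z) * cnj (u c y z))"
      using uu that by (intro sum.cong) (auto simp: mat_diag_mult_right[of _ 2 2] u_def)
    finally show ?thesis using that by (simp add: T_def)
  qed
  have s2: "(\<Sum>z<2. if x = z then g z else 0) = g x" "(\<Sum>z<2. g z * (if z = x then h z else 0)) = g x * h x"
    if "x < 2" for x :: nat and g h :: "nat \<Rightarrow> complex"
    using that by (auto simp: sum_lessThan_2 less_2_cases_iff)
  have "unitary_mat (2^n) (blk n i u)"
    unfolding unitary_mat_def madj_blk blk_mult[OF i] blk_one[of n i, symmetric]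
    by (intro conjI blk_carrier blk_cong[OF i] u1 u2) auto
  moreover have "A = blk n i u * rdiag (2^n) r' * madj (blk n i u)"
    unfolding r'_def blk_rdiag madj_blk blk_mult[OF i]
    by (subst blk_diag_eq[OF c bd], rule blk_cong[OF i]) (simp add: Tu s2)
  ultimately have s: "spec (2^n) A (blk n i u) r'" by (simp add: spec_def)
  have pos: "r' a > 0" if "a < 2^n" for a using spec_pd_pos[OF A s that] .
  have ent: "neg_entropy (2^n) A = (\<Sum>a<2^n. r' a * ln (r' a))" by (rule neg_entropy_spec[OF s pos])
  \<comment> \<open>Pairing an index with its flip brings both eigenvalues of a block into every
    summand.\<close>
  have fl: "(\<Sum>a<2^n. r' (flip i a) * ln (r' (flip i a))) = (\<Sum>a<2^n. r' a * ln (r' a))"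
    by (rule sum.reindex_bij_witness[of _ "flip i" "flip i"]) (use i in auto)
  have tt: "T c $$ (0,0) = A $$ (set_qbit i 0 c, set_qbit i 0 c)" "T c $$ (1,1) = A $$ (set_qbit i 1 c, set_qbit i 1 c)"
    "T c $$ (0,1) = A $$ (set_qbit i 0 c, set_qbit i 1 c)" for c by (auto simp: T_def)
  have pt: "r' a * ln (r' a) + r' (flip i a) * ln (r' (flip i a)) =
      pair_entropy (blk_sum i A (base i a)) (blk_disc i A (base i a))" if "a < 2^n" for a
  proof -
    have b: "base i a < 2^n" using that i by simp
    have "r' a * ln (r' a) + r' (flip i a) * ln (r' (flip i a)) =
       r (base i a) 0 * ln (r (base i a) 0) + r (base i a) 1 * ln (r (base i a) 1)"
      using qbit_cases[of i a] by (auto simp: r'_def flip_def)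
    then show ?thesis using spec_two(1)[OF p[OF b] Th[OF b]] unfolding r_def tt blk_sum_def blk_disc_def by simp
  qed
  have "2 * neg_entropy (2^n) A = (\<Sum>a<2^n. r' a * ln (r' a) + r' (flip i a) * ln (r' (flip i a)))"
    unfolding sum.distrib fl ent by simp
  also have "\<dots> = (\<Sum>a<2^n. pair_entropy (blk_sum i A (base i a)) (blk_disc i A (base i a)))"
    by (intro sum.cong refl pt) auto
  finally show "neg_entropy (2^n) A = (\<Sum>a<2^n. pair_entropy (blk_sum i A (base i a)) (blk_disc i A (base i a))) / 2" by simp
  assume c: "c < 2^n"
  have b: "base i c < 2^n" using c i by simp
  have "r (base i c) 0 > 0" "r (base i c) 1 > 0"
    using pos[of "set_qbit i 0 c"] pos[of "set_qbit i 1 c"] c i by (auto simp: r'_def)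
  then show "sqrt (blk_disc i A c) < blk_sum i A c"
    using spec_two(2)[OF p[OF b] Th[OF b]] unfolding r_def tt blk_sum_def blk_disc_def by simp
qed

text \<open>The three Pauli dephasings keep one component of the Bloch vector each, so that their
  discriminants add up to the original one.\<close>

lemma neg_entropy_pauli_sum:
  assumes A: "pd (2^n) A" and bd: "blk_diag n i A" and i: "i < n"
  shows "neg_entropy (2^n) (ptwirl n i True False 0 A) + neg_entropy (2^n) (ptwirl n i True True 0 A)
     + neg_entropy (2^n) (ptwirl n i False True 0 A) \<le> neg_entropy (2^n) A + 2 * neg_entropy (2^n) (replace_mixed n i A)"
proof -
  note c = pd_carrier[OF A]
  have Ah: "A $$ (b,a) = cnj (A $$ (a,b))" if "a < 2^n" "b < 2^n" for a b
    using that c arg_cong[OF psd_hermitian[OF pd_psd[OF A]], of "\<lambda>X. X $$ (b,a)"] by simp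
  have pdt: "pd (2^n) (ptwirl n i x z 0 B)" if "pd (2^n) B" for x z B
    by (rule pd_twirl[OF that sym_unitary_pauli[OF i]]) simp
  have full: "replace_mixed n i A = ptwirl n i True False 0 (ptwirl n i False True 0 A)"
    by (rule ptwirl_pair[symmetric, OF c i]) auto
  have bf: "base i (flip i a) = base i a" for a by (simp add: flip_def)
  have bt: "blk_diag n i (ptwirl n i x z 0 B)" if "B \<in> sq (2^n)" "blk_diag n i B" for x z B
    using that i bf unfolding blk_diag_def by (auto simp: ptwirl_index[of _ n])
  have f0: "flip i (set_qbit i 0 a) = set_qbit i (Suc 0) a" "flip i (set_qbit i (Suc 0) a) = set_qbit i 0 a" for a
    by (simp_all add: flip_def)
  let ?S = "\<lambda>A a. blk_sum i A (base i a)" and ?D = "\<lambda>A a. blk_disc i A (base i a)"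
  have tc: "ptwirl n i x z 0 A \<in> sq (2^n)" for x z using c by simp
  have lt: "set_qbit i 0 a < 2^n" "set_qbit i (Suc 0) a < 2^n" if "a < 2^n" for a using that i by auto
  define X where "X a = 4 * (Re (A $$ (set_qbit i 0 a, set_qbit i 1 a)))\<^sup>2" for a
  define Y where "Y a = 4 * (Im (A $$ (set_qbit i 0 a, set_qbit i 1 a)))\<^sup>2" for a
  define Z where "Z a = (Re (A $$ (set_qbit i 0 a, set_qbit i 0 a)) - Re (A $$ (set_qbit i 1 a, set_qbit i 1 a)))\<^sup>2" for a
  have D: "?D A a = X a + Y a + Z a" for a unfolding blk_disc_def X_def Y_def Z_def by (simp add: cmod_power2)
  have tr: "?S (ptwirl n i x z 0 A) a = ?S A a" if "a < 2^n" for x z a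
    using lt[OF that] i unfolding blk_sum_def by (cases x; simp add: ptwirl_index[OF c] f0 field_simps)
  have trf: "?S (replace_mixed n i A) a = ?S A a" if "a < 2^n" for a
    using lt[OF that] i unfolding blk_sum_def by (simp add: replace_mixed_index f0 field_simps)
  have DX: "?D (ptwirl n i True False 0 A) a = X a" if "a < 2^n" for a
    using lt[OF that] i Ah[OF lt[OF that]] unfolding blk_disc_def X_def
    by (simp add: ptwirl_index[OF c] f0 cmod_power2 field_simps)
  have DY: "?D (ptwirl n i True True 0 A) a = Y a" if "a < 2^n" for a
    using lt[OF that] i Ah[OF lt[OF that]] unfolding blk_disc_def Y_def
    by (simp add: ptwirl_index[OF c] f0 cmod_power2 field_simps)
  have DZ: "?D (ptwirl n i False True 0 A) a = Z a" if "a < 2^n" for a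
    using lt[OF that] i unfolding blk_disc_def Z_def
    by (simp add: ptwirl_index[OF c] f0 cmod_power2 field_simps)
  have DF: "?D (replace_mixed n i A) a = 0" if "a < 2^n" for a
    using lt[OF that] i unfolding blk_disc_def by (simp add: replace_mixed_index f0)
  have main: "pair_entropy (?S A a) (X a) + pair_entropy (?S A a) (Y a) + pair_entropy (?S A a) (Z a) \<le>
      pair_entropy (?S A a) (?D A a) + 2 * pair_entropy (?S A a) 0" if "a < 2^n" for a
  proof -
    have "sqrt (?D A a) < ?S A a" using that i by (intro neg_entropy_blk(2)[OF A bd i]) simp
    then show ?thesis unfolding D by (intro pair_entropy_add) (auto simp: X_def Y_def Z_def)
  qed
  have e1: "neg_entropy (2^n) (ptwirl n i True False 0 A) = (\<Sum>a<2^n. pair_entropy (?S A a) (X a)) / 2"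
    by (subst neg_entropy_blk(1)[OF pdt[OF A] bt[OF c bd] i]) (auto simp: tr DX intro!: sum.cong)
  have e2: "neg_entropy (2^n) (ptwirl n i True True 0 A) = (\<Sum>a<2^n. pair_entropy (?S A a) (Y a)) / 2"
    by (subst neg_entropy_blk(1)[OF pdt[OF A] bt[OF c bd] i]) (auto simp: tr DY intro!: sum.cong)
  have e3: "neg_entropy (2^n) (ptwirl n i False True 0 A) = (\<Sum>a<2^n. pair_entropy (?S A a) (Z a)) / 2"
    by (subst neg_entropy_blk(1)[OF pdt[OF A] bt[OF c bd] i]) (auto simp: tr DZ intro!: sum.cong)
  have e4: "neg_entropy (2^n) (replace_mixed n i A) = (\<Sum>a<2^n. pair_entropy (?S A a) 0) / 2"
  proof -
    have "pd (2^n) (replace_mixed n i A)" "blk_diag n i (replace_mixed n i A)"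
      unfolding full by (intro pdt A, intro bt tc c bd)
    from neg_entropy_blk(1)[OF this i] show ?thesis by (auto simp: trf DF intro!: sum.cong)
  qed
  have "(\<Sum>a<2^n. pair_entropy (?S A a) (X a) + pair_entropy (?S A a) (Y a) + pair_entropy (?S A a) (Z a)) \<le>
      (\<Sum>a<2^n. pair_entropy (?S A a) (?D A a) + 2 * pair_entropy (?S A a) 0)"
    by (intro sum_mono main) auto
  then show ?thesis unfolding e1 e2 e3 e4 neg_entropy_blk(1)[OF A bd i]
    by (simp add: sum.distrib flip: sum_distrib_left)
qed

section \<open>Averages over dephasing patterns\<close>

lemma replace_mixed_twirl:
  assumes "A \<in> sq (2^n)" "i < n"
  shows "replace_mixed n i A = ptwirl n i True False 0 (ptwirl n i False True 0 A)"
  by (rule ptwirl_pair[symmetric]) (use assms in auto)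

lemma pd_ptwirl: "pd (2^n) A \<Longrightarrow> i < n \<Longrightarrow> \<bar>l\<bar> \<le> 1 \<Longrightarrow> pd (2^n) (ptwirl n i x z l A)"
  by (rule pd_twirl) (auto intro: sym_unitary_pauli)

lemma pd_replace_mixed: "pd (2^n) A \<Longrightarrow> i < n \<Longrightarrow> pd (2^n) (replace_mixed n i A)"
  by (subst replace_mixed_twirl) (auto intro!: pd_ptwirl intro: pd_carrier)

lemma replace_mixed_ptwirl_commute:
  assumes "A \<in> sq (2^n)" "i < n" "j < n"
  shows "replace_mixed n i (ptwirl n j x z l A) = ptwirl n j x z l (replace_mixed n i A)"
proof -
  have t: "ptwirl n j x z l A \<in> sq (2^n)" "ptwirl n i False True 0 A \<in> sq (2^n)"
    using assms by auto
  show ?thesis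
    unfolding replace_mixed_twirl[OF assms(1,2)] replace_mixed_twirl[OF t(1) assms(2)]
      ptwirl_commute[OF assms(1) assms(2,3), of False True 0 x z l] ptwirl_commute[OF t(2) assms(2,3), of True False 0 x z l] ..
qed

text \<open>The expected negative entropy when every qubit below m is independently left alone, dephased
  along X, Y or Z, or depolarized completely; the weights come from expanding the product of three
  partial dephasings that each act completely with probability 1 - q.\<close>

fun pattern_ent :: "nat \<Rightarrow> real \<Rightarrow> nat \<Rightarrow> complex mat \<Rightarrow> real" where
  "pattern_ent n q 0 A = neg_entropy (2^n) A"
| "pattern_ent n q (Suc m) A = q^3 * pattern_ent n q m A
     + q\<^sup>2 * (1 - q) * (pattern_ent n q m (ptwirl n m True False 0 A) + pattern_ent n q m (ptwirl n m True True 0 A)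
         + pattern_ent n q m (ptwirl n m False True 0 A))
     + (1 - q)\<^sup>2 * (1 + 2 * q) * pattern_ent n q m (replace_mixed n m A)"

text \<open>The partial dephasing commutes with every pattern on the lower qubits, so the estimate
  for the entropy passes through the average. Complete dephasing does not raise the negative
  entropy, so the weight l^2 may be enlarged to q; thus one q serves qubits of different noise
  strength.\<close>

lemma pattern_ent_twirl:
  assumes "pd (2^n) A" "m \<le> i" "i < n" "0 \<le> q" "q \<le> 1" "\<bar>l\<bar> \<le> 1" "l\<^sup>2 \<le> q"
  shows "pattern_ent n q m (ptwirl n i x z l A) \<le> q * pattern_ent n q m A + (1 - q) * pattern_ent n q m (ptwirl n i x z 0 A)"
  using assms(1,2)
proof (induction m arbitrary: A)
  case 0
  let ?h = "neg_entropy (2^n) A" and ?k = "neg_entropy (2^n) (ptwirl n i x z 0 A)"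
  have "?k \<le> ?h" by (rule neg_entropy_twirl0_le[OF 0(1) sym_unitary_pauli[OF assms(3)]])
  then have "(q - l\<^sup>2) * ?k \<le> (q - l\<^sup>2) * ?h" using assms(7) by (intro mult_left_mono) auto
  then have "l\<^sup>2 * ?h + (1 - l\<^sup>2) * ?k \<le> q * ?h + (1 - q) * ?k" by (simp add: algebra_simps)
  then show ?case using neg_entropy_twirl_le[OF 0(1) sym_unitary_pauli[OF assms(3)] assms(6), of x z] by simp
next
  case (Suc m)
  note c = pd_carrier[OF Suc.prems(1)]
  have m: "m < n" "m \<le> i" using Suc.prems assms by auto
  have P: "pattern_ent n q m (ptwirl n m x' z' 0 (ptwirl n i x z l A)) \<le>
     q * pattern_ent n q m (ptwirl n m x' z' 0 A) + (1 - q) * pattern_ent n q m (ptwirl n m x' z' 0 (ptwirl n i x z 0 A))" for x' z'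
    using Suc.IH[OF pd_ptwirl[OF Suc.prems(1) m(1), of 0 x' z'] m(2)]
    by (simp add: ptwirl_commute[OF c m(1) assms(3)])
  have F: "pattern_ent n q m (replace_mixed n m (ptwirl n i x z l A)) \<le>
     q * pattern_ent n q m (replace_mixed n m A) + (1 - q) * pattern_ent n q m (replace_mixed n m (ptwirl n i x z 0 A))"
    using Suc.IH[OF pd_replace_mixed[OF Suc.prems(1) m(1)] m(2)]
    by (simp add: replace_mixed_ptwirl_commute[OF c m(1) assms(3)])
  have w: "0 \<le> q^3" "0 \<le> q\<^sup>2 * (1 - q)" "0 \<le> (1 - q)\<^sup>2 * (1 + 2 * q)" using assms by auto
  note I = mult_left_mono[OF Suc.IH[OF Suc.prems(1) m(2)] w(1)]
    mult_left_mono[OF P[of True False] w(2)] mult_left_mono[OF P[of True True] w(2)]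
    mult_left_mono[OF P[of False True] w(2)] mult_left_mono[OF F w(3)]
  show ?case unfolding pattern_ent.simps using add_mono[OF add_mono[OF add_mono[OF add_mono[OF I(1,2)] I(3)] I(4)] I(5)]
    by (simp add: algebra_simps)
qed

text \<open>\<open>pattern_ent_twirl\<close> for each of the three partial dephasings, multiplied
  out. All terms with at least two complete dephasings coincide, since two axes already depolarize
  and the third changes nothing; they collect into the last weight of
  \<open>pattern_ent\<close>.\<close>

lemma pattern_ent_depol:
  assumes A: "pd (2^n) A" and m: "m < n" and p: "0 \<le> p" "p \<le> 1" "1 - p \<le> q" "q \<le> 1"
  shows "pattern_ent n q m (depol_on n m p A) \<le> pattern_ent n q (Suc m) A" "pd (2^n) (depol_on n m p A)"
proof -
  define l where "l = sqrt (1 - p)"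
  have l: "l\<^sup>2 = 1 - p" "\<bar>l\<bar> \<le> 1" "l\<^sup>2 \<le> q" using p by (auto simp: l_def)
  have q: "0 \<le> q" using p by linarith
  note c = pd_carrier[OF A]
  let ?X = "\<lambda>l. ptwirl n m True False l" and ?Y = "\<lambda>l. ptwirl n m True True l" and ?Z = "\<lambda>l. ptwirl n m False True l"
  let ?F = "replace_mixed n m" and ?G = "pattern_ent n q m"
  have dep: "depol_on n m p A = ?Z l (?X l (?Y l A))" by (rule depol_on_twirl[OF c m]) (simp add: l)
  note pt = pd_ptwirl[OF _ m]
  show "pd (2^n) (depol_on n m p A)" unfolding dep by (intro pt A l)
  have step: "?G (ptwirl n m x z l B) \<le> q * ?G B + (1 - q) * ?G (ptwirl n m x z 0 B)" if "pd (2^n) B" for x z B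
    by (rule pattern_ent_twirl[OF that order_refl m q p(4) l(2,3)])
  have pl: "pd (2^n) (ptwirl n m x z l B)" "pd (2^n) (ptwirl n m x z 0 B)" if "pd (2^n) B" for x z B
    using pt[OF that] l by auto
  note com = ptwirl_commute[OF _ m m]
  have FF: "?Z 0 (?X 0 A) = ?F A" "?Y 0 (?X 0 A) = ?F A" "?Y 0 (?Z 0 A) = ?F A" "?Y 0 (?F A) = ?F A"
    "?X 0 (?Z 0 (?Y l A)) = ?Y l (?F A)"
  proof -
    show "?Z 0 (?X 0 A) = ?F A" "?Y 0 (?X 0 A) = ?F A" "?Y 0 (?Z 0 A) = ?F A"
      by (rule ptwirl_pair, use c m in auto)+
    then show "?Y 0 (?F A) = ?F A"
      using twirl_twirl[OF sym_unitary_pauli[OF m, of True True] twirl_carrier[OF pauli_carrier c, of m False True 0], of 0 0]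
      by simp
    show "?X 0 (?Z 0 (?Y l A)) = ?Y l (?F A)"
      unfolding replace_mixed_twirl[OF c m] using c by (simp add: com)
  qed
  have 1: "?G (?Y l A) \<le> q * ?G A + (1 - q) * ?G (?Y 0 A)" by (rule step[OF A])
  have 2: "?G (?X 0 (?Y l A)) \<le> q * ?G (?X 0 A) + (1 - q) * ?G (?F A)"
    using step[OF pl(2)[OF A], of True True True False] unfolding FF(2) com[OF c, of True False 0] .
  have 3: "?G (?Z 0 (?Y l A)) \<le> q * ?G (?Z 0 A) + (1 - q) * ?G (?F A)"
    using step[OF pl(2)[OF A], of True True False True] unfolding FF(3) com[OF c, of False True 0] .
  have 4: "?G (?Y l (?F A)) \<le> ?G (?F A)"
    using step[OF pd_replace_mixed[OF A m], of True True] unfolding FF(4) by (simp add: algebra_simps)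
  have 5: "?G (?X l (?Y l A)) \<le> q * ?G (?Y l A) + (1 - q) * ?G (?X 0 (?Y l A))" by (rule step[OF pl(1)[OF A]])
  have 6: "?G (?Z 0 (?X l (?Y l A))) \<le> q * ?G (?Z 0 (?Y l A)) + (1 - q) * ?G (?Y l (?F A))"
  proof -
    have "?Z 0 (?X l (?Y l A)) = ?X l (?Z 0 (?Y l A))" using c by (intro com) auto
    then show ?thesis using step[OF pl(2)[OF pl(1)[OF A]], of True False False True True True] unfolding FF(5) by simp
  qed
  have "?G (?Z l (?X l (?Y l A))) \<le> q * ?G (?X l (?Y l A)) + (1 - q) * ?G (?Z 0 (?X l (?Y l A)))"
    by (rule step) (intro pl A)
  also have "\<dots> \<le> q * (q * ?G (?Y l A) + (1 - q) * ?G (?X 0 (?Y l A))) + (1 - q) * (q * ?G (?Z 0 (?Y l A)) + (1 - q) * ?G (?Y l (?F A)))"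
    by (intro add_mono mult_left_mono 5 6) (use q p in auto)
  also have "\<dots> \<le> q * (q * (q * ?G A + (1 - q) * ?G (?Y 0 A)) + (1 - q) * (q * ?G (?X 0 A) + (1 - q) * ?G (?F A)))
      + (1 - q) * (q * (q * ?G (?Z 0 A) + (1 - q) * ?G (?F A)) + (1 - q) * ?G (?F A))"
    by (intro add_mono mult_left_mono 1 2 3 4) (use q p in auto)
  also have "\<dots> = pattern_ent n q (Suc m) A" by (simp add: power2_eq_square power3_eq_cube algebra_simps)
  finally show "pattern_ent n q m (depol_on n m p A) \<le> pattern_ent n q (Suc m) A" unfolding dep .
qed

lemma neg_entropy_noise_le:
  assumes "pd (2^n) A" "m \<le> n" "\<And>i. i < m \<Longrightarrow> 0 \<le> p i \<and> p i \<le> 1 \<and> 1 - p i \<le> q" "q \<le> 1"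
  shows "neg_entropy (2^n) (foldr (\<lambda>i t. depol_on n i (p i) t) [0..<m] A) \<le> pattern_ent n q m A"
    "pd (2^n) (foldr (\<lambda>i t. depol_on n i (p i) t) [0..<m] A)"
proof -
  have "neg_entropy (2^n) (foldr (\<lambda>i t. depol_on n i (p i) t) [0..<m] A) \<le> pattern_ent n q m A \<and>
    pd (2^n) (foldr (\<lambda>i t. depol_on n i (p i) t) [0..<m] A)"
    using assms(1-3)
  proof (induction m arbitrary: A)
    case (Suc m)
    have m: "m < n" "m \<le> n" and p: "0 \<le> p m" "p m \<le> 1" "1 - p m \<le> q" using Suc.prems by auto
    note d = pattern_ent_depol[OF Suc.prems(1) m(1) p assms(4)]
    \<comment> \<open>\<open>foldr\<close> applies the channel of the last qubit first, in line with
      the recursion of \<open>pattern_ent\<close> from the top.\<close>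
    have "neg_entropy (2^n) (foldr (\<lambda>i t. depol_on n i (p i) t) [0..<m] (depol_on n m (p m) A)) \<le> pattern_ent n q m (depol_on n m (p m) A) \<and>
      pd (2^n) (foldr (\<lambda>i t. depol_on n i (p i) t) [0..<m] (depol_on n m (p m) A))"
      using Suc.IH[OF d(2) m(2)] Suc.prems(3) by simp
    then show ?case using d(1) by simp
  qed simp
  then show "neg_entropy (2^n) (foldr (\<lambda>i t. depol_on n i (p i) t) [0..<m] A) \<le> pattern_ent n q m A"
    "pd (2^n) (foldr (\<lambda>i t. depol_on n i (p i) t) [0..<m] A)" by auto
qed

text \<open>Submodularity read as diminishing returns: the drop caused by a dephasing on j can only
  shrink after one on i.\<close>

lemma neg_entropy_ptwirl_diff:
  assumes "pd (2^n) A" "i < n" "j < n"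
  shows "neg_entropy (2^n) (ptwirl n i x z 0 A) - neg_entropy (2^n) (ptwirl n j x' z' 0 (ptwirl n i x z 0 A))
    \<le> neg_entropy (2^n) A - neg_entropy (2^n) (ptwirl n j x' z' 0 A)"
  using neg_entropy_submodular[OF assms(1) sym_unitary_pauli[OF assms(3)] sym_unitary_pauli[OF assms(2)]
      conj_commute_pauli[OF assms(3,2)], of x' z' x z] by simp

text \<open>A complete depolarization is two dephasings, so diminishing returns are applied
  twice.\<close>

lemma neg_entropy_mixed_diff:
  assumes "pd (2^n) A" "i < n" "j < n"
  shows "neg_entropy (2^n) (replace_mixed n i A) - neg_entropy (2^n) (ptwirl n j x' z' 0 (replace_mixed n i A))
    \<le> neg_entropy (2^n) A - neg_entropy (2^n) (ptwirl n j x' z' 0 A)"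
  unfolding replace_mixed_twirl[OF pd_carrier[OF assms(1)] assms(2)]
  using neg_entropy_ptwirl_diff[OF pd_ptwirl[OF assms(1,2), of 0 False True] assms(2,3), of True False x' z']
    neg_entropy_ptwirl_diff[OF assms, of False True x' z'] by simp

text \<open>Diminishing returns for every single pattern, averaged with weights that sum to 1. This
  controls the average at a state that has not yet been dephased on qubit i.\<close>

lemma pattern_ent_sub:
  assumes "pd (2^n) A" "m \<le> i" "i < n" "0 \<le> q" "q \<le> 1"
  shows "pattern_ent n q m A \<le> neg_entropy (2^n) A - neg_entropy (2^n) (ptwirl n i x z 0 A) + pattern_ent n q m (ptwirl n i x z 0 A)"
  using assms(1,2)
proof (induction m arbitrary: A)
  case (Suc m)
  note c = pd_carrier[OF Suc.prems(1)]
  have m: "m < n" "m \<le> i" using Suc.prems assms by auto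
  define D where "D = neg_entropy (2^n) A - neg_entropy (2^n) (ptwirl n i x z 0 A)"
  have P: "pattern_ent n q m (ptwirl n m x' z' 0 A) \<le> D + pattern_ent n q m (ptwirl n m x' z' 0 (ptwirl n i x z 0 A))" for x' z'
    using Suc.IH[OF pd_ptwirl[OF Suc.prems(1) m(1), of 0 x' z'] m(2)]
      neg_entropy_ptwirl_diff[OF Suc.prems(1) m(1) assms(3), of x' z' x z]
    by (simp add: ptwirl_commute[OF c assms(3) m(1)] D_def)
  have F: "pattern_ent n q m (replace_mixed n m A) \<le> D + pattern_ent n q m (replace_mixed n m (ptwirl n i x z 0 A))"
    using Suc.IH[OF pd_replace_mixed[OF Suc.prems(1) m(1)] m(2)]
      neg_entropy_mixed_diff[OF Suc.prems(1) m(1) assms(3), of x z]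
    by (simp add: replace_mixed_ptwirl_commute[OF c m(1) assms(3)] D_def)
  have I0: "pattern_ent n q m A \<le> D + pattern_ent n q m (ptwirl n i x z 0 A)"
    using Suc.IH[OF Suc.prems(1) m(2)] by (simp add: D_def)
  have w: "0 \<le> q^3" "0 \<le> q\<^sup>2 * (1 - q)" "0 \<le> (1 - q)\<^sup>2 * (1 + 2 * q)" using assms by auto
  note I = mult_left_mono[OF I0 w(1)]
    mult_left_mono[OF P[of True False] w(2)] mult_left_mono[OF P[of True True] w(2)]
    mult_left_mono[OF P[of False True] w(2)] mult_left_mono[OF F w(3)]
  have s: "q^3 * D + q\<^sup>2 * (1 - q) * D + q\<^sup>2 * (1 - q) * D + q\<^sup>2 * (1 - q) * D + (1 - q)\<^sup>2 * (1 + 2 * q) * D = D"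
    by (simp add: power2_eq_square power3_eq_cube algebra_simps)
  show ?case unfolding pattern_ent.simps D_def[symmetric]
    using add_mono[OF add_mono[OF add_mono[OF add_mono[OF I(1,2)] I(3)] I(4)] I(5)] s
    by (simp add: distrib_left)
qed simp

text \<open>The end point of depolarizing the qubits below m; its entropy is the zero level in the
  induction.\<close>

fun mix_below :: "nat \<Rightarrow> nat \<Rightarrow> complex mat \<Rightarrow> complex mat" where
  "mix_below n 0 A = A"
| "mix_below n (Suc m) A = mix_below n m (replace_mixed n m A)"

lemma pd_mix_below: "pd (2^n) A \<Longrightarrow> m \<le> n \<Longrightarrow> pd (2^n) (mix_below n m A)"
  by (induction m arbitrary: A) (auto intro!: pd_replace_mixed simp: Suc_le_eq)

lemma mix_below_ptwirl:
  "A \<in> sq (2^n) \<Longrightarrow> m \<le> n \<Longrightarrow> j < n \<Longrightarrow> mix_below n m (ptwirl n j x z l A) = ptwirl n j x z l (mix_below n m A)"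
  by (induction m arbitrary: A) (auto simp: replace_mixed_ptwirl_commute)

lemma mix_below_carrier: "A \<in> sq (2^n) \<Longrightarrow> mix_below n m A \<in> sq (2^n)"
  by (induction m arbitrary: A) auto

lemma mix_below_replace_mixed:
  assumes "A \<in> sq (2^n)" "m \<le> n" "j < n"
  shows "mix_below n m (replace_mixed n j A) = replace_mixed n j (mix_below n m A)"
  using assms by (simp add: replace_mixed_twirl mix_below_ptwirl mix_below_carrier)

text \<open>Diminishing returns once more, for the drop caused by depolarizing all qubits below m,
  accumulated qubit by qubit.\<close>

lemma neg_entropy_mix_below_diff:
  assumes "pd (2^n) A" "m \<le> n" "j < n"
  shows "neg_entropy (2^n) (ptwirl n j x z 0 A) - neg_entropy (2^n) (mix_below n m (ptwirl n j x z 0 A))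
    \<le> neg_entropy (2^n) A - neg_entropy (2^n) (mix_below n m A)"
  using assms(1,2)
proof (induction m arbitrary: A)
  case (Suc m)
  have m: "m < n" "m \<le> n" using Suc.prems by auto
  show ?case using Suc.IH[OF pd_replace_mixed[OF Suc.prems(1) m(1)] m(2)]
      neg_entropy_mixed_diff[OF Suc.prems(1) m(1) assms(3), of x z]
    by (simp add: replace_mixed_ptwirl_commute[OF pd_carrier[OF Suc.prems(1)] m(1) assms(3)])
qed simp

section \<open>Reflections exchanging two Pauli axes\<close>

lemma pauli_commute_off:
  assumes "i < n" "j < n" "i \<noteq> j"
  shows "pauli n i x z * pauli n j x' z' = pauli n j x' z' * pauli n i x z"
proof (rule sq_eqI[of _ "2^n"])
  fix a b :: nat assume ab: "a < 2^n" "b < 2^n"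
  show "(pauli n i x z * pauli n j x' z') $$ (a,b) = (pauli n j x' z' * pauli n i x z) $$ (a,b)"
    unfolding pauli_mult_left[OF pauli_carrier ab assms(1)] pauli_mult_left[OF pauli_carrier ab assms(2)]
    using ab assms by (auto simp: pauli_def flip_commute[of i j])
qed auto

lemma pauli_anticommute:
  assumes "i < n"
  shows "pauli n i False True * pauli n i True z = (-1) \<cdot>\<^sub>m (pauli n i True z * pauli n i False True)"
proof (rule sq_eqI[of _ "2^n"])
  fix a b :: nat assume ab: "a < 2^n" "b < 2^n"
  have 1: "((-1) \<cdot>\<^sub>m (pauli n i True z * pauli n i False True)) $$ (a,b) = - (pauli n i True z * pauli n i False True) $$ (a,b)"
    using ab by (simp add: sq_index(1)[of _ "2^n" "1\<^sub>m (2^n)"])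
  show "(pauli n i False True * pauli n i True z) $$ (a,b) = ((-1) \<cdot>\<^sub>m (pauli n i True z * pauli n i False True)) $$ (a,b)"
    unfolding 1 pauli_mult_left[OF pauli_carrier ab assms]
    using ab assms qbit_cases[of i a] by (auto simp: pauli_def)
qed auto

text \<open>The Hadamard-type reflection (P + Z) / sqrt 2 exchanges Z with P = X or P = Y.\<close>

definition axis_swap :: "nat \<Rightarrow> nat \<Rightarrow> bool \<Rightarrow> complex mat" where
  "axis_swap n i z = complex_of_real (1 / sqrt 2) \<cdot>\<^sub>m (pauli n i True z + pauli n i False True)"

lemma axis_swap_carrier [simp]: "axis_swap n i z \<in> sq (2^n)"
  by (simp add: axis_swap_def)

lemma half_sqrt: "complex_of_real (1 / sqrt 2) * complex_of_real (1 / sqrt 2) = 1/2"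
  by (simp flip: of_real_mult)

text \<open>The anticommuting cross terms cancel in (P + Z)^2 = 2, which the factor 1 / sqrt 2
  normalizes; since P and Z square to 1, also Z (P + Z) = (P + Z) P.\<close>

lemma axis_swap_sym:
  assumes "i < n"
  shows "sym_unitary (2^n) (axis_swap n i z)" "pauli n i False True * axis_swap n i z = axis_swap n i z * pauli n i True z"
proof -
  let ?P = "pauli n i True z" and ?Z = "pauli n i False True" and ?N = "2^n :: nat" and ?c = "complex_of_real (1 / sqrt 2)"
  note p = sym_unitaryD[OF sym_unitary_pauli[OF assms]]
  have c: "?P \<in> sq ?N" "?Z \<in> sq ?N" "?P + ?Z \<in> sq ?N" by auto
  have e: "(?P + ?Z) * ?P = 1\<^sub>m ?N + ?Z * ?P" "(?P + ?Z) * ?Z = ?P * ?Z + 1\<^sub>m ?N"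
    unfolding add_mult_distrib_mat[OF c(1,2,1)] add_mult_distrib_mat[OF c(1,2,2)] p(3) by simp_all
  have "(?P + ?Z) * (?P + ?Z) = (1\<^sub>m ?N + ?Z * ?P) + (?P * ?Z + 1\<^sub>m ?N)"
    unfolding mult_add_distrib_mat[OF c(3,1,2)] e ..
  also have "\<dots> = 2 \<cdot>\<^sub>m 1\<^sub>m ?N"
  proof -
    have "(1\<^sub>m N + (-1) \<cdot>\<^sub>m X) + (X + 1\<^sub>m N) = 2 \<cdot>\<^sub>m 1\<^sub>m N" if "X \<in> sq N" for X :: "complex mat" and N
      using that by (intro sq_eqI[of _ N]) auto
    then show ?thesis unfolding pauli_anticommute[OF assms] using sq_closed[OF c(1,2)] by blast
  qed
  finally have sq: "(?P + ?Z) * (?P + ?Z) = 2 \<cdot>\<^sub>m 1\<^sub>m ?N" .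
  have "axis_swap n i z * axis_swap n i z = ?c \<cdot>\<^sub>m ((?P + ?Z) * (?c \<cdot>\<^sub>m (?P + ?Z)))"
    unfolding axis_swap_def by (rule mult_smult_assoc_mat[OF c(3) smult_carrier_mat[OF c(3)]])
  also have "(?P + ?Z) * (?c \<cdot>\<^sub>m (?P + ?Z)) = ?c \<cdot>\<^sub>m (2 \<cdot>\<^sub>m 1\<^sub>m ?N)"
    unfolding mult_smult_distrib[OF c(3,3)] sq ..
  also have "?c \<cdot>\<^sub>m (?c \<cdot>\<^sub>m (2 \<cdot>\<^sub>m 1\<^sub>m ?N)) = 1\<^sub>m ?N"
    by (rule sq_eqI[of _ ?N]) (use half_sqrt in \<open>auto simp: algebra_simps\<close>)
  finally have "axis_swap n i z * axis_swap n i z = 1\<^sub>m ?N" .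
  moreover have "madj (axis_swap n i z) = axis_swap n i z"
    unfolding axis_swap_def madj_smult madj_add[OF c(1,2)] p(2) by simp
  ultimately show "sym_unitary (2^n) (axis_swap n i z)" by (simp add: sym_unitary_def)
  have "?Z * axis_swap n i z = ?c \<cdot>\<^sub>m (?Z * (?P + ?Z))"
    unfolding axis_swap_def by (rule mult_smult_distrib[OF c(2,3)])
  also have "?Z * (?P + ?Z) = ?Z * ?P + 1\<^sub>m ?N"
    unfolding mult_add_distrib_mat[OF c(2,1,2)] p(3) ..
  also have "\<dots> = (?P + ?Z) * ?P" unfolding e by (rule comm_add_mat[of _ ?N ?N]) auto
  also have "?c \<cdot>\<^sub>m ((?P + ?Z) * ?P) = axis_swap n i z * ?P"
    unfolding axis_swap_def by (rule mult_smult_assoc_mat[OF c(3,1), symmetric])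
  finally show "?Z * axis_swap n i z = axis_swap n i z * ?P" .
qed

lemma axis_swap_conj:
  assumes "i < n" "A \<in> sq (2^n)"
  shows "pauli n i False True * (axis_swap n i z * A * axis_swap n i z) * pauli n i False True =
    axis_swap n i z * (pauli n i True z * A * pauli n i True z) * axis_swap n i z"
proof -
  let ?W = "axis_swap n i z" and ?P = "pauli n i True z" and ?Z = "pauli n i False True"
  note p = sym_unitaryD[OF sym_unitary_pauli[OF assms(1)]] and w = sym_unitaryD[OF axis_swap_sym(1)[OF assms(1)]]
  have 1: "?Z * ?W = ?W * ?P" by (rule axis_swap_sym(2)[OF assms(1)])
  have 2: "?W * ?Z = ?P * ?W"
    using arg_cong[OF 1, of madj] unfolding madj_mult[OF p(1) w(1)] madj_mult[OF w(1) p(1)] p(2) w(2) .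
  have "?Z * (?W * A * ?W) * ?Z = (?Z * ?W) * (A * (?W * ?Z))"
    using assms(2) p(1) w(1) by (simp add: sq_assoc[of _ "2^n"])
  also have "\<dots> = ?W * (?P * A * ?P) * ?W" unfolding 1 2
    using assms(2) p(1) w(1) by (simp add: sq_assoc[of _ "2^n"])
  finally show ?thesis .
qed

lemma axis_swap_commute:
  assumes "i < n" "j < n" "i \<noteq> j"
  shows "conj_commute (2^n) (pauli n j x' z') (axis_swap n i z)"
  unfolding conj_commute_def
proof
  fix A :: "complex mat" assume A: "A \<in> sq (2^n)"
  let ?W = "axis_swap n i z" and ?Q = "pauli n j x' z'"
  have c: "pauli n i True z \<in> sq (2^n)" "pauli n i False True \<in> sq (2^n)"
    "pauli n i True z + pauli n i False True \<in> sq (2^n)" "?Q \<in> sq (2^n)" by auto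
  have WQ: "?W * ?Q = ?Q * ?W"
    unfolding axis_swap_def mult_smult_assoc_mat[OF c(3,4)] mult_smult_distrib[OF c(4,3)]
      add_mult_distrib_mat[OF c(1,2,4)] mult_add_distrib_mat[OF c(4,1,2)] pauli_commute_off[OF assms] ..
  have "?Q * (?W * A * ?W) * ?Q = (?Q * ?W) * (A * (?W * ?Q))" using A by (simp add: sq_assoc[of _ "2^n"])
  also have "\<dots> = (?W * ?Q) * (A * (?Q * ?W))" by (simp only: WQ)
  also have "\<dots> = ?W * (?Q * A * ?Q) * ?W" using A by (simp add: sq_assoc[of _ "2^n"])
  finally show "?Q * (?W * A * ?W) * ?Q = ?W * (?Q * A * ?Q) * ?W" .
qed

text \<open>Whatever intertwines two conjugations intertwines the twirls; P' differs from P when W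
  turns one axis into another.\<close>

lemma twirl_sym_conj:
  assumes "W \<in> sq N" "P \<in> sq N" "A \<in> sq N"
    "P * (W * A * W) * P = W * (P' * A * P') * W" "P' \<in> sq N"
  shows "twirl P l (W * A * W) = W * twirl P' l A * W"
proof -
  have c: "P' * A * P' \<in> sq N" by (intro sq_closed assms)
  show ?thesis unfolding twirl_def assms(4) using assms c
    by (simp add: sym_conj_linear[of _ N])
qed

lemma ptwirl_sym_conj:
  assumes "W \<in> sq (2^n)" "A \<in> sq (2^n)" "conj_commute (2^n) (pauli n j x z) W"
  shows "ptwirl n j x z l (W * A * W) = W * ptwirl n j x z l A * W"
  using assms by (intro twirl_sym_conj[of _ "2^n"]) (auto simp: conj_commute_def)

lemma replace_mixed_sym_conj:
  assumes "W \<in> sq (2^n)" "A \<in> sq (2^n)" "j < n"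
    "\<And>x z. conj_commute (2^n) (pauli n j x z) W"
  shows "replace_mixed n j (W * A * W) = W * replace_mixed n j A * W"
proof -
  have c: "W * A * W \<in> sq (2^n)" by (intro sq_closed assms)
  have t: "ptwirl n j False True 0 A \<in> sq (2^n)" using assms(2) by simp
  show ?thesis unfolding replace_mixed_twirl[OF c assms(3)] replace_mixed_twirl[OF assms(2,3)]
      ptwirl_sym_conj[OF assms(1,2,4)] ptwirl_sym_conj[OF assms(1) t assms(4)] ..
qed

text \<open>W passes through all dephasings of the averaged qubits and then disappears by unitary
  invariance of the entropy.\<close>

lemma pattern_ent_sym_conj:
  assumes "pd (2^n) A" "sym_unitary (2^n) W" "m \<le> n" "\<And>j x z. j < m \<Longrightarrow> conj_commute (2^n) (pauli n j x z) W"
  shows "pattern_ent n q m (W * A * W) = pattern_ent n q m A"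
  using assms(1,3,4)
proof (induction m arbitrary: A)
  case 0
  then show ?case using neg_entropy_unitary[OF 0(1), of W] sym_unitaryD[OF assms(2)] by simp
next
  case (Suc m)
  have m: "m < n" "m \<le> n" using Suc.prems by auto
  note w = sym_unitaryD[OF assms(2)]
  have IH: "pattern_ent n q m (W * B * W) = pattern_ent n q m B" if "pd (2^n) B" for B
    by (rule Suc.IH[OF that m(2)]) (use Suc.prems(3) in auto)
  have cm: "conj_commute (2^n) (pauli n m x z) W" for x z using Suc.prems(3) by simp
  show ?case unfolding pattern_ent.simps ptwirl_sym_conj[OF w(1) pd_carrier[OF Suc.prems(1)] cm]
      replace_mixed_sym_conj[OF w(1) pd_carrier[OF Suc.prems(1)] m(1) cm]
    using IH[OF Suc.prems(1)] IH[OF pd_ptwirl[OF Suc.prems(1) m(1)]] IH[OF pd_replace_mixed[OF Suc.prems(1) m(1)]]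
    by simp
qed

lemma mix_below_sym_conj:
  assumes "A \<in> sq (2^n)" "W \<in> sq (2^n)" "m \<le> n"
    "\<And>j x z. j < m \<Longrightarrow> conj_commute (2^n) (pauli n j x z) W"
  shows "mix_below n m (W * A * W) = W * mix_below n m A * W"
  using assms(1,3,4)
proof (induction m arbitrary: A)
  case (Suc m)
  have m: "m < n" "m \<le> n" using Suc.prems by auto
  have cm: "conj_commute (2^n) (pauli n m x z) W" for x z using Suc.prems(3) by simp
  show ?case unfolding mix_below.simps replace_mixed_sym_conj[OF assms(2) Suc.prems(1) m(1) cm]
    by (rule Suc.IH[OF replace_mixed_carrier m(2)]) (use Suc.prems(3) in auto)
qed simp

section \<open>States fixed by dephasings\<close>

lemma replace_mixed_fixed:
  assumes "A \<in> sq (2^n)" "i < n"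
  shows "ptwirl n i False True 0 (replace_mixed n i A) = replace_mixed n i A"
    "ptwirl n i True False 0 (replace_mixed n i A) = replace_mixed n i A"
proof -
  have F: "replace_mixed n i A = ptwirl n i False True 0 (ptwirl n i True False 0 A)"
    "replace_mixed n i A = ptwirl n i True False 0 (ptwirl n i False True 0 A)"
    by (rule ptwirl_pair[symmetric], use assms in auto)+
  show "ptwirl n i False True 0 (replace_mixed n i A) = replace_mixed n i A" unfolding F(1)
    by (subst twirl_twirl[OF sym_unitary_pauli[OF assms(2)]]) (use assms in auto)
  show "ptwirl n i True False 0 (replace_mixed n i A) = replace_mixed n i A" unfolding F(2)
    by (subst twirl_twirl[OF sym_unitary_pauli[OF assms(2)]]) (use assms in auto)
qed

lemma mix_below_fixed:
  assumes "A \<in> sq (2^n)" "m \<le> n" "j < m"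
  shows "ptwirl n j False True 0 (mix_below n m A) = mix_below n m A"
    "ptwirl n j True False 0 (mix_below n m A) = mix_below n m A"
proof -
  have "ptwirl n j False True 0 (mix_below n m A) = mix_below n m A \<and>
    ptwirl n j True False 0 (mix_below n m A) = mix_below n m A"
    using assms
  proof (induction m arbitrary: A)
    case (Suc m)
    have m: "m < n" "m \<le> n" using Suc.prems by auto
    show ?case
    proof (cases "j = m")
      case True
      have "ptwirl n m x z 0 (mix_below n m (replace_mixed n m A)) = mix_below n m (ptwirl n m x z 0 (replace_mixed n m A))" for x z
        by (rule mix_below_ptwirl[symmetric, OF replace_mixed_carrier m(2,1)])
      then show ?thesis using True replace_mixed_fixed[OF Suc.prems(1) m(1)] by simp
    next
      case False
      then show ?thesis using Suc.IH[OF replace_mixed_carrier m(2)] Suc.prems(3) False by simp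
    qed
  qed simp
  then show "ptwirl n j False True 0 (mix_below n m A) = mix_below n m A"
    "ptwirl n j True False 0 (mix_below n m A) = mix_below n m A" by auto
qed

lemma ptwirl_fixed_offdiag:
  assumes "A \<in> sq (2^n)" "ptwirl n j False True 0 A = A" "j < n" "a < 2^n" "b < 2^n" "qbit j a \<noteq> qbit j b"
  shows "A $$ (a,b) = 0"
  using ptwirl_index[OF assms(1,4,5,3), of False True 0] assms(2,6) by simp

text \<open>Z-dephasing of a qubit kills the entries between states that differ in its bit, so only
  pairs that agree away from i remain.\<close>

lemma blk_diagI:
  assumes "A \<in> sq (2^n)" "i < n" "\<And>j. j < n \<Longrightarrow> j \<noteq> i \<Longrightarrow> ptwirl n j False True 0 A = A"
  shows "blk_diag n i A"
  unfolding blk_diag_def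
proof (intro allI impI)
  fix a b :: nat assume ab: "a < 2^n" "b < 2^n" "base i a \<noteq> base i b"
  have "\<exists>j<n. qbit j (base i a) \<noteq> qbit j (base i b)"
    using qbit_eqI[of "base i a" n "base i b"] ab assms(2) by (meson pos2 set_qbit_lt)
  then obtain j where "j < n" "qbit j (base i a) \<noteq> qbit j (base i b)" by blast
  then have "j \<noteq> i" "qbit j a \<noteq> qbit j b" by (auto split: if_splits)
  then show "A $$ (a,b) = 0" using ptwirl_fixed_offdiag[OF assms(1) assms(3) _ ab(1,2)] \<open>j < n\<close> by blast
qed

text \<open>The arithmetic of the inductive step. Let F and R depolarize the current qubit and the
  lower ones, and let T1, T2, T3 be the dephasings of the current qubit. The negative entropies are
  h of A, c of R A, a_i of T_i A, b_i of R T_i A, f of F A and e of R F A; g, g1, g2, g3, gf are the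
  pattern averages of A, T_i A and F A. \<open>S1\<close> and \<open>S2\<close> are diminishing
  returns, \<open>C\<close> is the Bloch inequality, and \<open>G\<close> bounds the average at the
  undephased A.\<close>

lemma pattern_ent_bound_arith:
  fixes q h e f c a1 a2 a3 b1 b2 b3 :: real
  assumes q: "0 \<le> q" "q \<le> 1"
    and S1: "a1 - b1 \<le> h - c" "a2 - b2 \<le> h - c" "a3 - b3 \<le> h - c"
    and S2: "f - e \<le> a1 - b1" "f - e \<le> a2 - b2" "f - e \<le> a3 - b3"
    and C: "b1 + b2 + b3 \<le> c + 2 * e"
    and G: "g \<le> h - (1 - q\<^sup>2) * (a1 - b1)" "g \<le> h - (1 - q\<^sup>2) * (a2 - b2)" "g \<le> h - (1 - q\<^sup>2) * (a3 - b3)"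
    and g: "g1 \<le> q\<^sup>2 * a1 + (1 - q\<^sup>2) * b1" "g2 \<le> q\<^sup>2 * a2 + (1 - q\<^sup>2) * b2" "g3 \<le> q\<^sup>2 * a3 + (1 - q\<^sup>2) * b3"
      "gf \<le> q\<^sup>2 * f + (1 - q\<^sup>2) * e"
  shows "q^3 * g + q\<^sup>2 * (1 - q) * (g1 + g2 + g3) + (1 - q)\<^sup>2 * (1 + 2 * q) * gf \<le> q\<^sup>2 * h + (1 - q\<^sup>2) * e"
proof -
  \<comment> \<open>Averages over the three axes, measured from the fully mixed value e; the final
    estimate treats the axes alike.\<close>
  define a where "a = (a1 + a2 + a3) / 3 - e"
  define b where "b = (b1 + b2 + b3) / 3 - e"
  have G': "g \<le> h - (1 - q\<^sup>2) * (a - b)"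
  proof -
    have "3 * ((1 - q\<^sup>2) * (a - b)) = (1 - q\<^sup>2) * (a1 - b1) + (1 - q\<^sup>2) * (a2 - b2) + (1 - q\<^sup>2) * (a3 - b3)"
      unfolding a_def b_def by (simp add: field_simps)
    then show ?thesis using G by linarith
  qed
  have g': "g1 + g2 + g3 \<le> 3 * (q\<^sup>2 * (a + e) + (1 - q\<^sup>2) * (b + e))"
  proof -
    have "3 * (q\<^sup>2 * (a + e) + (1 - q\<^sup>2) * (b + e)) = (q\<^sup>2 * a1 + (1 - q\<^sup>2) * b1) + (q\<^sup>2 * a2 + (1 - q\<^sup>2) * b2)
        + (q\<^sup>2 * a3 + (1 - q\<^sup>2) * b3)"
      unfolding a_def b_def by (simp add: field_simps)
    then show ?thesis using g(1-3) by linarith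
  qed
  have F: "f - e \<le> a - b" and H: "a + 2 * b \<le> h - e"
    using S1 S2 C unfolding a_def b_def by (simp_all add: field_simps)
  have gf: "gf \<le> q\<^sup>2 * (a - b) + e"
  proof -
    have "q\<^sup>2 * f \<le> q\<^sup>2 * (a - b + e)" using F by (intro mult_left_mono) auto
    then show ?thesis using g(4) by (simp add: algebra_simps)
  qed
  have w: "0 \<le> q^3" "0 \<le> q\<^sup>2 * (1 - q)" "0 \<le> (1 - q)\<^sup>2 * (1 + 2 * q)" using q by auto
  have "q^3 * g + q\<^sup>2 * (1 - q) * (g1 + g2 + g3) + (1 - q)\<^sup>2 * (1 + 2 * q) * gf \<le>
    q^3 * (h - (1 - q\<^sup>2) * (a - b)) + q\<^sup>2 * (1 - q) * (3 * (q\<^sup>2 * (a + e) + (1 - q\<^sup>2) * (b + e)))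
      + (1 - q)\<^sup>2 * (1 + 2 * q) * (q\<^sup>2 * (a - b) + e)"
    by (intro add_mono mult_left_mono G' g' gf w)
  \<comment> \<open>Everything else cancels; what remains is a nonpositive multiple of the gap in
    \<open>H\<close>, which combines \<open>S1\<close> with \<open>C\<close>.\<close>
  also have "\<dots> = q\<^sup>2 * h + (1 - q\<^sup>2) * e - q\<^sup>2 * (1 - q) * ((h - e) - (a + 2 * b))"
    by (simp add: power2_eq_square power3_eq_cube algebra_simps)
  also have "\<dots> \<le> q\<^sup>2 * h + (1 - q\<^sup>2) * e" using w(2) H by simp
  finally show ?thesis .
qed

text \<open>Z-dephased upper qubits, together with the mixing of the lower ones, give the
  block-diagonal form that \<open>neg_entropy_pauli_sum\<close> asks for; for m = n the condition is
  vacuous. In the induction step A itself need not be dephased on qubit m, so the induction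
  hypothesis is used on its three dephasings and on its depolarization, and the average at A is
  reached through \<open>pattern_ent_sub\<close>.\<close>

lemma pattern_ent_le:
  assumes "pd (2^n) A" "m \<le> n" "0 \<le> q" "q \<le> 1"
    "\<And>j. m \<le> j \<Longrightarrow> j < n \<Longrightarrow> ptwirl n j False True 0 A = A"
  shows "pattern_ent n q m A \<le> q\<^sup>2 * neg_entropy (2^n) A + (1 - q\<^sup>2) * neg_entropy (2^n) (mix_below n m A)"
  using assms(1,2,5)
proof (induction m arbitrary: A)
  case 0
  then show ?case by (simp add: algebra_simps)
next
  case (Suc m)
  note A = Suc.prems(1) and fix_above = Suc.prems(3)
  have m: "m < n" "m \<le> n" using Suc.prems by auto
  note c = pd_carrier[OF A]
  let ?h = "neg_entropy (2^n)" and ?T = "\<lambda>x z. ptwirl n m x z 0 A" and ?R = "mix_below n m" and ?F = "replace_mixed n m A"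
  have pT: "pd (2^n) (?T x z)" for x z using pd_ptwirl[OF A m(1)] by simp
  note cT = pd_carrier[OF pT]
  have fT: "ptwirl n j False True 0 (?T x z) = ?T x z" if "Suc m \<le> j" "j < n" for j x z
    using ptwirl_commute[OF c that(2) m(1), of False True 0 x z 0] fix_above[OF that] by simp
  have IHZ: "pattern_ent n q m (?T False True) \<le> q\<^sup>2 * ?h (?T False True) + (1 - q\<^sup>2) * ?h (?R (?T False True))"
  proof (rule Suc.IH[OF pT m(2)])
    fix j assume j: "m \<le> j" "j < n"
    show "ptwirl n j False True 0 (?T False True) = ?T False True"
      using fT[of j] j twirl_twirl[OF sym_unitary_pauli[OF m(1)] c, of False True 0 0] by (cases "j = m") auto
  qed
  \<comment> \<open>An X- or Y-dephased state becomes Z-dephased under the reflection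
    \<open>axis_swap\<close>, which leaves every quantity in the claim unchanged; in this form the
    induction hypothesis applies.\<close>
  have IHP: "pattern_ent n q m (?T True z) \<le> q\<^sup>2 * ?h (?T True z) + (1 - q\<^sup>2) * ?h (?R (?T True z))" for z
  proof -
    let ?W = "axis_swap n m z"
    note W = axis_swap_sym(1)[OF m(1), of z]
    note w = sym_unitaryD[OF W]
    define B where "B = ?W * ?T True z * ?W"
    have B: "pd (2^n) B" unfolding B_def by (rule pd_sym_conj[OF pT W])
    have com: "conj_commute (2^n) (pauli n j x' z') ?W" if "j < m \<or> m < j" "j < n" for j x' z'
      using axis_swap_commute[OF m(1) that(2)] that(1) by auto
    have "pattern_ent n q m B \<le> q\<^sup>2 * ?h B + (1 - q\<^sup>2) * ?h (?R B)"
    proof (rule Suc.IH[OF B m(2)])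
      fix j assume j: "m \<le> j" "j < n"
      show "ptwirl n j False True 0 B = B"
      proof (cases "j = m")
        case True
        have "ptwirl n m False True 0 B = ?W * ptwirl n m True z 0 (?T True z) * ?W" unfolding B_def
          by (rule twirl_sym_conj[OF w(1) pauli_carrier cT axis_swap_conj[OF m(1) cT] pauli_carrier])
        then show ?thesis unfolding True B_def twirl_twirl[OF sym_unitary_pauli[OF m(1)] c] by simp
      next
        case False
        then have j': "Suc m \<le> j" using j by simp
        have cc: "conj_commute (2^n) (pauli n j False True) ?W" using com[of j] j' j by simp
        show ?thesis unfolding B_def ptwirl_sym_conj[OF w(1) cT cc] fT[OF j' j(2)] ..
      qed
    qed
    moreover have "pattern_ent n q m B = pattern_ent n q m (?T True z)" unfolding B_def
      by (rule pattern_ent_sym_conj[OF pT W m(2)]) (use com m in auto)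
    moreover have "?h B = ?h (?T True z)" unfolding B_def
      using neg_entropy_unitary[OF pT w(4)] w(2) by simp
    moreover have "?R B = ?W * ?R (?T True z) * ?W" unfolding B_def
      by (rule mix_below_sym_conj[OF cT w(1) m(2)]) (use com m in auto)
    moreover have "?h (?W * ?R (?T True z) * ?W) = ?h (?R (?T True z))"
      using neg_entropy_unitary[OF pd_mix_below[OF pT m(2)] w(4)] w(2) by simp
    ultimately show ?thesis by simp
  qed
  have IHF: "pattern_ent n q m ?F \<le> q\<^sup>2 * ?h ?F + (1 - q\<^sup>2) * ?h (?R ?F)"
  proof (rule Suc.IH[OF pd_replace_mixed[OF A m(1)] m(2)])
    fix j assume j: "m \<le> j" "j < n"
    show "ptwirl n j False True 0 ?F = ?F"
    proof (cases "j = m")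
      case False
      then show ?thesis using replace_mixed_ptwirl_commute[OF c m(1) j(2), of False True 0] fix_above[of j] j by simp
    qed (use replace_mixed_fixed(1)[OF c m(1)] in simp)
  qed
  have S1: "?h (?T x z) - ?h (?R (?T x z)) \<le> ?h A - ?h (?R A)" for x z
    by (rule neg_entropy_mix_below_diff[OF A m(2,1)])
  have pair: "replace_mixed n m A = ptwirl n m x' z' 0 (?T x z)" if "x \<or> z" "x' \<or> z'" "x' \<noteq> x \<or> z' \<noteq> z" for x z x' z'
    using ptwirl_pair[OF c m(1) that(2,1,3)] by simp
  have S2: "?h ?F - ?h (?R ?F) \<le> ?h (?T x z) - ?h (?R (?T x z))" if "x \<or> z" "x' \<or> z'" "x' \<noteq> x \<or> z' \<noteq> z" for x z x' z'
    unfolding pair[OF that] by (rule neg_entropy_mix_below_diff[OF pT m(2,1)])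
  have S2': "?h ?F - ?h (?R ?F) \<le> ?h (?T True False) - ?h (?R (?T True False))"
    "?h ?F - ?h (?R ?F) \<le> ?h (?T True True) - ?h (?R (?T True True))"
    "?h ?F - ?h (?R ?F) \<le> ?h (?T False True) - ?h (?R (?T False True))"
    using S2[of True False False True] S2[of True True False True] S2[of False True True True] by simp_all
  have G: "pattern_ent n q m A \<le> ?h A - ?h (?T x z) + pattern_ent n q m (?T x z)" for x z
    by (rule pattern_ent_sub[OF A order_refl m(1) assms(3,4)])
  have C: "?h (?R (?T True False)) + ?h (?R (?T True True)) + ?h (?R (?T False True)) \<le> ?h (?R A) + 2 * ?h (?R ?F)"
  proof -
    have "blk_diag n m (?R A)"
    proof (rule blk_diagI[OF mix_below_carrier[OF c] m(1)])
      fix j assume j: "j < n" "j \<noteq> m"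
      show "ptwirl n j False True 0 (?R A) = ?R A"
      proof (cases "j < m")
        case True
        then show ?thesis using mix_below_fixed(1)[OF c m(2)] by simp
      next
        case False
        then show ?thesis using mix_below_ptwirl[OF c m(2) j(1), of False True 0] fix_above[of j] j by simp
      qed
    qed
    from neg_entropy_pauli_sum[OF pd_mix_below[OF A m(2)] this m(1)]
    show ?thesis unfolding mix_below_ptwirl[OF c m(2,1)] mix_below_replace_mixed[OF c m(2,1)] .
  qed
  show ?case unfolding pattern_ent.simps mix_below.simps
  proof (rule pattern_ent_bound_arith[OF assms(3,4) S1 S1 S1 S2' C _ _ _ IHP IHP IHZ IHF])
    show "pattern_ent n q m A \<le> ?h A - (1 - q\<^sup>2) * (?h (?T True False) - ?h (?R (?T True False)))"
      using G[of True False] IHP[of False] by (simp add: algebra_simps)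
    show "pattern_ent n q m A \<le> ?h A - (1 - q\<^sup>2) * (?h (?T True True) - ?h (?R (?T True True)))"
      using G[of True True] IHP[of True] by (simp add: algebra_simps)
    show "pattern_ent n q m A \<le> ?h A - (1 - q\<^sup>2) * (?h (?T False True) - ?h (?R (?T False True)))"
      using G[of False True] IHZ by (simp add: algebra_simps)
  qed
qed

section \<open>Entropy decay of the noisy circuit\<close>

lemma mtrace_replace_mixed:
  assumes "A \<in> sq (2^n)" "i < n"
  shows "mtrace (replace_mixed n i A) = mtrace A"
proof -
  have t: "ptwirl n i False True 0 A \<in> sq (2^n)" using assms by simp
  show ?thesis unfolding replace_mixed_twirl[OF assms] mtrace_twirl[OF sym_unitary_pauli[OF assms(2)] t]
    by (rule mtrace_twirl[OF sym_unitary_pauli[OF assms(2)] assms(1)])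
qed

lemma mtrace_mix_below:
  "A \<in> sq (2^n) \<Longrightarrow> m \<le> n \<Longrightarrow> mtrace (mix_below n m A) = mtrace A"
  by (induction m arbitrary: A) (auto simp: mtrace_replace_mixed)

text \<open>Bits are corrected from the top down: at stage k only the bits below k may still differ
  from those of b.\<close>

lemma flip_invariant_const:
  assumes f: "\<And>j a. j < n \<Longrightarrow> a < 2^n \<Longrightarrow> f (flip j a) = f a" and a: "a < 2^n" "b < 2^n"
  shows "f a = f b"
proof -
  have "f a = f b" if "a < 2^n" "k \<le> n" "\<And>j. k \<le> j \<Longrightarrow> j < n \<Longrightarrow> qbit j a = qbit j b" for a k
    using that
  proof (induction k arbitrary: a)
    case 0
    then show ?case using qbit_eqI[of a n b] a(2) by auto
  next
    case (Suc k)
    show ?case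
    proof (cases "qbit k a = qbit k b")
      case True
      have "qbit j a = qbit j b" if "k \<le> j" "j < n" for j
        using Suc.prems(3)[of j] that True by (cases "j = k") auto
      then show ?thesis using Suc.IH[of a] Suc.prems by simp
    next
      case False
      have "qbit j (flip k a) = qbit j b" if "k \<le> j" "j < n" for j
        using Suc.prems(3)[of j] that False qbit_cases[of k a] qbit_cases[of k b] by (cases "j = k") auto
      then have "f (flip k a) = f b" using Suc.IH[of "flip k a"] Suc.prems by simp
      then show ?thesis using f[of k a] Suc.prems by simp
    qed
  qed
  from this[OF a(1), of n] show ?thesis by simp
qed

text \<open>Invariance under the Z-dephasings removes the off-diagonal entries, invariance under the
  X-dephasings makes the diagonal constant.\<close>

lemma mix_below_all:
  assumes A: "A \<in> sq (2^n)" and tr: "mtrace A = 1"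
  shows "mix_below n n A = complex_of_real (1 / 2^n) \<cdot>\<^sub>m 1\<^sub>m (2^n)"
proof -
  define B where "B = mix_below n n A"
  have B: "B \<in> sq (2^n)" unfolding B_def by (rule mix_below_carrier[OF A])
  have fix1: "ptwirl n j False True 0 B = B" "ptwirl n j True False 0 B = B" if "j < n" for j
    unfolding B_def using mix_below_fixed[OF A order_refl that] by auto
  have off: "B $$ (a,b) = 0" if "a < 2^n" "b < 2^n" "a \<noteq> b" for a b
  proof -
    have "\<exists>j<n. qbit j a \<noteq> qbit j b" using qbit_eqI[of a n b] that by blast
    then show ?thesis using ptwirl_fixed_offdiag[OF B fix1(1)] that by blast
  qed
  have "B $$ (flip j a, flip j a) = B $$ (a,a)" if "j < n" "a < 2^n" for j a
  proof -
    have "B $$ (a,a) = B $$ (a,a) / 2 + B $$ (flip j a, flip j a) / 2"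
      using ptwirl_index[OF B that(2,2,1), of True False 0] fix1(2)[OF that(1)] by simp
    moreover have "y = x" if "x = x / 2 + y / 2" for x y :: complex
    proof (rule complex_eqI)
      show "Re y = Re x" using arg_cong[OF that, of Re] unfolding plus_complex.sel Re_divide_numeral by linarith
      show "Im y = Im x" using arg_cong[OF that, of Im] unfolding plus_complex.sel Im_divide_numeral by linarith
    qed
    ultimately show ?thesis by blast
  qed
  then have const: "B $$ (a,a) = B $$ (0,0)" if "a < 2^n" for a
    using flip_invariant_const[of n "\<lambda>a. B $$ (a,a)" a 0] that by simp
  have "(\<Sum>a<2^n. B $$ (a,a)) = (\<Sum>a<(2::nat)^n. B $$ (0,0))" by (intro sum.cong const) auto
  moreover have "mtrace B = 1" unfolding B_def by (simp add: mtrace_mix_below[OF A] tr)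
  ultimately have B0: "B $$ (0,0) = 1 / 2^n" using mtrace_carrier[OF B] by (simp add: field_simps)
  show ?thesis unfolding B_def[symmetric]
  proof (rule sq_eqI[OF B])
    fix a b :: nat assume ab: "a < 2^n" "b < 2^n"
    show "B $$ (a,b) = (complex_of_real (1 / 2^n) \<cdot>\<^sub>m 1\<^sub>m (2^n)) $$ (a,b)"
    proof (cases "a = b")
      case True
      then show ?thesis using const[OF ab(1)] ab by (simp add: B0)
    next
      case False
      then show ?thesis using off[OF ab] ab by simp
    qed
  qed simp
qed

lemma pd_one: "pd N (1\<^sub>m N)"
  using pd_rdiag[of N "\<lambda>_. 1"] by simp

lemma neg_entropy_mixed: "N > 0 \<Longrightarrow> neg_entropy N (complex_of_real (1 / real N) \<cdot>\<^sub>m 1\<^sub>m N) = - ln (real N)"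
proof -
  assume N: "N > 0"
  have "complex_of_real (1 / real N) \<cdot>\<^sub>m 1\<^sub>m N = rdiag N (\<lambda>_. 1 / real N)"
    by (rule sq_eqI[of _ N]) (auto simp: mat_diag_def)
  moreover have "neg_entropy N (rdiag N (\<lambda>_. 1 / real N)) = (\<Sum>i<N. 1 / real N * ln (1 / real N))"
    by (rule neg_entropy_rdiag) (use N in simp)
  ultimately show ?thesis using N by (simp only:) (simp add: ln_div)
qed

text \<open>\<open>pattern_ent_le\<close> with all qubits averaged; the zero level is then -n ln 2,
  the value at the maximally mixed state.\<close>

lemma noise_entropy:
  assumes A: "pd (2^n) A" and tr: "mtrace A = 1" and p: "\<And>i. i < n \<Longrightarrow> 0 \<le> p i \<and> p i \<le> 1 \<and> 1 - p i \<le> q"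
    and q: "0 \<le> q" "q \<le> 1"
  shows "neg_entropy (2^n) (noise n p A) + n * ln 2 \<le> q\<^sup>2 * (neg_entropy (2^n) A + n * ln 2)" "pd (2^n) (noise n p A)"
proof -
  show "pd (2^n) (noise n p A)" unfolding noise_def by (rule neg_entropy_noise_le(2)[OF A order_refl p q(2)])
  have "neg_entropy (2^n) (noise n p A) \<le> pattern_ent n q n A"
    unfolding noise_def by (rule neg_entropy_noise_le(1)[OF A order_refl p q(2)])
  also have "\<dots> \<le> q\<^sup>2 * neg_entropy (2^n) A + (1 - q\<^sup>2) * neg_entropy (2^n) (mix_below n n A)"
    by (rule pattern_ent_le[OF A order_refl q]) auto
  also have "neg_entropy (2^n) (mix_below n n A) = - (n * ln 2)"
    unfolding mix_below_all[OF pd_carrier[OF A] tr] using neg_entropy_mixed[of "2^n"] by (simp add: ln_realpow)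
  finally show "neg_entropy (2^n) (noise n p A) + n * ln 2 \<le> q\<^sup>2 * (neg_entropy (2^n) A + n * ln 2)"
    by (simp add: algebra_simps)
qed

section \<open>Density operators and entropy along the circuit\<close>

lemma depol_on_carrier: "A \<in> sq (2^n) \<Longrightarrow> depol_on n i p A \<in> sq (2^n)"
  by (simp add: depol_on_def)

lemma psd_sym_conj: "psd N A \<Longrightarrow> sym_unitary N P \<Longrightarrow> psd N (P * A * P)"
  using psd_conj[of N A P] sym_unitaryD(1,2)[of N P] by simp

lemma psd_twirl: "psd N A \<Longrightarrow> sym_unitary N P \<Longrightarrow> \<bar>l\<bar> \<le> 1 \<Longrightarrow> psd N (twirl P l A)"
  unfolding twirl_def by (intro psd_add psd_smult psd_sym_conj) auto

definition density_mat :: "nat \<Rightarrow> complex mat \<Rightarrow> bool" where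
  "density_mat N A \<longleftrightarrow> psd N A \<and> mtrace A = 1"

text \<open>Written as three dephasings, the channel is visibly a mixture of unitary
  conjugations.\<close>

lemma density_depol_on:
  assumes "density_mat (2^n) A" "i < n" "0 \<le> p" "p \<le> 1"
  shows "density_mat (2^n) (depol_on n i p A)"
proof -
  have A: "psd (2^n) A" "mtrace A = 1" using assms by (auto simp: density_mat_def)
  note c = psd_carrier[OF A(1)]
  define l where "l = sqrt (1 - p)"
  have l: "p = 1 - l\<^sup>2" "\<bar>l\<bar> \<le> 1" using assms by (auto simp: l_def)
  note s = sym_unitary_pauli[OF assms(2)]
  have t: "twirl (pauli n i x z) l B \<in> sq (2^n)" if "B \<in> sq (2^n)" for x z B
    using that by simp
  show ?thesis unfolding density_mat_def depol_on_twirl[OF c assms(2) l(1)]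
      mtrace_twirl[OF s t[OF t[OF c]]] mtrace_twirl[OF s t[OF c]] mtrace_twirl[OF s c]
    by (intro conjI psd_twirl A s l)
qed

lemma density_noise:
  assumes "density_mat (2^n) A" "\<And>i. i < n \<Longrightarrow> 0 \<le> p i \<and> p i \<le> 1"
  shows "density_mat (2^n) (noise n p A)"
proof -
  have "density_mat (2^n) (foldr (\<lambda>i t. depol_on n i (p i) t) [0..<m] A)" if "m \<le> n" for m
    using assms(1) that
  proof (induction m arbitrary: A)
    case (Suc m)
    then show ?case using density_depol_on[OF Suc.prems(1), of m "p m"] assms(2)[of m] by simp
  qed simp
  then show ?thesis unfolding noise_def by simp
qed

lemma density_unitary_channel:
  assumes "density_mat N A" "unitary_mat N U"
  shows "density_mat N (unitary_channel U A)"
  using assms psd_conj[of N A U] mtrace_unitary_conj(1)[OF assms(2), of A] unitary_matD(1)[OF assms(2)]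
  by (auto simp: density_mat_def unitary_channel_def psd_carrier)

lemma density_noisy_state:
  assumes "density_mat (2^n) A" "\<And>i. i < n \<Longrightarrow> 0 \<le> p i \<and> p i \<le> 1" "\<forall>U\<in>set Us. unitary_mat (2^n) U"
  shows "density_mat (2^n) (noisy_state n p Us A)"
proof -
  have "density_mat (2^n) B \<Longrightarrow> density_mat (2^n) (foldl (\<lambda>\<tau> U. noise n p (unitary_channel U \<tau>)) B Us)" for B
    using assms(3)
    by (induction Us arbitrary: B) (auto intro!: density_noise density_unitary_channel assms(2))
  moreover have "density_mat (2^n) (noise n p A)" by (rule density_noise[OF assms(1,2)])
  ultimately show ?thesis unfolding noisy_state_def by blast
qed

text \<open>Gates leave the entropy alone, so only the noise layers count: one after each gate and
  one before the first, each contributing q^2.\<close>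

lemma noisy_state_entropy:
  assumes A: "pd (2^n) A" and tr: "mtrace A = 1" and p: "\<And>i. i < n \<Longrightarrow> 0 \<le> p i \<and> p i \<le> 1 \<and> 1 - p i \<le> q"
    and q: "0 \<le> q" "q \<le> 1" and U: "\<forall>U\<in>set Us. unitary_mat (2^n) U"
  shows "neg_entropy (2^n) (noisy_state n p Us A) + n * ln 2 \<le> q ^ (2 * (length Us + 1)) * (neg_entropy (2^n) A + n * ln 2)"
    and "pd (2^n) (noisy_state n p Us A)"
proof -
  have p': "0 \<le> p i \<and> p i \<le> 1" if "i < n" for i using p[OF that] by auto
  let ?D = "\<lambda>A. neg_entropy (2^n) A + n * ln 2"
  have step: "?D (foldl (\<lambda>\<tau> U. noise n p (unitary_channel U \<tau>)) B Us) \<le> q ^ (2 * length Us) * ?D B \<and>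
      pd (2^n) (foldl (\<lambda>\<tau> U. noise n p (unitary_channel U \<tau>)) B Us)"
    if "pd (2^n) B" "mtrace B = 1" for B
    using U that
  proof (induction Us arbitrary: B)
    case (Cons V Us)
    have V: "unitary_mat (2^n) V" using Cons.prems by simp
    define C where "C = unitary_channel V B"
    have C: "pd (2^n) C" "mtrace C = 1" "neg_entropy (2^n) C = neg_entropy (2^n) B"
      unfolding C_def unitary_channel_def
      using pd_conj[OF Cons.prems(2) V] mtrace_unitary_conj(1)[OF V pd_carrier[OF Cons.prems(2)]] Cons.prems(3)
        neg_entropy_unitary[OF Cons.prems(2) V] by simp_all
    have d: "density_mat (2^n) (noise n p C)" by (rule density_noise[OF _ p']) (use C pd_psd in \<open>auto simp: density_mat_def\<close>)
    note nz = noise_entropy[OF C(1,2) p q]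
    have "?D (foldl (\<lambda>\<tau> U. noise n p (unitary_channel U \<tau>)) (noise n p C) Us) \<le> q ^ (2 * length Us) * ?D (noise n p C) \<and>
      pd (2^n) (foldl (\<lambda>\<tau> U. noise n p (unitary_channel U \<tau>)) (noise n p C) Us)"
      by (rule Cons.IH) (use Cons.prems(1) d nz in \<open>auto simp: density_mat_def\<close>)
    moreover have "q ^ (2 * length Us) * ?D (noise n p C) \<le> q ^ (2 * length Us) * (q\<^sup>2 * ?D B)"
      using nz(1) q unfolding C(3) by (intro mult_left_mono) auto
    moreover have "q ^ (2 * length Us) * (q\<^sup>2 * ?D B) = q ^ (2 * length (V # Us)) * ?D B"
      by (simp add: power_add power2_eq_square)
    ultimately show ?case unfolding C_def foldl_Cons by linarith
  qed simp
  note nz = noise_entropy[OF A tr p q]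
  have d: "density_mat (2^n) (noise n p A)" by (rule density_noise[OF _ p']) (use A tr pd_psd in \<open>auto simp: density_mat_def\<close>)
  have s: "?D (noisy_state n p Us A) \<le> q ^ (2 * length Us) * ?D (noise n p A)" "pd (2^n) (noisy_state n p Us A)"
    unfolding noisy_state_def using step[OF nz(2)] d by (auto simp: density_mat_def)
  show "pd (2^n) (noisy_state n p Us A)" by (rule s)
  have "q ^ (2 * length Us) * ?D (noise n p A) \<le> q ^ (2 * length Us) * (q\<^sup>2 * ?D A)"
    using nz(1) q by (intro mult_left_mono) auto
  moreover have "q ^ (2 * length Us) * (q\<^sup>2 * ?D A) = q ^ (2 * (length Us + 1)) * ?D A"
    by (simp add: power_add power2_eq_square)
  ultimately show "?D (noisy_state n p Us A) \<le> q ^ (2 * (length Us + 1)) * ?D A" using s by linarith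
qed

section \<open>Entropy and distance from the uniform distribution\<close>

lemma neg_entropy_nonpos:
  assumes "pd N A" "mtrace A = 1"
  shows "neg_entropy N A \<le> 0"
proof -
  obtain U r where r: "spec N A U r" "\<And>i. i < N \<Longrightarrow> r i > 0" using pd_spec[OF assms(1)] by metis
  have "(\<Sum>i<N. r i) = 1" using spec_mtrace[OF r(1)] assms(2) by (metis of_real_eq_1_iff)
  have "r i * ln (r i) \<le> 0" if "i < N" for i
  proof -
    have "r i \<le> (\<Sum>i<N. r i)" using r(2) that by (intro member_le_sum) (auto simp: less_imp_le)
    then have "r i \<le> 1" using \<open>(\<Sum>i<N. r i) = 1\<close> by simp
    then show ?thesis using r(2)[OF that] by (simp add: mult_le_0_iff)
  qed
  then have "(\<Sum>i<N. r i * ln (r i)) \<le> 0" by (intro sum_nonpos) auto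
  then show ?thesis using neg_entropy_spec[OF r] by simp
qed

text \<open>Pinsker's inequality is Cauchy-Schwarz inside the integral formula for the relative entropy.\<close>

lemma pinsker_uniform:
  fixes r :: "nat \<Rightarrow> real"
  assumes r: "\<And>i. i < N \<Longrightarrow> r i > 0" and sum: "(\<Sum>i<N. r i) = 1" and N: "N > 0"
  shows "(\<Sum>i<N. \<bar>r i - 1 / N\<bar>)\<^sup>2 \<le> 2 * ((\<Sum>i<N. r i * ln (r i)) + ln N)"
proof -
  define s where "s = 1 / real N"
  have s: "s > 0" "(\<Sum>i<N. s) = 1" using N by (auto simp: s_def)
  define T where "T = (\<Sum>i<N. \<bar>r i - s\<bar>)"
  have 1: "((\<lambda>v. \<Sum>i<N. v * ((s - r i)\<^sup>2 / (v * s + (1 - v) * r i))) has_integral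
      (\<Sum>i<N. r i * ln (r i) - r i * ln s - r i + s)) {0..1}"
    by (intro has_integral_sum rel_ent_kernel_integral r s) auto
  \<comment> \<open>The integral of v over [0,1] is 1/2, the source of the constant 2 in the
    bound.\<close>
  have 2: "((\<lambda>v. v * T\<^sup>2) has_integral (1/2 * T\<^sup>2)) {0..1::real}"
    using has_integral_mult_left[OF ident_has_integral[of 0 "1::real"], of "T\<^sup>2"] by simp
  have "v * T\<^sup>2 \<le> (\<Sum>i<N. v * ((s - r i)\<^sup>2 / (v * s + (1 - v) * r i)))" if v: "v \<in> {0..1}" for v
  proof -
    define m where "m i = v * s + (1 - v) * r i" for i
    have m: "m i > 0" if "i < N" for i
    proof (cases "v = 0")
      case False
      then have "v * s > 0" "(1 - v) * r i \<ge> 0" using s r[OF that] v by (auto simp: less_imp_le)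
      then show ?thesis unfolding m_def by linarith
    qed (use r that in \<open>auto simp: m_def\<close>)
    have ms: "(\<Sum>i<N. m i) = 1" unfolding m_def
      using sum s(2) by (simp add: sum.distrib flip: sum_distrib_left)
    \<comment> \<open>Cauchy-Schwarz with weights m i, which sum to 1 because they interpolate
      between r and the uniform distribution.\<close>
    have "T = (\<Sum>i<N. (\<bar>r i - s\<bar> / sqrt (m i)) * sqrt (m i))" unfolding T_def
      using m by (intro sum.cong) (auto simp: less_imp_neq[symmetric])
    also have "\<dots>\<^sup>2 \<le> (\<Sum>i<N. (\<bar>r i - s\<bar> / sqrt (m i))\<^sup>2) * (\<Sum>i<N. (sqrt (m i))\<^sup>2)"
      by (rule Cauchy_Schwarz_ineq_sum)
    also have "(\<Sum>i<N. (sqrt (m i))\<^sup>2) = (\<Sum>i<N. m i)" using m by (intro sum.cong) (auto simp: less_imp_le)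
    also have "(\<Sum>i<N. (\<bar>r i - s\<bar> / sqrt (m i))\<^sup>2) = (\<Sum>i<N. (s - r i)\<^sup>2 / m i)"
      using m by (intro sum.cong) (auto simp: power_divide less_imp_le power2_commute)
    finally have "T\<^sup>2 \<le> (\<Sum>i<N. (s - r i)\<^sup>2 / m i)" by (simp add: ms)
    then have "v * T\<^sup>2 \<le> v * (\<Sum>i<N. (s - r i)\<^sup>2 / m i)" using v by (intro mult_left_mono) auto
    then show ?thesis by (simp add: m_def sum_distrib_left)
  qed
  with has_integral_le[OF 2 1] have "1/2 * T\<^sup>2 \<le> (\<Sum>i<N. r i * ln (r i) - r i * ln s - r i + s)" by blast
  also have "\<dots> = (\<Sum>i<N. r i * ln (r i)) - ln s"
    using sum s(2) by (simp add: sum.distrib sum_subtractf flip: sum_distrib_right)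
  also have "ln s = - ln N" using N by (simp add: s_def ln_div)
  finally show ?thesis by (simp add: T_def s_def)
qed

section \<open>Linearity and unitality of the noisy circuit\<close>

lemma depol_on_affine:
  assumes "A \<in> sq (2^n)" "i < n"
  shows "depol_on n i p (a \<cdot>\<^sub>m A + b \<cdot>\<^sub>m 1\<^sub>m (2^n)) = a \<cdot>\<^sub>m depol_on n i p A + b \<cdot>\<^sub>m 1\<^sub>m (2^n)"
proof (rule sq_eqI[of _ "2^n"])
  fix x y :: nat assume xy: "x < 2^n" "y < 2^n"
  let ?B = "a \<cdot>\<^sub>m A + b \<cdot>\<^sub>m 1\<^sub>m (2^n)"
  have dep: "depol_on n i p C $$ (x,y) = (1 - p) * C $$ (x,y) + p * replace_mixed n i C $$ (x,y)"
    if "C \<in> sq (2^n)" for C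
    unfolding depol_on_def using that xy by (simp add: sq_index[of _ "2^n"])
  have f: "flip i x = flip i y \<longleftrightarrow> x = y" by (metis flip_flip)
  have B: "?B \<in> sq (2^n)" using assms by simp
  have 1: "?B $$ (x,y) = a * A $$ (x,y) + (if x = y then b else 0)" using assms xy by auto
  have 2: "?B $$ (flip i x, flip i y) = a * A $$ (flip i x, flip i y) + (if x = y then b else 0)" using assms xy f by auto
  have 3: "(a \<cdot>\<^sub>m depol_on n i p A + b \<cdot>\<^sub>m 1\<^sub>m (2^n)) $$ (x,y) = a * depol_on n i p A $$ (x,y) + (if x = y then b else 0)"
    using depol_on_carrier[OF assms(1), of i p] xy by auto
  show "depol_on n i p ?B $$ (x,y) = (a \<cdot>\<^sub>m depol_on n i p A + b \<cdot>\<^sub>m 1\<^sub>m (2^n)) $$ (x,y)"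
    unfolding 3 dep[OF B] dep[OF assms(1)] replace_mixed_index[OF xy] 1 2
    by (cases "qbit i x = qbit i y") (auto simp: field_simps)
qed (use depol_on_carrier assms in auto)

lemma noise_affine:
  assumes "A \<in> sq (2^n)"
  shows "noise n p (a \<cdot>\<^sub>m A + b \<cdot>\<^sub>m 1\<^sub>m (2^n)) = a \<cdot>\<^sub>m noise n p A + b \<cdot>\<^sub>m 1\<^sub>m (2^n)" "noise n p A \<in> sq (2^n)"
proof -
  let ?f = "\<lambda>m. foldr (\<lambda>i t. depol_on n i (p i) t) [0..<m]"
  have "?f m (a \<cdot>\<^sub>m A + b \<cdot>\<^sub>m 1\<^sub>m (2^n)) = a \<cdot>\<^sub>m ?f m A + b \<cdot>\<^sub>m 1\<^sub>m (2^n) \<and> ?f m A \<in> sq (2^n)" if "m \<le> n" for m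
    using assms that
  proof (induction m arbitrary: A)
    case (Suc m)
    then show ?case using Suc.IH[OF depol_on_carrier[OF Suc.prems(1)], of m "p m"] by (simp add: depol_on_affine)
  qed simp
  from this[of n] show "noise n p (a \<cdot>\<^sub>m A + b \<cdot>\<^sub>m 1\<^sub>m (2^n)) = a \<cdot>\<^sub>m noise n p A + b \<cdot>\<^sub>m 1\<^sub>m (2^n)"
    "noise n p A \<in> sq (2^n)" unfolding noise_def by auto
qed

lemma unitary_channel_affine:
  assumes "A \<in> sq N" "unitary_mat N U"
  shows "unitary_channel U (a \<cdot>\<^sub>m A + b \<cdot>\<^sub>m 1\<^sub>m N) = a \<cdot>\<^sub>m unitary_channel U A + b \<cdot>\<^sub>m 1\<^sub>m N"
    "unitary_channel U A \<in> sq N"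
proof -
  note u = unitary_matD[OF assms(2)]
  have c: "a \<cdot>\<^sub>m A \<in> sq N" "b \<cdot>\<^sub>m 1\<^sub>m N \<in> sq N" "1\<^sub>m N \<in> sq N" using assms by auto
  show "unitary_channel U A \<in> sq N" unfolding unitary_channel_def by (intro sq_closed u assms)
  have "U * (a \<cdot>\<^sub>m A + b \<cdot>\<^sub>m 1\<^sub>m N) = U * (a \<cdot>\<^sub>m A) + U * (b \<cdot>\<^sub>m 1\<^sub>m N)"
    by (rule mult_add_distrib_mat[OF u(1) c(1,2)])
  also have "\<dots> = a \<cdot>\<^sub>m (U * A) + b \<cdot>\<^sub>m U"
    unfolding mult_smult_distrib[OF u(1) assms(1)] mult_smult_distrib[OF u(1) c(3)] right_mult_one_mat[OF u(1)] ..
  finally have 1: "U * (a \<cdot>\<^sub>m A + b \<cdot>\<^sub>m 1\<^sub>m N) = a \<cdot>\<^sub>m (U * A) + b \<cdot>\<^sub>m U" .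
  have d: "U * A \<in> sq N" "a \<cdot>\<^sub>m (U * A) \<in> sq N" "b \<cdot>\<^sub>m U \<in> sq N"
    using sq_closed[OF u(1) assms(1)] u(1) by simp_all
  have "(a \<cdot>\<^sub>m (U * A) + b \<cdot>\<^sub>m U) * madj U = a \<cdot>\<^sub>m (U * A) * madj U + b \<cdot>\<^sub>m U * madj U"
    by (rule add_mult_distrib_mat[OF d(2,3) u(2)])
  also have "\<dots> = a \<cdot>\<^sub>m (U * A * madj U) + b \<cdot>\<^sub>m 1\<^sub>m N"
    unfolding mult_smult_assoc_mat[OF d(1) u(2)] mult_smult_assoc_mat[OF u(1,2)] u(4) ..
  finally show "unitary_channel U (a \<cdot>\<^sub>m A + b \<cdot>\<^sub>m 1\<^sub>m N) = a \<cdot>\<^sub>m unitary_channel U A + b \<cdot>\<^sub>m 1\<^sub>m N"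
    unfolding unitary_channel_def 1 .
qed

lemma noisy_state_affine:
  assumes "A \<in> sq (2^n)" "\<forall>U\<in>set Us. unitary_mat (2^n) U"
  shows "noisy_state n p Us (a \<cdot>\<^sub>m A + b \<cdot>\<^sub>m 1\<^sub>m (2^n)) = a \<cdot>\<^sub>m noisy_state n p Us A + b \<cdot>\<^sub>m 1\<^sub>m (2^n)"
proof -
  have "foldl (\<lambda>\<tau> U. noise n p (unitary_channel U \<tau>)) (a \<cdot>\<^sub>m B + b \<cdot>\<^sub>m 1\<^sub>m (2^n)) Us =
      a \<cdot>\<^sub>m foldl (\<lambda>\<tau> U. noise n p (unitary_channel U \<tau>)) B Us + b \<cdot>\<^sub>m 1\<^sub>m (2^n)"
    if "B \<in> sq (2^n)" for B
    using assms(2) that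
    by (induction Us arbitrary: B) (simp_all add: unitary_channel_affine noise_affine)
  then show ?thesis unfolding noisy_state_def noise_affine(1)[OF assms(1)] using noise_affine(2)[OF assms(1)] by blast
qed

section \<open>Trace norm bounds\<close>

text \<open>An upper bound on the trace norm, witnessed by a decomposition into rank-one operators.\<close>

inductive tnorm_le :: "nat \<Rightarrow> complex mat \<Rightarrow> real \<Rightarrow> bool" for N where
  tnorm_zero: "t \<ge> 0 \<Longrightarrow> tnorm_le N (0\<^sub>m N N) t"
| tnorm_add_ketbra: "tnorm_le N A t \<Longrightarrow> w \<in> carrier_vec N \<Longrightarrow> vnorm w = 1 \<Longrightarrow> tnorm_le N (A + c \<cdot>\<^sub>m ketbra w) (t + cmod c)"

lemma one_smult_cmat: "(1 :: complex) \<cdot>\<^sub>m A = A"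
  by (rule eq_matI) auto

lemma ketbra_carrier: "w \<in> carrier_vec N \<Longrightarrow> ketbra w \<in> sq N"
  by (auto simp: ketbra_def)

lemma tnorm_le_carrier: "tnorm_le N A t \<Longrightarrow> A \<in> sq N"
  by (induction rule: tnorm_le.induct) (auto simp: ketbra_carrier)

lemma tnorm_le_nonneg: "tnorm_le N A t \<Longrightarrow> t \<ge> 0"
  by (induction rule: tnorm_le.induct) auto

text \<open>The rank-one terms of B are appended to those of A. The base case takes an induction of
  its own, raising the bound of A by the slack allowed at the zero matrix.\<close>

lemma tnorm_le_add:
  assumes "tnorm_le N A s" "tnorm_le N B t"
  shows "tnorm_le N (A + B) (s + t)"
  using assms(2,1)
proof (induction rule: tnorm_le.induct)
  case (tnorm_zero t)
  from tnorm_zero(2) have "tnorm_le N A (s + t)" using tnorm_zero(1)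
  proof (induction rule: tnorm_le.induct)
    case (tnorm_zero s)
    then show ?case by (intro tnorm_le.tnorm_zero) simp
  next
    case (tnorm_add_ketbra A s w c)
    then have "tnorm_le N (A + c \<cdot>\<^sub>m ketbra w) ((s + t) + cmod c)" by (intro tnorm_le.tnorm_add_ketbra) auto
    then show ?case by (simp add: algebra_simps)
  qed
  then show ?case using tnorm_le_carrier[OF tnorm_zero(2)] by simp
next
  case (tnorm_add_ketbra B t w c)
  then have "tnorm_le N ((A + B) + c \<cdot>\<^sub>m ketbra w) ((s + t) + cmod c)" by (intro tnorm_le.tnorm_add_ketbra) auto
  moreover have "(A + B) + c \<cdot>\<^sub>m ketbra w = A + (B + c \<cdot>\<^sub>m ketbra w)"
    using tnorm_add_ketbra.hyps tnorm_add_ketbra.prems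
    by (intro assoc_add_mat[of _ N N]) (auto dest: tnorm_le_carrier simp: ketbra_carrier)
  ultimately show ?case by (simp add: algebra_simps)
qed

lemma tnorm_le_mono: "tnorm_le N A s \<Longrightarrow> s \<le> t \<Longrightarrow> tnorm_le N A t"
  using tnorm_le_add[OF _ tnorm_zero, of N A s "t - s"] tnorm_le_carrier[of N A s] by simp

lemma tnorm_le_ketbra: "w \<in> carrier_vec N \<Longrightarrow> vnorm w = 1 \<Longrightarrow> tnorm_le N (c \<cdot>\<^sub>m ketbra w) (cmod c)"
  using tnorm_add_ketbra[OF tnorm_zero[of 0], of w N c] ketbra_carrier[of w N] by simp

lemma tnorm_le_smult: "tnorm_le N A t \<Longrightarrow> tnorm_le N (c \<cdot>\<^sub>m A) (cmod c * t)"
proof (induction rule: tnorm_le.induct)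
  case (tnorm_zero t)
  then show ?case by (simp add: tnorm_le.tnorm_zero)
next
  case (tnorm_add_ketbra A t w a)
  then have "tnorm_le N (c \<cdot>\<^sub>m A + (c * a) \<cdot>\<^sub>m ketbra w) (cmod c * t + cmod (c * a))" by (intro tnorm_le.tnorm_add_ketbra) auto
  moreover have "c \<cdot>\<^sub>m (A + a \<cdot>\<^sub>m ketbra w) = c \<cdot>\<^sub>m A + (c * a) \<cdot>\<^sub>m ketbra w"
    using tnorm_le_carrier[OF tnorm_add_ketbra(1)] ketbra_carrier[OF tnorm_add_ketbra(2)]
    by (intro sq_eqI[of _ N]) (auto simp: algebra_simps)
  ultimately show ?case by (simp add: norm_mult algebra_simps)
qed

section \<open>Kronecker products and their trace norm\<close>

lemma kron_carrier: "A \<in> carrier_mat a b \<Longrightarrow> B \<in> carrier_mat c d \<Longrightarrow> kron A B \<in> carrier_mat (a * c) (b * d)"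
  by (auto simp: kron_def)

lemma kron_index:
  assumes "A \<in> sq a" "B \<in> sq b" "i < a * b" "j < a * b"
  shows "kron A B $$ (i,j) = A $$ (i div b, j div b) * B $$ (i mod b, j mod b)"
  using assms by (simp add: kron_def)

lemma div_mod_lt:
  assumes "i < a * (b::nat)"
  shows "i div b < a" "i mod b < b"
proof -
  have "b > 0" using assms by (cases b) auto
  then show "i mod b < b" by simp
  show "i div b < a" using assms by (simp add: less_mult_imp_div_less)
qed

lemma kron_linear:
  assumes "A \<in> sq a" "A' \<in> sq a" "B \<in> sq b" "B' \<in> sq b"
  shows "kron (A + c \<cdot>\<^sub>m A') B = kron A B + c \<cdot>\<^sub>m kron A' B" "kron A (B + c \<cdot>\<^sub>m B') = kron A B + c \<cdot>\<^sub>m kron A B'"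
    "kron (A - A') B = kron A B - kron A' B" "kron A (B - B') = kron A B - kron A B'"
    "kron (c \<cdot>\<^sub>m A) B = c \<cdot>\<^sub>m kron A B" "kron A (c \<cdot>\<^sub>m B) = c \<cdot>\<^sub>m kron A B"
  using assms div_mod_lt[of _ a b] by (auto simp: kron_def algebra_simps intro!: eq_matI)

lemma kron_zero:
  "B \<in> sq b \<Longrightarrow> kron (0\<^sub>m a a) B = 0\<^sub>m (a * b) (a * b)"
  "A \<in> sq a \<Longrightarrow> kron A (0\<^sub>m b b) = 0\<^sub>m (a * b) (a * b)"
  using div_mod_lt[of _ a b] by (auto simp: kron_def intro!: eq_matI)

lemma sum_div_mod:
  fixes f :: "nat \<Rightarrow> nat \<Rightarrow> 'a::comm_monoid_add"
  shows "(\<Sum>i<a * b. f (i div b) (i mod b)) = (\<Sum>x<a. \<Sum>y<b. f x y)"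
proof -
  have "(\<Sum>x<a. \<Sum>y<b. f x y) = (\<Sum>(x,y)\<in>{..<a} \<times> {..<b}. f x y)" by (rule sum.cartesian_product)
  also have "\<dots> = (\<Sum>i<a * b. f (i div b) (i mod b))"
  proof (rule sum.reindex_bij_witness[of _ "\<lambda>i. (i div b, i mod b)" "\<lambda>(x,y). x * b + y"])
    fix p assume "p \<in> {..<a} \<times> {..<b}"
    then obtain x y where p: "p = (x,y)" "x < a" "y < b" by auto
    have "x * b + y < x * b + b" using p by simp
    also have "\<dots> = Suc x * b" by simp
    also have "\<dots> \<le> a * b" using p by (intro mult_le_mono1) simp
    finally show "(case p of (x,y) \<Rightarrow> x * b + y) \<in> {..<a * b}" using p by simp
  qed (use div_mod_lt in auto)
  finally show ?thesis by simp
qed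

definition vkron :: "complex vec \<Rightarrow> complex vec \<Rightarrow> complex vec" where
  "vkron u v = vec (dim_vec u * dim_vec v) (\<lambda>i. u $ (i div dim_vec v) * v $ (i mod dim_vec v))"

lemma vkron_carrier: "u \<in> carrier_vec a \<Longrightarrow> v \<in> carrier_vec b \<Longrightarrow> vkron u v \<in> carrier_vec (a * b)"
  by (auto simp: vkron_def)

lemma vnorm_vkron: "vnorm (vkron u v) = vnorm u * vnorm v"
proof -
  have "(\<Sum>i<dim_vec u * dim_vec v. (cmod (vkron u v $ i))\<^sup>2) =
     (\<Sum>i<dim_vec u * dim_vec v. (cmod (u $ (i div dim_vec v)))\<^sup>2 * (cmod (v $ (i mod dim_vec v)))\<^sup>2)"
    by (intro sum.cong refl) (simp add: vkron_def norm_mult power_mult_distrib)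
  also have "\<dots> = (\<Sum>x<dim_vec u. (cmod (u $ x))\<^sup>2) * (\<Sum>y<dim_vec v. (cmod (v $ y))\<^sup>2)"
    unfolding sum_div_mod[of "\<lambda>x y. (cmod (u $ x))\<^sup>2 * (cmod (v $ y))\<^sup>2"] sum_product ..
  finally show ?thesis by (simp add: vnorm_def vkron_def real_sqrt_mult)
qed

lemma kron_ketbra: "kron (ketbra u) (ketbra v) = ketbra (vkron u v)"
proof (rule sq_eqI)
  let ?a = "dim_vec u" and ?b = "dim_vec v"
  have c: "ketbra u \<in> carrier_mat ?a ?a" "ketbra v \<in> carrier_mat ?b ?b" by (auto simp: ketbra_def)
  show "kron (ketbra u) (ketbra v) \<in> sq (?a * ?b)" by (rule kron_carrier[OF c])
  show "ketbra (vkron u v) \<in> sq (?a * ?b)" by (auto simp: ketbra_def vkron_def)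
  fix i j assume ij: "i < ?a * ?b" "j < ?a * ?b"
  show "kron (ketbra u) (ketbra v) $$ (i,j) = ketbra (vkron u v) $$ (i,j)"
    unfolding kron_index[OF c ij] using ij div_mod_lt[OF ij(1)] div_mod_lt[OF ij(2)]
    by (simp add: ketbra_def vkron_def)
qed

lemma tnorm_le_kron_ketbra:
  assumes "tnorm_le a A s" "w \<in> carrier_vec b" "vnorm w = 1"
  shows "tnorm_le (a * b) (kron A (ketbra w)) s"
  using assms(1)
proof (induction rule: tnorm_le.induct)
  case (tnorm_zero t)
  then show ?case by (simp add: kron_zero(1)[OF ketbra_carrier[OF assms(2)]] tnorm_le.tnorm_zero)
next
  case (tnorm_add_ketbra A t v c)
  have "tnorm_le (a * b) (kron A (ketbra w) + c \<cdot>\<^sub>m ketbra (vkron v w)) (t + cmod c)"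
    using tnorm_add_ketbra assms vkron_carrier[of v a w b] by (intro tnorm_le.tnorm_add_ketbra) (auto simp: vnorm_vkron)
  moreover have "kron (A + c \<cdot>\<^sub>m ketbra v) (ketbra w) = kron A (ketbra w) + c \<cdot>\<^sub>m ketbra (vkron v w)"
    using kron_linear(1)[OF tnorm_le_carrier[OF tnorm_add_ketbra(1)] ketbra_carrier[OF tnorm_add_ketbra(2)]
        ketbra_carrier[OF assms(2)] ketbra_carrier[OF assms(2)]] by (simp add: kron_ketbra)
  ultimately show ?case by simp
qed

text \<open>Both factors are expanded into rank-one terms, and the Kronecker product of two unit
  vectors is again a unit vector.\<close>

lemma tnorm_le_kron:
  assumes "tnorm_le a A s" "tnorm_le b B t"
  shows "tnorm_le (a * b) (kron A B) (s * t)"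
  using assms(2)
proof (induction rule: tnorm_le.induct)
  case (tnorm_zero t)
  then show ?case
    using tnorm_le_nonneg[OF assms(1)] by (simp add: kron_zero(2)[OF tnorm_le_carrier[OF assms(1)]] tnorm_le.tnorm_zero)
next
  case (tnorm_add_ketbra B t w c)
  have "tnorm_le (a * b) (kron A B + c \<cdot>\<^sub>m kron A (ketbra w)) (s * t + cmod c * s)"
    by (intro tnorm_le_add tnorm_add_ketbra.IH tnorm_le_smult tnorm_le_kron_ketbra assms(1) tnorm_add_ketbra.hyps)
  moreover have "kron A (B + c \<cdot>\<^sub>m ketbra w) = kron A B + c \<cdot>\<^sub>m kron A (ketbra w)"
    by (rule kron_linear(2)[OF tnorm_le_carrier[OF assms(1)] tnorm_le_carrier[OF assms(1)]
        tnorm_le_carrier[OF tnorm_add_ketbra(1)] ketbra_carrier[OF tnorm_add_ketbra(2)]])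
  ultimately show ?case by (simp add: algebra_simps)
qed

lemma tnorm_le_kron_pow: "tnorm_le a A 1 \<Longrightarrow> tnorm_le (a ^ m) (kron_pow A m) 1"
proof (induction m)
  case 0
  \<comment> \<open>The empty power is the 1 x 1 identity, itself a rank-one projector.\<close>
  have "ketbra (vec 1 (\<lambda>_. 1)) = 1\<^sub>m 1" by (rule eq_matI) (auto simp: ketbra_def)
  then show ?case using tnorm_le_ketbra[of "vec 1 (\<lambda>_. 1)" 1 1] by (simp add: vnorm_def one_smult_cmat)
next
  case (Suc m)
  then show ?case using tnorm_le_kron[OF Suc.prems Suc.IH[OF Suc.prems]] by simp
qed

lemma kron_pow_carrier: "A \<in> sq a \<Longrightarrow> kron_pow A m \<in> sq (a ^ m)"
  by (induction m) (auto intro: kron_carrier)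

text \<open>One telescoping step splits the difference into (A - B) times a power of A and B times
  the difference of the lower powers; the accompanying factors have trace norm at most 1, so each
  copy costs t once.\<close>

lemma tnorm_le_kron_pow_diff:
  assumes "tnorm_le a A 1" "tnorm_le a B 1" "tnorm_le a (A - B) t"
  shows "tnorm_le (a ^ m) (kron_pow A m - kron_pow B m) (real m * t)"
proof (induction m)
  case 0
  have "kron_pow A 0 - kron_pow B 0 = 0\<^sub>m 1 1" by (rule eq_matI) auto
  then show ?case using tnorm_zero[of 0 1] by (simp only: power_0 of_nat_0 mult_zero_left)
next
  case (Suc m)
  note c = tnorm_le_carrier[OF assms(1)] tnorm_le_carrier[OF assms(2)]
  note k = kron_pow_carrier[OF c(1), of m] kron_pow_carrier[OF c(2), of m]
  have "kron_pow A (Suc m) - kron_pow B (Suc m) =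
    kron (A - B) (kron_pow A m) + kron B (kron_pow A m - kron_pow B m)"
    unfolding kron_pow.simps kron_linear(3)[OF c k(1,1)] kron_linear(4)[OF c(2,2) k]
    using kron_carrier[OF c(1) k(1)] kron_carrier[OF c(2) k(1)] kron_carrier[OF c(2) k(2)]
    by (intro sq_eqI[of _ "a * a ^ m"]) (auto intro!: minus_carrier_mat)
  moreover have "tnorm_le (a * a ^ m) (kron (A - B) (kron_pow A m) + kron B (kron_pow A m - kron_pow B m)) (t * 1 + 1 * (real m * t))"
    by (intro tnorm_le_add tnorm_le_kron assms Suc tnorm_le_kron_pow)
  ultimately show ?case by (simp add: algebra_simps)
qed

lemma tnorm_le_spec:
  assumes "spec N A U r"
  shows "tnorm_le N A (\<Sum>i<N. \<bar>r i\<bar>)"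
proof -
  note s = specD[OF assms] and u = unitary_matD[OF specD(1)[OF assms]]
  \<comment> \<open>Partial sums of the spectral decomposition, so that the eigenprojections are
    added one at a time.\<close>
  define B where "B m = mat N N (\<lambda>(a,b). \<Sum>i<m. U $$ (a,i) * r i * cnj (U $$ (b,i)))" for m
  have B: "tnorm_le N (B m) (\<Sum>i<m. \<bar>r i\<bar>)" if "m \<le> N" for m
    using that
  proof (induction m)
    case 0
    have "B 0 = 0\<^sub>m N N" unfolding B_def by (rule eq_matI) auto
    then show ?case by (simp add: tnorm_zero)
  next
    case (Suc m)
    have "tnorm_le N (B m + complex_of_real (r m) \<cdot>\<^sub>m ketbra (col U m)) ((\<Sum>i<m. \<bar>r i\<bar>) + cmod (complex_of_real (r m)))"
      using Suc u(1) spec_eigenvector_form(3)[OF assms, of m] by (intro tnorm_add_ketbra) auto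
    moreover have "B (Suc m) = B m + complex_of_real (r m) \<cdot>\<^sub>m ketbra (col U m)"
      using Suc.prems u(1) unfolding B_def by (intro eq_matI) (auto simp: ketbra_def algebra_simps)
    ultimately show ?case by simp
  qed
  have "A = B N"
  proof (rule sq_eqI[OF s(3)])
    fix a b assume ab: "a < N" "b < N"
    have "A $$ (a,b) = (\<Sum>i<N. (U * rdiag N r) $$ (a,i) * madj U $$ (i,b))"
      unfolding s(2) by (rule mult_index) (use u ab in auto)
    also have "\<dots> = B N $$ (a,b)" using u(1) ab
      by (auto simp: B_def mat_diag_mult_right[of _ N N] intro!: sum.cong)
    finally show "A $$ (a,b) = B N $$ (a,b)" .
  qed (simp add: B_def)
  then show ?thesis using B[of N] by simp
qed

section \<open>Duality of trace norm and operator norm\<close>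

lemma vnorm_L2: "vnorm v = L2_set (\<lambda>i. cmod (v $ i)) {..<dim_vec v}"
  by (simp add: vnorm_def L2_set_def)

lemma cprod_le:
  assumes "v \<in> carrier_vec N" "w \<in> carrier_vec N"
  shows "cmod (v \<bullet>c w) \<le> vnorm v * vnorm w"
proof -
  have "cmod (v \<bullet>c w) \<le> (\<Sum>i<N. \<bar>cmod (v $ i)\<bar> * \<bar>cmod (w $ i)\<bar>)"
    unfolding cprod_sum[OF assms(2)] by (rule order_trans[OF norm_sum]) (simp add: norm_mult)
  also have "\<dots> \<le> vnorm v * vnorm w" unfolding vnorm_L2
    using assms L2_set_mult_ineq[of "\<lambda>i. cmod (v $ i)" "\<lambda>i. cmod (w $ i)" "{..<N}"] by simp
  finally show ?thesis .
qed

lemma vnorm_mult_le_op_norm: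
  assumes X: "X \<in> sq N" and v: "v \<in> carrier_vec N" "vnorm v \<le> 1"
  shows "vnorm (X *\<^sub>v v) \<le> op_norm X"
  unfolding op_norm_def
proof (rule cSup_upper)
  show "vnorm (X *\<^sub>v v) \<in> {vnorm (X *\<^sub>v v) |v. v \<in> carrier_vec (dim_col X) \<and> vnorm v \<le> 1}" using X v by auto
  \<comment> \<open>The supremum in \<open>op_norm\<close> is informative only for a bounded set;
    the sum of the moduli of all entries is a crude bound.\<close>
  show "bdd_above {vnorm (X *\<^sub>v v) |v. v \<in> carrier_vec (dim_col X) \<and> vnorm v \<le> 1}"
  proof (rule bdd_aboveI)
    fix x assume "x \<in> {vnorm (X *\<^sub>v v) |v. v \<in> carrier_vec (dim_col X) \<and> vnorm v \<le> 1}"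
    then obtain w where w: "x = vnorm (X *\<^sub>v w)" "w \<in> carrier_vec N" "vnorm w \<le> 1" using X by auto
    have w1: "cmod (w $ l) \<le> 1" if "l < N" for l
    proof -
      have "cmod (w $ l) \<le> L2_set (\<lambda>i. cmod (w $ i)) {..<dim_vec w}"
        using w(2) that by (intro member_le_L2_set) auto
      then show ?thesis using w(3) unfolding vnorm_L2 by simp
    qed
    have "x \<le> (\<Sum>i<N. cmod ((X *\<^sub>v w) $ i))"
      unfolding w(1) vnorm_L2 using X by simp (rule L2_set_le_sum, simp)
    also have "\<dots> \<le> (\<Sum>i<N. \<Sum>l<N. cmod (X $$ (i,l)))"
    proof (rule sum_mono)
      fix i assume "i \<in> {..<N}"
      then have "cmod ((X *\<^sub>v w) $ i) \<le> (\<Sum>l<N. cmod (X $$ (i,l) * w $ l))"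
        using mult_vec_index[OF X w(2)] by simp (rule norm_sum)
      also have "\<dots> \<le> (\<Sum>l<N. cmod (X $$ (i,l)))"
        using w1 by (intro sum_mono) (auto simp: norm_mult mult_left_le)
      finally show "cmod ((X *\<^sub>v w) $ i) \<le> (\<Sum>l<N. cmod (X $$ (i,l)))" .
    qed
    finally show "x \<le> (\<Sum>i<N. \<Sum>l<N. cmod (X $$ (i,l)))" .
  qed
qed

lemma op_norm_nonneg:
  assumes "X \<in> sq N"
  shows "op_norm X \<ge> 0"
  using order_trans[OF vnorm_nonneg vnorm_mult_le_op_norm[OF assms, of "0\<^sub>v N"]] vnorm_eq_0[of "0\<^sub>v N" N] by simp

lemma mtrace_mult_ketbra:
  assumes X: "X \<in> sq N" and w: "w \<in> carrier_vec N"
  shows "mtrace (X * ketbra w) = (X *\<^sub>v w) \<bullet>c w"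
proof -
  have "mtrace (X * ketbra w) = (\<Sum>i<N. \<Sum>j<N. X $$ (i,j) * ketbra w $$ (j,i))"
    by (rule mtrace_mult[OF X ketbra_carrier[OF w]])
  also have "\<dots> = (\<Sum>i<N. (X *\<^sub>v w) $ i * cnj (w $ i))"
    using w by (intro sum.cong refl) (auto simp: mult_vec_index[OF X w] sum_distrib_right ketbra_def mult.assoc intro!: sum.cong)
  finally show ?thesis by (simp add: cprod_sum[OF w])
qed

text \<open>On a rank-one term the trace is its coefficient times a quadratic form at a unit vector,
  which Cauchy-Schwarz bounds by the operator norm.\<close>

lemma mtrace_mult_le:
  assumes X: "X \<in> sq N" and A: "tnorm_le N A t"
  shows "cmod (mtrace (X * A)) \<le> op_norm X * t"
  using A
proof (induction rule: tnorm_le.induct)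
  case (tnorm_zero t)
  have "X * 0\<^sub>m N N = 0\<^sub>m N N" using X by simp
  then show ?case using op_norm_nonneg[OF X] tnorm_zero by (simp add: mtrace_def)
next
  case (tnorm_add_ketbra A t w c)
  note c = tnorm_le_carrier[OF tnorm_add_ketbra(1)] ketbra_carrier[OF tnorm_add_ketbra(2)]
  have "X * (A + c \<cdot>\<^sub>m ketbra w) = X * A + c \<cdot>\<^sub>m (X * ketbra w)"
    using mult_add_distrib_mat[OF X c(1) smult_carrier_mat[OF c(2), of c]] mult_smult_distrib[OF X c(2), of c] by simp
  then have "mtrace (X * (A + c \<cdot>\<^sub>m ketbra w)) = mtrace (X * A) + c * ((X *\<^sub>v w) \<bullet>c w)"
    using sq_closed[OF X c(1)] sq_closed[OF X c(2)] mtrace_mult_ketbra[OF X tnorm_add_ketbra(2)]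
    by (simp add: mtrace_add[of _ N] mtrace_smult[of _ N])
  also have "cmod \<dots> \<le> cmod (mtrace (X * A)) + cmod c * cmod ((X *\<^sub>v w) \<bullet>c w)"
    by (rule order_trans[OF norm_triangle_ineq]) (simp add: norm_mult)
  also have "\<dots> \<le> op_norm X * t + cmod c * op_norm X"
  proof (intro add_mono mult_left_mono tnorm_add_ketbra.IH)
    have "cmod ((X *\<^sub>v w) \<bullet>c w) \<le> vnorm (X *\<^sub>v w) * vnorm w"
      by (rule cprod_le[OF vec_closed[OF X tnorm_add_ketbra(2)] tnorm_add_ketbra(2)])
    also have "\<dots> \<le> op_norm X" using vnorm_mult_le_op_norm[OF X tnorm_add_ketbra(2)] tnorm_add_ketbra(3) by simp
    finally show "cmod ((X *\<^sub>v w) \<bullet>c w) \<le> op_norm X" .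
  qed simp
  finally show ?case by (simp add: algebra_simps)
qed

lemma density_tnorm:
  assumes "density_mat N A"
  shows "tnorm_le N A 1"
proof -
  obtain U r where r: "spec N A U r" "\<And>i. i < N \<Longrightarrow> r i \<ge> 0" using psd_spec assms by (metis density_mat_def)
  have "(\<Sum>i<N. r i) = 1" using spec_mtrace[OF r(1)] assms unfolding density_mat_def by (metis of_real_eq_1_iff)
  moreover have "(\<Sum>i<N. \<bar>r i\<bar>) = (\<Sum>i<N. r i)" using r(2) by (intro sum.cong) auto
  ultimately show ?thesis using tnorm_le_spec[OF r(1)] by simp
qed

section \<open>Distance of the noisy state from the maximally mixed state\<close>

lemma spec_shift:
  assumes "spec N A U r"
  shows "spec N (A - complex_of_real s \<cdot>\<^sub>m 1\<^sub>m N) U (\<lambda>i. r i - s)"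
proof -
  note u = unitary_matD[OF specD(1)[OF assms]]
  have e: "rdiag N (\<lambda>i. r i - s) = rdiag N r - complex_of_real s \<cdot>\<^sub>m 1\<^sub>m N"
    by (rule sq_eqI[of _ N]) (auto simp: mat_diag_def intro!: minus_carrier_mat)
  have c: "rdiag N r \<in> sq N" "complex_of_real s \<cdot>\<^sub>m 1\<^sub>m N \<in> sq N" by auto
  have "U * rdiag N (\<lambda>i. r i - s) * madj U = U * rdiag N r * madj U - U * (complex_of_real s \<cdot>\<^sub>m 1\<^sub>m N) * madj U"
    unfolding e mult_minus_distrib_mat[OF u(1) c]
    by (rule minus_mult_distrib_mat[OF sq_closed[OF u(1) c(1)] sq_closed[OF u(1) c(2)] u(2)])
  also have "U * (complex_of_real s \<cdot>\<^sub>m 1\<^sub>m N) * madj U = complex_of_real s \<cdot>\<^sub>m 1\<^sub>m N"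
    unfolding mult_smult_distrib[OF u(1) one_carrier_mat] right_mult_one_mat[OF u(1)] mult_smult_assoc_mat[OF u(1,2)] u(4) ..
  finally show ?thesis using specD(1,2)[OF assms] by (simp add: spec_def)
qed

lemma pd_tnorm_mixed:
  assumes "pd N A" "mtrace A = 1" "N > 0"
  shows "tnorm_le N (A - complex_of_real (1 / real N) \<cdot>\<^sub>m 1\<^sub>m N) (sqrt (2 * (neg_entropy N A + ln N)))"
proof -
  obtain U r where r: "spec N A U r" "\<And>i. i < N \<Longrightarrow> r i > 0" using pd_spec[OF assms(1)] by metis
  have "(\<Sum>i<N. r i) = 1" using spec_mtrace[OF r(1)] assms(2) by (metis of_real_eq_1_iff)
  from pinsker_uniform[OF r(2) this assms(3)]
  have "(\<Sum>i<N. \<bar>r i - 1 / real N\<bar>) \<le> sqrt (2 * (neg_entropy N A + ln N))"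
    using neg_entropy_spec[OF r] by (intro real_le_rsqrt) simp
  then show ?thesis using tnorm_le_mono[OF tnorm_le_spec[OF spec_shift[OF r(1), of "1 / real N"]]] by blast
qed

lemma kron_pow_smult: "A \<in> sq a \<Longrightarrow> kron_pow (c \<cdot>\<^sub>m A) m = c ^ m \<cdot>\<^sub>m kron_pow A m"
proof (induction m)
  case (Suc m)
  note k = kron_pow_carrier[OF Suc.prems, of m]
  have "c \<cdot>\<^sub>m A \<in> sq a" using Suc.prems by simp
  then have "kron (c \<cdot>\<^sub>m A) (c ^ m \<cdot>\<^sub>m kron_pow A m) = c ^ m \<cdot>\<^sub>m (c \<cdot>\<^sub>m kron A (kron_pow A m))"
    using kron_linear(6)[OF _ _ k k, of "c \<cdot>\<^sub>m A" a "c \<cdot>\<^sub>m A" "c ^ m"] kron_linear(5)[OF Suc.prems Suc.prems k k, of c] by simp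
  also have "\<dots> = c ^ Suc m \<cdot>\<^sub>m kron A (kron_pow A m)"
    using kron_carrier[OF Suc.prems k] by (intro eq_matI) auto
  finally show ?case using Suc by simp
qed (auto intro: eq_matI)

text \<open>The estimate for the regularized input \<tau>, divided by e. The initial deficit is at
  most n ln 2 because the negative entropy of a state is nonpositive; the factor 2 from Pinsker's
  inequality turns ln 2 into ln 4.\<close>

lemma noisy_state_tnorm:
  fixes n :: nat and p :: "nat \<Rightarrow> real" and q e :: real
  assumes \<rho>: "density_mat (2^n) \<rho>" and p: "\<And>i. i < n \<Longrightarrow> 0 \<le> p i \<and> p i \<le> 1 \<and> 1 - p i \<le> q"
    and q: "0 \<le> q" "q \<le> 1" and U: "\<forall>U\<in>set Us. unitary_mat (2^n) U" and e: "0 < e" "e < 1"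
  shows "tnorm_le (2^n) (noisy_state n p Us \<rho> - complex_of_real (1 / 2^n) \<cdot>\<^sub>m 1\<^sub>m (2^n))
    (sqrt (ln 4) * sqrt (real n) * q ^ (length Us + 1) / e)"
proof -
  let ?N = "2^n :: nat" and ?\<pi> = "complex_of_real (1 / 2^n) \<cdot>\<^sub>m 1\<^sub>m (2^n)"
  have c: "\<rho> \<in> sq ?N" and tr: "mtrace \<rho> = 1" using \<rho> by (auto simp: density_mat_def psd_carrier)
  define b where "b = (1 - e) / 2^n"
  have b: "b > 0" using e by (simp add: b_def)
  define \<tau> where "\<tau> = complex_of_real e \<cdot>\<^sub>m \<rho> + complex_of_real b \<cdot>\<^sub>m 1\<^sub>m ?N"
  have "\<tau> = complex_of_real b \<cdot>\<^sub>m 1\<^sub>m ?N + complex_of_real e \<cdot>\<^sub>m \<rho>"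
    unfolding \<tau>_def using c by (intro comm_add_mat[of _ ?N ?N]) auto
  moreover have "pd ?N (complex_of_real b \<cdot>\<^sub>m 1\<^sub>m ?N + complex_of_real e \<cdot>\<^sub>m \<rho>)"
    using \<rho> e by (intro pd_add_psd pd_smult psd_smult pd_one b) (auto simp: density_mat_def)
  ultimately have pd: "pd ?N \<tau>" by simp
  have "mtrace \<tau> = complex_of_real e + complex_of_real b * of_nat ?N"
    unfolding \<tau>_def using c by (simp add: mtrace_add[of _ ?N] mtrace_smult[of _ ?N] tr) (simp add: mtrace_def)
  also have "\<dots> = 1" by (simp add: b_def field_simps)
  finally have tr\<tau>: "mtrace \<tau> = 1" .
  define \<sigma> where "\<sigma> = noisy_state n p Us \<rho>"
  define \<sigma>' where "\<sigma>' = noisy_state n p Us \<tau>"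
  have p': "0 \<le> p i \<and> p i \<le> 1" if "i < n" for i using p[OF that] by auto
  have d: "density_mat ?N \<sigma>" unfolding \<sigma>_def by (rule density_noisy_state[OF \<rho> p' U])
  have \<sigma>: "\<sigma> \<in> sq ?N" using d by (auto simp: density_mat_def psd_carrier)
  have "density_mat ?N \<tau>" using pd tr\<tau> by (simp add: density_mat_def pd_psd)
  from density_noisy_state[OF this p' U] have tr': "mtrace \<sigma>' = 1" by (simp add: \<sigma>'_def density_mat_def)
  note ent = noisy_state_entropy[OF pd tr\<tau> p q U]
  have aff: "\<sigma>' = complex_of_real e \<cdot>\<^sub>m \<sigma> + complex_of_real b \<cdot>\<^sub>m 1\<^sub>m ?N"
    unfolding \<sigma>'_def \<tau>_def \<sigma>_def by (rule noisy_state_affine[OF c U])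
  have "neg_entropy ?N \<sigma>' + n * ln 2 \<le> q ^ (2 * (length Us + 1)) * (neg_entropy ?N \<tau> + n * ln 2)"
    using ent(1) unfolding \<sigma>'_def .
  also have "\<dots> \<le> q ^ (2 * (length Us + 1)) * (n * ln 2)"
    using neg_entropy_nonpos[OF pd tr\<tau>] q by (intro mult_left_mono) auto
  also have "q ^ (2 * (length Us + 1)) = (q ^ (length Us + 1))\<^sup>2"
    by (simp only: power_mult[symmetric] mult.commute)
  finally have "2 * (neg_entropy ?N \<sigma>' + n * ln 2) \<le> 2 * ((q ^ (length Us + 1))\<^sup>2 * (n * ln 2))"
    by (rule mult_left_mono) simp
  moreover have "ln (real ?N) = n * ln 2" by (simp add: ln_realpow)
  moreover have "(q ^ (length Us + 1))\<^sup>2 * (n * (2 * ln 2)) = 2 * ((q ^ (length Us + 1))\<^sup>2 * (n * ln 2))" by simp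
  ultimately have "2 * (neg_entropy ?N \<sigma>' + ln ?N) \<le> (q ^ (length Us + 1))\<^sup>2 * (n * (2 * ln 2))" by (simp only:)
  moreover have "ln 4 = 2 * ln (2::real)" using ln_realpow[of 2 2] by simp
  ultimately have "sqrt (2 * (neg_entropy ?N \<sigma>' + ln ?N)) \<le> sqrt ((q ^ (length Us + 1))\<^sup>2 * (n * ln 4))"
    by (simp only: real_sqrt_le_iff)
  also have "\<dots> = sqrt (ln 4) * sqrt (real n) * q ^ (length Us + 1)"
    using q by (simp add: real_sqrt_mult)
  finally have le: "sqrt (2 * (neg_entropy ?N \<sigma>' + ln ?N)) \<le> sqrt (ln 4) * sqrt (real n) * q ^ (length Us + 1)" .
  have "pd ?N \<sigma>'" using ent(2) unfolding \<sigma>'_def .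
  from tnorm_le_mono[OF pd_tnorm_mixed[OF this tr'] le]
  have "tnorm_le ?N (\<sigma>' - ?\<pi>) (sqrt (ln 4) * sqrt (real n) * q ^ (length Us + 1))" by simp
  note * = tnorm_le_smult[OF this, of "complex_of_real (1 / e)"]
  have "tnorm_le ?N (complex_of_real (1 / e) \<cdot>\<^sub>m (\<sigma>' - ?\<pi>)) (sqrt (ln 4) * sqrt (real n) * q ^ (length Us + 1) / e)"
  proof -
    have "cmod (complex_of_real (1 / e)) = 1 / e" unfolding norm_of_real using e by simp
    then have "cmod (complex_of_real (1 / e)) * (sqrt (ln 4) * sqrt (real n) * q ^ (length Us + 1)) =
        sqrt (ln 4) * sqrt (real n) * q ^ (length Us + 1) / e" by (simp only: times_divide_eq_left mult_1_left)
    with * show ?thesis by simp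
  qed
  \<comment> \<open>The identity parts combine to b - 1/2^n = -e/2^n, so the whole difference
    carries the factor e.\<close>
  moreover have "complex_of_real (1 / e) \<cdot>\<^sub>m (\<sigma>' - ?\<pi>) = \<sigma> - ?\<pi>"
    unfolding aff
  proof (rule sq_eqI[of _ ?N])
    fix i j :: nat assume ij: "i < 2^n" "j < 2^n"
    show "(complex_of_real (1 / e) \<cdot>\<^sub>m (complex_of_real e \<cdot>\<^sub>m \<sigma> + complex_of_real b \<cdot>\<^sub>m 1\<^sub>m ?N - ?\<pi>)) $$ (i,j) = (\<sigma> - ?\<pi>) $$ (i,j)"
      using \<sigma> ij e by (auto simp: b_def field_simps)
  qed (use \<sigma> in \<open>auto intro!: minus_carrier_mat\<close>)
  ultimately show ?thesis unfolding \<sigma>_def by simp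
qed

theorem theorem1:
  fixes n M k d :: nat and p :: "nat \<Rightarrow> real" and \<rho> X :: "complex mat"
    and Us :: "complex mat list" and z :: "complex vec"
  assumes "n \<ge> 1"
    and "\<forall>i<n. 0 < p i \<and> p i \<le> 1"
    and "density_op n \<rho>"
    and "\<forall>U \<in> set Us. unitary_mat (2^n) U"
    and "z \<in> carrier_vec d" and "vnorm z = 1"
    and "M \<ge> 1"
    and "X \<in> carrier_mat (2^(M*n) * d^k) (2^(M*n) * d^k)"
  shows "let \<sigma> = noisy_state n p Us \<rho>;
             q = Max ((\<lambda>i. 1 - p i) ` {..<n});
             P0 = kron_pow (ketbra z) k
         in cmod (mtrace (X * kron (kron_pow \<sigma> M) P0)
                  - mtrace (X * kron ((1 / 2^(M*n)) \<cdot>\<^sub>m kron_pow (1\<^sub>m (2^n)) M) P0))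
            \<le> sqrt (ln 4) * op_norm X * real M * sqrt (real n) * q ^ (length Us + 1)"
proof -
  define q where "q = Max ((\<lambda>i. 1 - p i) ` {..<n})"
  define \<sigma> where "\<sigma> = noisy_state n p Us \<rho>"
  define P0 where "P0 = kron_pow (ketbra z) k"
  define \<pi> where "\<pi> = complex_of_real (1 / 2^n) \<cdot>\<^sub>m 1\<^sub>m (2^n)"
  let ?N = "2^n :: nat"
  have qi: "1 - p i \<le> q" if "i < n" for i unfolding q_def using that by (intro Max_ge) auto
  \<comment> \<open>Since there is at least one qubit, the maximum is one of the values 1 - p i and
    so lies in [0,1].\<close>
  have "q \<in> (\<lambda>i. 1 - p i) ` {..<n}" unfolding q_def using assms(1) by (intro Max_in) (auto simp: lessThan_empty_iff)
  then have q: "0 \<le> q" "q \<le> 1" using assms(2) by fastforce+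
  have p: "0 \<le> p i \<and> p i \<le> 1 \<and> 1 - p i \<le> q" if "i < n" for i using assms(2) qi that by auto
  have \<rho>: "density_mat ?N \<rho>" using assms(3) by (auto simp: density_op_def density_mat_def psd_def)
  have d\<sigma>: "density_mat ?N \<sigma>" unfolding \<sigma>_def by (rule density_noisy_state[OF \<rho> _ assms(4)]) (use p in auto)
  have "psd ?N \<pi>" unfolding \<pi>_def by (intro psd_smult pd_psd pd_one) simp
  moreover have "mtrace \<pi> = 1" unfolding \<pi>_def by (simp add: mtrace_smult[of _ ?N]) (simp add: mtrace_def)
  ultimately have d\<pi>: "density_mat ?N \<pi>" by (simp add: density_mat_def)
  have P0: "tnorm_le (d^k) P0 1" unfolding P0_def
    using tnorm_le_kron_pow[OF tnorm_le_ketbra[OF assms(5,6), of 1, unfolded norm_one]] 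
    by (simp add: one_smult_cmat)
  have NM: "?N ^ M = 2 ^ (M * n)" by (simp add: mult.commute flip: power_mult)
  have X: "X \<in> sq (?N ^ M * d ^ k)" using assms(8) by (simp add: NM)
  have k\<pi>: "kron_pow \<pi> M = (1 / 2^(M*n)) \<cdot>\<^sub>m kron_pow (1\<^sub>m ?N) M"
    unfolding \<pi>_def kron_pow_smult[OF one_carrier_mat]
    by (simp add: power_one_over mult.commute flip: power_mult)
  note c = tnorm_le_carrier[OF density_tnorm[OF d\<sigma>]] tnorm_le_carrier[OF density_tnorm[OF d\<pi>]] tnorm_le_carrier[OF P0]
  note kc = kron_pow_carrier[OF c(1), of M] kron_pow_carrier[OF c(2), of M]
  define V where "V = cmod (mtrace (X * kron (kron_pow \<sigma> M) P0) - mtrace (X * kron (kron_pow \<pi> M) P0))"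
  have V: "V = cmod (mtrace (X * kron (kron_pow \<sigma> M - kron_pow \<pi> M) P0))"
    unfolding V_def kron_linear(3)[OF kc c(3,3)]
      mult_minus_distrib_mat[OF X kron_carrier[OF kc(1) c(3)] kron_carrier[OF kc(2) c(3)]]
    by (subst mtrace_minus[OF sq_closed[OF X kron_carrier[OF kc(1) c(3)]] sq_closed[OF X kron_carrier[OF kc(2) c(3)]]]) simp
  define T where "T = sqrt (ln 4) * sqrt (real n) * q ^ (length Us + 1)"
  have "V \<le> op_norm X * real M * T"
  \<comment> \<open>The left side does not depend on the regularization, so the bounds with T / e
    for all e in (0,1) yield the one with T.\<close>
  proof (rule field_le_mult_one_interval)
    fix e :: real assume e: "0 < e" "e < 1"
    have "tnorm_le ?N (\<sigma> - \<pi>) (T / e)"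
      unfolding \<sigma>_def \<pi>_def T_def by (rule noisy_state_tnorm[OF \<rho> p q assms(4) e])
    then have "tnorm_le (?N ^ M * d ^ k) (kron (kron_pow \<sigma> M - kron_pow \<pi> M) P0) (real M * (T / e) * 1)"
      by (intro tnorm_le_kron tnorm_le_kron_pow_diff density_tnorm d\<sigma> d\<pi> P0)
    from mtrace_mult_le[OF X this] have "V \<le> op_norm X * real M * T / e" unfolding V by simp
    then show "e * V \<le> op_norm X * real M * T" using e by (simp add: field_simps)
  qed
  then show ?thesis
    unfolding Let_def q_def[symmetric] \<sigma>_def[symmetric] P0_def[symmetric] k\<pi>[symmetric] V_def[symmetric]
    by (simp add: T_def algebra_simps)
qed

end
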